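(* Let $C\subset\mathbb{R}^2$ be the circle (closed disk) with center $(a,b)\in\mathbb{R}^2$ and radius $r>0$, and let $\mathcal{S}=\bigcup_{i=0}^{\infty} C_i\cap\mathbb{N}^2$, where $C_i=iC$ is the disk with center $(ia,ib)$ and radius $ir$. Assume that $\mathcal{S}$ is a simplicial affine (i.e. finitely generated) semigroup, let $\{n_1,\ldots,n_m\}$ be its minimal system of generators, and let $\overline{\mathcal{S}}=\{x\in\mathbb{N}^2 \mid x+n_i\in\mathcal{S}\ \text{for all } i=1,\ldots,m\}$. Let $\mathcal{C}=L_{\mathbb{Q}_{\geq}}(C\cap\mathbb{R}^2_{\geq})\cap\mathbb{N}^2$ be the positive integer cone of $C$, with extremal rays $\tau_1,\tau_2$. Then $\mathcal{S}$ is Buchsbaum if and only if $\mathrm{int}(\mathcal{C})=\mathrm{int}(\overline{\mathcal{S}})$ and, for each $j=1,2$, the semigroup $\overline{\mathcal{S}}\cap\tau_j$ is generated by only one element.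
   Context: Here $\mathbb{N}$ contains $0$. For a set $G\subset\mathbb{R}^2_{\geq}$ (points with nonnegative coordinates), $L_{\mathbb{Q}_{\geq}}(G)=\{\sum_{i=1}^p q_if_i \mid p\in\mathbb{N},\ q_i\in\mathbb{Q}_{\geq},\ f_i\in G\}$. An affine semigroup $S\subset\mathbb{N}^2$ is a finitely generated submonoid of $\mathbb{N}^2$; it is simplicial if the cone $L_{\mathbb{Q}_{\geq}}(S)$ equals $L_{\mathbb{Q}_{\geq}}(\{s_1,s_2\})$ for two (linearly independent) elements $s_1,s_2$ of its generating set. (The semigroup $\mathcal{S}$ is simplicial when $C\cap\mathbb{R}^2_{\geq}$ has at least two points.) Let $\Bbbk$ be a field. The semigroup ring $\Bbbk[S]$ is the subring of $\Bbbk[t_1,t_2]$ generated by the monomials $t_1^{s_1}t_2^{s_2}$ with $(s_1,s_2)\in S$; $S$ is called Buchsbaum if $\Bbbk[S]$ is a Buchsbaum ring. The rays $\tau_1,\tau_2$ are the two extremal rays (half-lines from the origin) of the cone spanned by $\mathcal{C}$, $\tau_1$ being the one with greater slope. For $X\subset\mathcal{C}$ (in particular $X=\mathcal{C}$ or $X=\overline{\mathcal{S}}$, which is contained in $\mathcal{C}$), $\mathrm{int}(X)=X\setminus(\tau_1\cup\tau_2)$, i.e. the elements of $X$ not lying on the boundary of the cone. *)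

theory Defs
  imports "HOL-Analysis.Analysis" "HOL-Algebra.Algebraic_Closure_Type"
    "HOL-Algebra.Generated_Rings" "HOL-Algebra.Ring_Divisibility" "HOL-Library.Extended_Nat"
begin

section \<open>Buchsbaum rings\<close>

definition fraction_rel :: "('a, 'b) ring_scheme \<Rightarrow> 'a set \<Rightarrow> (('a \<times> 'a) \<times> ('a \<times> 'a)) set" where
  "fraction_rel R M = {((a, s), (b, t)). a \<in> carrier R \<and> s \<in> M \<and> b \<in> carrier R \<and> t \<in> M \<and>
      (\<exists>u\<in>M. u \<otimes>\<^bsub>R\<^esub> (a \<otimes>\<^bsub>R\<^esub> t) = u \<otimes>\<^bsub>R\<^esub> (b \<otimes>\<^bsub>R\<^esub> s))}"

definition fraction :: "('a, 'b) ring_scheme \<Rightarrow> 'a set \<Rightarrow> 'a \<Rightarrow> 'a \<Rightarrow> ('a \<times> 'a) set" where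
  "fraction R M a s = fraction_rel R M `` {(a, s)}"

text \<open>The ring of fractions \<open>M\<^sup>-\<^sup>1R\<close>, for a commutative ring \<open>R\<close> and a multiplicative set \<open>M\<close>.
  The operations are formed over all representatives of the two classes; since
  \<^const>\<open>fraction\<close> respects \<^const>\<open>fraction_rel\<close>, each union is a single class.\<close>

definition localization :: "('a, 'b) ring_scheme \<Rightarrow> 'a set \<Rightarrow> ('a \<times> 'a) set ring" where
  "localization R M = \<lparr>
     carrier = {fraction R M a s | a s. a \<in> carrier R \<and> s \<in> M},
     monoid.mult = (\<lambda>U V. \<Union>{fraction R M (a \<otimes>\<^bsub>R\<^esub> b) (s \<otimes>\<^bsub>R\<^esub> t) | a s b t. (a, s) \<in> U \<and> (b, t) \<in> V}),
     one = fraction R M \<one>\<^bsub>R\<^esub> \<one>\<^bsub>R\<^esub>,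
     ring.zero = fraction R M \<zero>\<^bsub>R\<^esub> \<one>\<^bsub>R\<^esub>,
     add = (\<lambda>U V. \<Union>{fraction R M (a \<otimes>\<^bsub>R\<^esub> t \<oplus>\<^bsub>R\<^esub> b \<otimes>\<^bsub>R\<^esub> s) (s \<otimes>\<^bsub>R\<^esub> t) | a s b t.
        (a, s) \<in> U \<and> (b, t) \<in> V}) \<rparr>"

definition krull_dim :: "('a, 'b) ring_scheme \<Rightarrow> enat" where
  "krull_dim R = Sup {enat n | n. \<exists>P :: nat \<Rightarrow> 'a set.
     (\<forall>i\<le>n. primeideal (P i) R) \<and> (\<forall>i<n. P i \<subset> P (Suc i))}"

definition radical_ideal :: "('a, 'b) ring_scheme \<Rightarrow> 'a set \<Rightarrow> 'a set" where
  "radical_ideal R I = {y \<in> carrier R. \<exists>n::nat. y [^]\<^bsub>R\<^esub> n \<in> I}"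

definition colon_ideal :: "('a, 'b) ring_scheme \<Rightarrow> 'a set \<Rightarrow> 'a set \<Rightarrow> 'a set" where
  "colon_ideal R I E = {y \<in> carrier R. \<forall>x\<in>E. y \<otimes>\<^bsub>R\<^esub> x \<in> I}"

definition system_of_parameters :: "('a, 'b) ring_scheme \<Rightarrow> 'a set \<Rightarrow> 'a list \<Rightarrow> bool" where
  "system_of_parameters A \<mm> xs \<longleftrightarrow>
     set xs \<subseteq> carrier A \<and> enat (length xs) = krull_dim A \<and>
     radical_ideal A (genideal A (set xs)) = \<mm>"

definition weak_sequence :: "('a, 'b) ring_scheme \<Rightarrow> 'a set \<Rightarrow> 'a list \<Rightarrow> bool" where
  "weak_sequence A \<mm> xs \<longleftrightarrow>
     (\<forall>i<length xs. colon_ideal A (genideal A (set (take i xs))) {xs ! i} =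
                    colon_ideal A (genideal A (set (take i xs))) \<mm>)"

definition buchsbaum_local_ring :: "('a, 'b) ring_scheme \<Rightarrow> bool" where
  "buchsbaum_local_ring A \<longleftrightarrow> cring A \<and> noetherian_ring A \<and>
     (\<exists>\<mm>. {I. maximalideal I A} = {\<mm>} \<and>
          (\<forall>xs. system_of_parameters A \<mm> xs \<longrightarrow> weak_sequence A \<mm> xs))"

definition buchsbaum_ring :: "('a, 'b) ring_scheme \<Rightarrow> bool" where
  "buchsbaum_ring R \<longleftrightarrow> cring R \<and> noetherian_ring R \<and>
     (\<forall>\<mm>. maximalideal \<mm> R \<longrightarrow> buchsbaum_local_ring (localization R (carrier R - \<mm>)))"


section \<open>Subsemigroups of \<open>\<nat>\<^sup>2\<close> and their semigroup rings\<close>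

inductive_set submonoid_gen :: "'a::comm_monoid_add set \<Rightarrow> 'a set" for G where
  zero: "0 \<in> submonoid_gen G"
| add: "g \<in> G \<Longrightarrow> x \<in> submonoid_gen G \<Longrightarrow> g + x \<in> submonoid_gen G"

definition affine_semigroup :: "(nat \<times> nat) set \<Rightarrow> bool" where
  "affine_semigroup S \<longleftrightarrow> (\<exists>G. finite G \<and> S = submonoid_gen G)"

definition minimal_generators :: "'a::comm_monoid_add set \<Rightarrow> 'a set \<Rightarrow> bool" where
  "minimal_generators G S \<longleftrightarrow> submonoid_gen G = S \<and> (\<forall>H. H \<subset> G \<longrightarrow> submonoid_gen H \<noteq> S)"

definition pt :: "nat \<times> nat \<Rightarrow> real \<times> real" where
  "pt x = (real (fst x), real (snd x))"

definition rat_cone :: "(real \<times> real) set \<Rightarrow> (real \<times> real) set" where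
  "rat_cone G = {\<Sum>i<p. q i *\<^sub>R f i | (p::nat) q f. \<forall>i<p. q i \<in> \<rat> \<and> 0 \<le> q i \<and> f i \<in> G}"

definition simplicial :: "(nat \<times> nat) set \<Rightarrow> (nat \<times> nat) set \<Rightarrow> bool" where
  "simplicial G S \<longleftrightarrow> (\<exists>s1\<in>G. \<exists>s2\<in>G. s1 \<noteq> s2 \<and> independent {pt s1, pt s2} \<and>
     rat_cone (pt ` S) = rat_cone {pt s1, pt s2})"

text \<open>The polynomial ring \<open>\<bbbk>[t\<^sub>1, t\<^sub>2]\<close> is \<^typ>\<open>'k poly poly\<close>, that is
  \<open>\<bbbk>[t\<^sub>1][t\<^sub>2]\<close>, so \<open>t\<^sub>1\<^sup>i t\<^sub>2\<^sup>j\<close> is \<open>monom (monom 1 i) j\<close>. The ring \<open>\<bbbk>[S]\<close> contains \<open>\<bbbk>\<close>.\<close>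

definition semigroup_ring :: "(nat \<times> nat) set \<Rightarrow> 'k::field poly poly ring" where
  "semigroup_ring S = ring_of_type_algebra
     \<lparr>carrier := generate_ring ring_of_type_algebra
        (range (\<lambda>c. [:[:c:]:]) \<union> (\<lambda>(i, j). Polynomial.monom (Polynomial.monom 1 i) j) ` S)\<rparr>"

definition semigroup_bar :: "(nat \<times> nat) set \<Rightarrow> (nat \<times> nat) set \<Rightarrow> (nat \<times> nat) set" where
  "semigroup_bar G S = {x. \<forall>g\<in>G. x + g \<in> S}"


section \<open>Semigroups of a disk\<close>

definition disk_semigroup :: "real \<Rightarrow> real \<Rightarrow> real \<Rightarrow> (nat \<times> nat) set" where
  "disk_semigroup a b r = (\<Union>i::nat. {x. pt x \<in> cball (real i * a, real i * b) (real i * r)})"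

definition disk_cone :: "real \<Rightarrow> real \<Rightarrow> real \<Rightarrow> (nat \<times> nat) set" where
  "disk_cone a b r = {x. pt x \<in> rat_cone (cball (a, b) r \<inter> {0..} \<times> {0..})}"

definition extremal_ray :: "(real \<times> real) set \<Rightarrow> (real \<times> real) set \<Rightarrow> bool" where
  "extremal_ray \<tau> K \<longleftrightarrow> \<tau> face_of K \<and> (\<exists>v. v \<noteq> 0 \<and> \<tau> = {t *\<^sub>R v | t. 0 \<le> t})"

text \<open>Slopes are compared after clearing denominators, which allows a vertical ray. This is meant
  for rays in the closed first quadrant only.\<close>

definition steeper :: "(real \<times> real) set \<Rightarrow> (real \<times> real) set \<Rightarrow> bool" where
  "steeper \<tau> \<tau>' \<longleftrightarrow> (\<forall>v\<in>\<tau> - {0}. \<forall>w\<in>\<tau>' - {0}. snd w * fst v < snd v * fst w)"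

definition on_ray :: "(nat \<times> nat) set \<Rightarrow> (real \<times> real) set \<Rightarrow> (nat \<times> nat) set" where
  "on_ray E \<tau> = {x\<in>E. pt x \<in> \<tau>}"

definition int_part ::
    "(real \<times> real) set \<Rightarrow> (real \<times> real) set \<Rightarrow> (nat \<times> nat) set \<Rightarrow> (nat \<times> nat) set" where
  "int_part \<tau>\<^sub>1 \<tau>\<^sub>2 E = {x\<in>E. pt x \<notin> \<tau>\<^sub>1 \<union> \<tau>\<^sub>2}"

end

theory Submission
  imports Defs "HOL-Computational_Algebra.Fraction_Field"
begin

text \<open>Let \<open>s\<^sub>1, s\<^sub>2\<close> span the cone and let \<open>\<mm>\<close> be the maximal ideal of \<open>\<bbbk>[S]\<close> at the origin. There
  \<open>t\<^bsup>Ns\<^sub>1\<^esup>, t\<^bsup>Ns\<^sub>2\<^esup>\<close> is a system of parameters, and the Buchsbaum condition for it says that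
  \<open>\<alpha> + Ns\<^sub>1, \<alpha> + Ns\<^sub>2 \<in> S\<close> implies \<open>\<alpha> \<in> \<^bold>S\<close>, where \<open>\<^bold>S\<close> is the set of all \<open>\<alpha>\<close> with
  \<open>\<alpha> + (S - {0}) \<subseteq> S\<close>. The multiples of a disk leave no gaps: far out in the direction
  of \<open>s\<^sub>j\<close> the lattice points on any line parallel to \<open>s\<^sub>j\<close> belong to \<open>S\<close>, except possibly
  on the ray of \<open>s\<^sub>j\<close> itself when this ray is tangent to the disk. Hence all interior points of the cone lie in \<open>\<^bold>S\<close>,
  and on each ray \<open>\<^bold>S\<close> is closed under subtraction, hence generated by one element.

  Conversely, if \<open>\<^bold>S\<close> consists of the interior points and of one cyclic monoid on each ray, then
  \<open>\<alpha> + ms\<^sub>1, \<alpha> + ns\<^sub>2 \<in> \<^bold>S\<close> implies \<open>\<alpha> \<in> \<^bold>S\<close>, so nonzero polynomials in \<open>t\<^bsup>s\<^sub>1\<^esup>\<close> and in \<open>t\<^bsup>s\<^sub>2\<^esup>\<close>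
  form regular sequences on \<open>\<bbbk>[\<^bold>S]\<close>. Every maximal ideal of height two contains two such polynomials.
  If \<open>x, y\<close> are parameters and \<open>zy \<in> (x)\<close>, this yields \<open>z \<in> x\<bbbk>[\<^bold>S]\<close> after localization, and
  \<open>z\<mm> \<subseteq> (x)\<close> because \<open>\<^bold>S + (S - {0}) \<subseteq> S\<close>.\<close>

section \<open>Invariance of the Buchsbaum property under isomorphism\<close>

text \<open>Write T for the set of exponents set in bold above. The definition of Buchsbaum
  quantifies over all maximal ideals and all systems of parameters, so the origin alone does not
  settle sufficiency. At any other maximal ideal m some \<open>t^e\<close> with e nonzero in S is
  invertible, and it multiplies k[T] into k[S]; the two therefore differ at the origin only.
  Dimension theory is reduced to counting. Three elements of \<open>k[t_1, t_2]\<close> are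
  algebraically dependent, because the products of their powers grow cubically in number while the
  space containing them grows quadratically. Cancelling along a chain of primes turns the relation
  into \<phi>(z) in the top prime. This bounds the dimension by two and also supplies the
  polynomials in the monomials of s1 and s2, over every field. The geometric obstacle is a tangent
  ray: each multiple of the disk meets it in a single point, so translating far out along the ray
  proves nothing about points of the ray itself. There closure under subtraction comes from the
  points of tangency being the natural multiples of one fixed vector.\<close>

lemma ideal_subset: "ideal I R \<Longrightarrow> I \<subseteq> carrier R"
  by (auto dest: ideal.Icarr)

lemma genideal_subset: "ring R \<Longrightarrow> A \<subseteq> carrier R \<Longrightarrow> Idl\<^bsub>R\<^esub> A \<subseteq> carrier R"
  by (rule ideal_subset[OF ring.genideal_ideal])

text \<open>Elements of \<open>localization\<close> are sets of pairs, awkward to compute with. The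
  work is done in a subring of a fraction field instead, and this locale carries
  \<open>buchsbaum_local_ring\<close> from one ring to the other.\<close>

locale cring_iso = R: cring R + S: cring S
  for R (structure) and S (structure) +
  fixes h :: "'a \<Rightarrow> 'c"
  assumes iso: "h \<in> ring_iso R S"
begin

abbreviation g where "g \<equiv> inv_into (carrier R) h"

sublocale ring_hom_ring R S h
  using iso by (intro ring_hom_ringI2 R.ring_axioms S.ring_axioms) (simp add: ring_iso_def)

lemma bij: "bij_betw h (carrier R) (carrier S)"
  by (rule ring_iso_memE(5)[OF iso])

lemma g_h [simp]: "x \<in> carrier R \<Longrightarrow> g (h x) = x"
  using bij by (simp add: bij_betw_inv_into_left)

lemma h_g [simp]: "y \<in> carrier S \<Longrightarrow> h (g y) = y"
  using bij by (simp add: bij_betw_inv_into_right)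

lemma g_closed [simp]: "y \<in> carrier S \<Longrightarrow> g y \<in> carrier R"
  using bij_betwE[OF bij_betw_inv_into[OF bij]] by blast

text \<open>By symmetry each transfer below is proved in one direction and then instantiated with
  the inverse.\<close>

lemma inverse_iso: "cring_iso S R g"
  by (intro cring_iso.intro S.cring_axioms R.cring_axioms cring_iso_axioms.intro
      ring_iso_set_sym[OF R.ring_axioms iso])

lemma image_g_h [simp]: "I \<subseteq> carrier R \<Longrightarrow> g ` h ` I = I"
  using bij by (simp add: bij_betw_def)

lemma image_mem: "I \<subseteq> carrier R \<Longrightarrow> x \<in> carrier R \<Longrightarrow> h x \<in> h ` I \<longleftrightarrow> x \<in> I"
  using inj_on_image_mem_iff[OF bij_betw_imp_inj_on[OF bij]] by blast

lemma h_image_carrier: "h ` carrier R = carrier S"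
  using bij by (simp add: bij_betw_def)

lemma image_g: "J \<subseteq> carrier S \<Longrightarrow> h ` g ` J = J"
  using bij by (simp add: bij_betw_def image_inv_into_cancel)

lemma image_ideal: assumes "ideal I R" shows "ideal (h ` I) S"
proof -
  have sub: "I \<subseteq> carrier R" using assms by (rule ideal_subset)
  \<comment> \<open>Written as a preimage under the inverse map, the image is an ideal by
    \<open>ideal_vimage\<close>.\<close>
  have "h ` I = {y \<in> carrier S. g y \<in> I}"
  proof (intro equalityI subsetI)
    fix y assume "y \<in> {y \<in> carrier S. g y \<in> I}"
    then have "g y \<in> I" "y = h (g y)" by simp_all
    then show "y \<in> h ` I" by (rule rev_image_eqI)
  next
    fix y assume "y \<in> h ` I"
    then obtain x where "x \<in> I" "y = h x" by blast
    moreover from this have "x \<in> carrier R" using sub by blast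
    ultimately show "y \<in> {y \<in> carrier S. g y \<in> I}" by simp
  qed
  moreover have "ring_hom_ring S R g"
    using ring_iso_set_sym[OF R.ring_axioms iso]
    by (intro ring_hom_ringI2 S.ring_axioms R.ring_axioms) (simp add: ring_iso_def)
  ultimately show ?thesis
    using ring_hom_ring.ideal_vimage[OF _ assms, of S g] by simp
qed

lemma genideal_image_le:
  assumes "A \<subseteq> carrier R" shows "Idl\<^bsub>S\<^esub> (h ` A) \<subseteq> h ` (Idl\<^bsub>R\<^esub> A)"
  using S.genideal_minimal[OF image_ideal[OF R.genideal_ideal[OF assms]]
      image_mono[OF R.genideal_self[OF assms]]] .

lemma genideal_image:
  assumes "A \<subseteq> carrier R" shows "h ` (Idl\<^bsub>R\<^esub> A) = Idl\<^bsub>S\<^esub> (h ` A)"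
proof
  have A: "h ` A \<subseteq> carrier S" using assms by auto
  then have "Idl\<^bsub>S\<^esub> (h ` A) \<subseteq> carrier S"
    by (rule genideal_subset[OF S.ring_axioms])
  then show "h ` (Idl\<^bsub>R\<^esub> A) \<subseteq> Idl\<^bsub>S\<^esub> (h ` A)"
    using image_mono[OF cring_iso.genideal_image_le[OF inverse_iso A], of h]
    unfolding image_g_h[OF assms] by (simp only: image_g)
qed (rule genideal_image_le[OF assms])

lemma image_primeideal: assumes "primeideal P R" shows "primeideal (h ` P) S"
proof (rule primeidealI)
  interpret P: primeideal P R by fact
  have sub: "P \<subseteq> carrier R" using P.is_ideal by (rule ideal_subset)
  show "ideal (h ` P) S" by (rule image_ideal[OF P.is_ideal])
  show "carrier S \<noteq> h ` P"
    using P.I_notcarr image_g_h[OF sub] image_g_h[OF subset_refl] by (auto simp: h_image_carrier)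
  fix a b assume ab: "a \<in> carrier S" "b \<in> carrier S" "a \<otimes>\<^bsub>S\<^esub> b \<in> h ` P"
  then obtain x y where "x \<in> carrier R" "y \<in> carrier R" "a = h x" "b = h y"
    unfolding h_image_carrier[symmetric] by blast
  with ab(3) show "a \<in> h ` P \<or> b \<in> h ` P"
    using P.I_prime[of x y] by (simp add: image_mem[OF sub] flip: hom_mult)
qed (rule S.cring_axioms)

lemma image_maximalideal: assumes "maximalideal P R" shows "maximalideal (h ` P) S"
proof (rule maximalidealI)
  interpret P: maximalideal P R by fact
  have sub: "P \<subseteq> carrier R" using P.is_ideal by (rule ideal_subset)
  show "ideal (h ` P) S" by (rule image_ideal[OF P.is_ideal])
  show "carrier S \<noteq> h ` P"
    using P.I_notcarr image_g_h[OF sub] image_g_h[OF subset_refl] by (auto simp: h_image_carrier)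
  fix J assume J: "ideal J S" "h ` P \<subseteq> J" "J \<subseteq> carrier S"
  have "P \<subseteq> g ` J" using J(2) sub image_g_h image_mono by metis
  moreover have "ideal (g ` J) R" by (rule cring_iso.image_ideal[OF inverse_iso J(1)])
  moreover have "g ` J \<subseteq> carrier R" using J(3) by auto
  ultimately have "g ` J = P \<or> g ` J = carrier R" using P.I_maximal by blast
  then show "J = h ` P \<or> J = carrier S"
    using image_g[OF J(3)] h_image_carrier by auto
qed

lemma krull_dim_le: "krull_dim R \<le> krull_dim S"
  unfolding krull_dim_def
proof (intro Sup_subset_mono subsetI, elim CollectE exE conjE)
  fix x n and P :: "nat \<Rightarrow> 'a set"
  assume x: "x = enat n" and P: "\<forall>i\<le>n. primeideal (P i) R" "\<forall>i<n. P i \<subset> P (Suc i)"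
  have sub: "P i \<subseteq> carrier R" if "i \<le> n" for i
  proof -
    have "primeideal (P i) R" using P(1) that by simp
    then show ?thesis by (rule ideal_subset[OF primeideal.axioms(1)])
  qed
  have "h ` P i \<subset> h ` P (Suc i)" if "i < n" for i
  proof -
    have "P i \<subset> P (Suc i)" "P i \<subseteq> carrier R" "P (Suc i) \<subseteq> carrier R" using P(2) sub that by simp_all
    then show ?thesis
      using inj_on_subset[OF bij_betw_imp_inj_on[OF bij]] by (intro image_strict_mono)
  qed
  then show "x \<in> {enat n |n. \<exists>P. (\<forall>i\<le>n. primeideal (P i) S) \<and> (\<forall>i<n. P i \<subset> P (Suc i))}"
    using x P image_primeideal by (intro CollectI exI[of _ n] conjI exI[of _ "\<lambda>i. h ` P i"]) auto
qed

lemma krull_dim_eq: "krull_dim R = krull_dim S"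
  using krull_dim_le cring_iso.krull_dim_le[OF inverse_iso] by auto

lemma image_noetherian: assumes "noetherian_ring R" shows "noetherian_ring S"
proof (rule S.noetherian_ringI)
  interpret N: noetherian_ring R by fact
  fix I assume I: "ideal I S"
  then have sub: "I \<subseteq> carrier S" by (rule ideal_subset)
  obtain A where "A \<subseteq> carrier R" "finite A" "g ` I = Idl\<^bsub>R\<^esub> A"
    using N.finetely_gen[OF cring_iso.image_ideal[OF inverse_iso I]] by blast
  then have "I = Idl\<^bsub>S\<^esub> (h ` A)" "finite (h ` A)" "h ` A \<subseteq> carrier S"
    using genideal_image[of A] image_g[OF sub] by auto
  then show "\<exists>A\<subseteq>carrier S. finite A \<and> I = Idl\<^bsub>S\<^esub> A" by blast
qed

lemma image_Collect:
  assumes "\<And>x. x \<in> carrier R \<Longrightarrow> P (h x) \<longleftrightarrow> Q x"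
  shows "{y \<in> carrier S. P y} = h ` {x \<in> carrier R. Q x}"
proof (intro equalityI subsetI)
  fix y assume y: "y \<in> {y \<in> carrier S. P y}"
  then have "g y \<in> carrier R" "Q (g y)" using assms[of "g y"] by auto
  then show "y \<in> h ` {x \<in> carrier R. Q x}"
    using y by (intro rev_image_eqI[of "g y"]) auto
qed (use assms in auto)

lemma radical_image:
  assumes "I \<subseteq> carrier R" shows "radical_ideal S (h ` I) = h ` radical_ideal R I"
  unfolding radical_ideal_def
proof (rule image_Collect)
  fix x assume "x \<in> carrier R"
  then have "h x [^]\<^bsub>S\<^esub> (n::nat) \<in> h ` I \<longleftrightarrow> x [^]\<^bsub>R\<^esub> n \<in> I" for n
    using image_mem[OF assms, of "x [^]\<^bsub>R\<^esub> n"] hom_nat_pow[of x] by auto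
  then show "(\<exists>n::nat. h x [^]\<^bsub>S\<^esub> n \<in> h ` I) \<longleftrightarrow> (\<exists>n::nat. x [^]\<^bsub>R\<^esub> n \<in> I)" by blast
qed

lemma colon_image:
  assumes "I \<subseteq> carrier R" "E \<subseteq> carrier R"
  shows "colon_ideal S (h ` I) (h ` E) = h ` colon_ideal R I E"
  unfolding colon_ideal_def
proof (rule image_Collect)
  fix y assume y: "y \<in> carrier R"
  have "h y \<otimes>\<^bsub>S\<^esub> h x \<in> h ` I \<longleftrightarrow> y \<otimes>\<^bsub>R\<^esub> x \<in> I" if "x \<in> E" for x
  proof -
    have "x \<in> carrier R" using that assms by blast
    then show ?thesis
      using y image_mem[OF assms(1), of "y \<otimes>\<^bsub>R\<^esub> x"] hom_mult[of y x] by simp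
  qed
  then show "(\<forall>x\<in>h ` E. h y \<otimes>\<^bsub>S\<^esub> x \<in> h ` I) \<longleftrightarrow> (\<forall>x\<in>E. y \<otimes>\<^bsub>R\<^esub> x \<in> I)" by simp
qed

lemma image_system_of_parameters:
  assumes "system_of_parameters R \<mm> xs"
  shows "system_of_parameters S (h ` \<mm>) (map h xs)"
proof -
  have xs: "set xs \<subseteq> carrier R" and len: "enat (length xs) = krull_dim R"
    and rad: "radical_ideal R (Idl\<^bsub>R\<^esub> (set xs)) = \<mm>"
    using assms unfolding system_of_parameters_def by blast+
  have "set (map h xs) \<subseteq> carrier S" using xs by auto
  moreover have "enat (length (map h xs)) = krull_dim S"
    by (simp only: length_map len krull_dim_eq)
  moreover have "radical_ideal S (Idl\<^bsub>S\<^esub> (set (map h xs))) = h ` \<mm>"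
    unfolding set_map genideal_image[OF xs, symmetric]
      radical_image[OF genideal_subset[OF R.ring_axioms xs]] rad ..
  ultimately show ?thesis
    unfolding system_of_parameters_def by blast
qed

lemma image_weak_sequence:
  assumes "set xs \<subseteq> carrier R" "\<mm> \<subseteq> carrier R" "weak_sequence R \<mm> xs"
  shows "weak_sequence S (h ` \<mm>) (map h xs)"
  unfolding weak_sequence_def
proof (intro allI impI)
  fix i assume "i < length (map h xs)"
  then have i: "i < length xs" by (simp only: length_map)
  have t: "set (take i xs) \<subseteq> carrier R" by (rule subset_trans[OF set_take_subset assms(1)])
  have I: "Idl\<^bsub>R\<^esub> (set (take i xs)) \<subseteq> carrier R" by (rule genideal_subset[OF R.ring_axioms t])
  have x: "{xs ! i} \<subseteq> carrier R" using i assms(1) nth_mem by blast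
  have "h ` colon_ideal R (Idl\<^bsub>R\<^esub> (set (take i xs))) {xs ! i} =
        h ` colon_ideal R (Idl\<^bsub>R\<^esub> (set (take i xs))) \<mm>"
    using assms(3) i by (simp only: weak_sequence_def)
  moreover have "h ` {xs ! i} = {map h xs ! i}" using i by simp
  ultimately show "colon_ideal S (Idl\<^bsub>S\<^esub> set (take i (map h xs))) {map h xs ! i} =
             colon_ideal S (Idl\<^bsub>S\<^esub> set (take i (map h xs))) (h ` \<mm>)"
    using colon_image[OF I x] colon_image[OF I assms(2)]
    unfolding take_map set_map genideal_image[OF t] by simp
qed

lemma image_buchsbaum_local:
  assumes "buchsbaum_local_ring R" shows "buchsbaum_local_ring S"
proof -
  from assms obtain \<mm> where m: "{I. maximalideal I R} = {\<mm>}"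
    and ws: "\<And>xs. system_of_parameters R \<mm> xs \<Longrightarrow> weak_sequence R \<mm> xs"
    and N: "noetherian_ring R"
    unfolding buchsbaum_local_ring_def by blast
  have mR: "maximalideal \<mm> R" using m by blast
  then have sub: "\<mm> \<subseteq> carrier R" by (intro ideal_subset maximalideal.axioms(1))
  have unique: "J = h ` \<mm>" if J: "maximalideal J S" for J
  proof -
    have "J \<subseteq> carrier S" by (rule ideal_subset[OF maximalideal.axioms(1)[OF J]])
    moreover have "g ` J \<in> {I. maximalideal I R}"
      using cring_iso.image_maximalideal[OF inverse_iso J] by (rule CollectI)
    then have "g ` J = \<mm>" unfolding m by (rule singletonD)
    ultimately show ?thesis using image_g[of J] by simp
  qed
  have max: "{J. maximalideal J S} = {h ` \<mm>}"
  proof (intro equalityI subsetI)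
    fix J assume "J \<in> {J. maximalideal J S}"
    then show "J \<in> {h ` \<mm>}" unfolding mem_Collect_eq singleton_iff by (rule unique)
  next
    fix J assume "J \<in> {h ` \<mm>}"
    then have "J = h ` \<mm>" by (rule singletonD)
    then show "J \<in> {J. maximalideal J S}" using image_maximalideal[OF mR] by (simp only: mem_Collect_eq)
  qed
  have "weak_sequence S (h ` \<mm>) ys" if ys: "system_of_parameters S (h ` \<mm>) ys" for ys
  proof -
    have sop: "system_of_parameters R \<mm> (map g ys)"
      using cring_iso.image_system_of_parameters[OF inverse_iso ys]
      unfolding image_g_h[OF sub] .
    then have "weak_sequence R \<mm> (map g ys)" by (rule ws)
    moreover have "set (map g ys) \<subseteq> carrier R" using sop unfolding system_of_parameters_def by blast
    ultimately have "weak_sequence S (h ` \<mm>) (map h (map g ys))"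
      by (intro image_weak_sequence sub)
    moreover have "set ys \<subseteq> carrier S" using ys unfolding system_of_parameters_def by blast
    then have "map h (map g ys) = ys"
      unfolding map_map by (intro map_idI) auto
    ultimately show ?thesis by simp
  qed
  then show ?thesis
    unfolding buchsbaum_local_ring_def
    by (intro conjI S.cring_axioms image_noetherian[OF N] exI[of _ "h ` \<mm>"] max allI impI)
qed

lemma buchsbaum_local_iff: "buchsbaum_local_ring R \<longleftrightarrow> buchsbaum_local_ring S"
  using image_buchsbaum_local cring_iso.image_buchsbaum_local[OF inverse_iso] by (rule iffI)

end

section \<open>Subrings of a domain and their localizations\<close>

text \<open>Only the carrier is restricted; the operations remain those of the type, so goals
  simplify to ordinary \<open>+\<close> and \<open>*\<close>.\<close>

abbreviation rng :: "'a::comm_ring_1 set \<Rightarrow> 'a ring" where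
  "rng B \<equiv> ring_of_type_algebra\<lparr>carrier := B\<rparr>"

lemma rng_simps [simp]:
  "carrier (rng B) = B" "mult (rng B) = (*)" "one (rng B) = 1"
  "zero (rng B) = 0" "add (rng B) = (+)"
  by (simp_all add: ring_of_type_algebra_def fun_eq_iff)

lemma rng_pow [simp]: "x [^]\<^bsub>rng B\<^esub> (n::nat) = x ^ n"
  by (induction n) (simp_all add: nat_pow_def mult.commute)

locale subring_of =
  fixes B :: "'a::idom set"
  assumes one_mem [simp, intro]: "1 \<in> B"
    and diff_mem [intro]: "x \<in> B \<Longrightarrow> y \<in> B \<Longrightarrow> x - y \<in> B"
    and mult_mem [intro]: "x \<in> B \<Longrightarrow> y \<in> B \<Longrightarrow> x * y \<in> B"
begin

lemma zero_mem [simp, intro]: "0 \<in> B"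
  using diff_mem[of 1 1] by simp

lemma uminus_mem [intro]: "x \<in> B \<Longrightarrow> - x \<in> B"
  using diff_mem[of 0 x] by simp

lemma add_mem [intro]: "x \<in> B \<Longrightarrow> y \<in> B \<Longrightarrow> x + y \<in> B"
  using diff_mem[of x "- y"] uminus_mem by simp

lemma power_mem [intro]: "x \<in> B \<Longrightarrow> x ^ n \<in> B"
  by (induction n) auto

lemma sum_mem [intro]: "(\<And>i. i \<in> A \<Longrightarrow> f i \<in> B) \<Longrightarrow> sum f A \<in> B"
  by (induction A rule: infinite_finite_induct) auto

lemma domain_rng: "domain (rng B)"
proof (rule domain.intro)
  have "\<exists>y\<in>B. x + y = 0 \<and> y + x = 0" if "x \<in> B" for x
    using uminus_mem[OF that] by (intro bexI[of _ "- x"]) auto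
  then show "cring (rng B)"
    by (intro cringI abelian_groupI comm_monoidI)
      (auto simp: algebra_simps)
  show "domain_axioms (rng B)"
    by (auto simp: domain_axioms_def)
qed

sublocale ring_B: domain "rng B" by (rule domain_rng)

lemma ideal_iff:
  "ideal I (rng B) \<longleftrightarrow> I \<subseteq> B \<and> 0 \<in> I \<and> (\<forall>x\<in>I. \<forall>y\<in>I. x + y \<in> I) \<and> (\<forall>b\<in>B. \<forall>x\<in>I. b * x \<in> I)"
proof
  assume "ideal I (rng B)"
  then interpret I: ideal I "rng B" .
  show "I \<subseteq> B \<and> 0 \<in> I \<and> (\<forall>x\<in>I. \<forall>y\<in>I. x + y \<in> I) \<and> (\<forall>b\<in>B. \<forall>x\<in>I. b * x \<in> I)"
    using I.Icarr I.zero_closed I.a_closed I.I_l_closed by auto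
next
  assume I: "I \<subseteq> B \<and> 0 \<in> I \<and> (\<forall>x\<in>I. \<forall>y\<in>I. x + y \<in> I) \<and> (\<forall>b\<in>B. \<forall>x\<in>I. b * x \<in> I)"
  \<comment> \<open>-x is the multiple of x by -1, an element of B.\<close>
  have neg: "- x \<in> I" if "x \<in> I" for x
    using I that uminus_mem[OF one_mem] by (metis mult_minus1)
  show "ideal I (rng B)"
  proof (rule idealI)
    show "subgroup I (add_monoid (rng B))"
    proof (rule group.subgroupI)
      show "group (add_monoid (rng B))" by (rule ring_B.a_group)
      fix x assume x: "x \<in> I"
      then have "inv\<^bsub>add_monoid (rng B)\<^esub> x = - x"
        using I neg uminus_mem
        by (intro group.inv_equality[OF ring_B.a_group]) auto
      then show "inv\<^bsub>add_monoid (rng B)\<^esub> x \<in> I" using neg[OF x] by simp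
    qed (use I in auto)
    show "x \<otimes>\<^bsub>rng B\<^esub> a \<in> I" "a \<otimes>\<^bsub>rng B\<^esub> x \<in> I" if "a \<in> I" "x \<in> carrier (rng B)" for a x
      using that I by (simp_all add: mult.commute[of a x])
  qed (rule ring_B.ring_axioms)
qed

lemma primeideal_iff:
  "primeideal P (rng B) \<longleftrightarrow>
    ideal P (rng B) \<and> 1 \<notin> P \<and> (\<forall>x\<in>B. \<forall>y\<in>B. x * y \<in> P \<longrightarrow> x \<in> P \<or> y \<in> P)"
proof
  assume "primeideal P (rng B)"
  then interpret P: primeideal P "rng B" .
  show "ideal P (rng B) \<and> 1 \<notin> P \<and> (\<forall>x\<in>B. \<forall>y\<in>B. x * y \<in> P \<longrightarrow> x \<in> P \<or> y \<in> P)"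
    using P.is_ideal P.I_notcarr P.one_imp_carrier P.I_prime by auto
next
  assume "ideal P (rng B) \<and> 1 \<notin> P \<and> (\<forall>x\<in>B. \<forall>y\<in>B. x * y \<in> P \<longrightarrow> x \<in> P \<or> y \<in> P)"
  then show "primeideal P (rng B)"
    by (intro primeidealI ring_B.cring_axioms) auto
qed

lemma genideal_eqI:
  assumes "ideal I (rng B)" "A \<subseteq> I" "\<And>J. ideal J (rng B) \<Longrightarrow> A \<subseteq> J \<Longrightarrow> I \<subseteq> J"
  shows "Idl\<^bsub>rng B\<^esub> A = I"
  unfolding genideal_def using assms by blast

lemma genideal_empty: "Idl\<^bsub>rng B\<^esub> {} = {0}"
  by (rule genideal_eqI) (auto simp: ideal_iff)

lemma genideal_single: "x \<in> B \<Longrightarrow> Idl\<^bsub>rng B\<^esub> {x} = (\<lambda>b. b * x) ` B"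
proof (rule genideal_eqI)
  assume x: "x \<in> B"
  have "0 \<in> (\<lambda>b. b * x) ` B" by (intro rev_image_eqI[of 0]) auto
  moreover have "b * x + c * x \<in> (\<lambda>b. b * x) ` B" if "b \<in> B" "c \<in> B" for b c
    using that by (intro rev_image_eqI[of "b + c"]) (auto simp: algebra_simps)
  moreover have "c * (b * x) \<in> (\<lambda>b. b * x) ` B" if "b \<in> B" "c \<in> B" for b c
    using that by (intro rev_image_eqI[of "c * b"]) (auto simp: algebra_simps)
  ultimately show "ideal ((\<lambda>b. b * x) ` B) (rng B)" using x by (auto simp: ideal_iff)
  show "{x} \<subseteq> (\<lambda>b. b * x) ` B" using image_eqI[of x "\<lambda>b. b * x" 1 B] by simp
qed (auto simp: ideal_iff)

lemma genideal_pair: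
  assumes "x \<in> B" "y \<in> B"
  shows "Idl\<^bsub>rng B\<^esub> {x, y} = {b * x + c * y | b c. b \<in> B \<and> c \<in> B}" (is "_ = ?I")
proof (rule genideal_eqI)
  have "0 \<in> ?I" by (intro CollectI exI[of _ 0]) auto
  moreover have "u + v \<in> ?I" if "u \<in> ?I" "v \<in> ?I" for u v
  proof -
    from that obtain b c b' c' where "b \<in> B" "c \<in> B" "b' \<in> B" "c' \<in> B"
      "u = b * x + c * y" "v = b' * x + c' * y" by blast
    then show ?thesis
      by (intro CollectI exI[of _ "b + b'"] exI[of _ "c + c'"]) (auto simp: algebra_simps)
  qed
  moreover have "d * u \<in> ?I" if "d \<in> B" "u \<in> ?I" for d u
  proof -
    from that obtain b c where "b \<in> B" "c \<in> B" "u = b * x + c * y" by blast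
    then show ?thesis using that(1)
      by (intro CollectI exI[of _ "d * b"] exI[of _ "d * c"]) (auto simp: algebra_simps)
  qed
  ultimately show "ideal ?I (rng B)" using assms by (auto simp: ideal_iff)
  have "x \<in> ?I" by (intro CollectI exI[of _ 1] exI[of _ 0]) auto
  moreover have "y \<in> ?I" by (intro CollectI exI[of _ 0] exI[of _ 1]) auto
  ultimately show "{x, y} \<subseteq> ?I" by blast
  show "?I \<subseteq> J" if "ideal J (rng B)" "{x, y} \<subseteq> J" for J
    using that by (auto simp: ideal_iff)
qed

text \<open>In the binomial expansion of \<open>(x + y) ^ (m + n)\<close> every term contains
  \<open>x ^ m\<close> or \<open>y ^ n\<close>.\<close>

lemma ideal_radical:
  assumes "ideal I (rng B)" shows "ideal (radical_ideal (rng B) I) (rng B)"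
  unfolding ideal_iff
proof (intro conjI ballI)
  have I: "I \<subseteq> B" "0 \<in> I" "\<And>x y. x \<in> I \<Longrightarrow> y \<in> I \<Longrightarrow> x + y \<in> I"
    "\<And>b x. b \<in> B \<Longrightarrow> x \<in> I \<Longrightarrow> b * x \<in> I"
    using assms by (auto simp: ideal_iff)
  show "radical_ideal (rng B) I \<subseteq> B" by (auto simp: radical_ideal_def)
  show "0 \<in> radical_ideal (rng B) I"
    using exI[of "\<lambda>n. 0 ^ n \<in> I" 1] I(2) by (auto simp: radical_ideal_def)
  fix x assume x: "x \<in> radical_ideal (rng B) I"
  then obtain m where m: "x \<in> B" "x ^ m \<in> I" by (auto simp: radical_ideal_def)
  {
    fix y assume "y \<in> radical_ideal (rng B) I"
    then obtain n where n: "y \<in> B" "y ^ n \<in> I" by (auto simp: radical_ideal_def)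
    have s: "sum f A \<in> I" if "\<And>k. k \<in> A \<Longrightarrow> f k \<in> I" for f and A :: "nat set"
      using that I(2,3) by (induction A rule: infinite_finite_induct) auto
    have of_nat: "of_nat k \<in> B" for k by (induction k) auto
    have "(x + y) ^ (m + n) \<in> I"
      unfolding binomial_ring
    proof (rule s)
      fix k assume k: "k \<in> {..m + n}"
      show "of_nat (m + n choose k) * x ^ k * y ^ (m + n - k) \<in> I"
      proof (cases "m \<le> k")
        case True
        then have "x ^ k = x ^ (k - m) * x ^ m" by (simp flip: power_add)
        then have "of_nat (m + n choose k) * x ^ k * y ^ (m + n - k) =
          (of_nat (m + n choose k) * x ^ (k - m) * y ^ (m + n - k)) * x ^ m"
          by (simp only: mult_ac)
        then show ?thesis by (simp only:) (intro I(4) mult_mem power_mem of_nat m n)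
      next
        case False
        then have "y ^ (m + n - k) = y ^ (m - k) * y ^ n" by (simp flip: power_add)
        then have "of_nat (m + n choose k) * x ^ k * y ^ (m + n - k) =
          (of_nat (m + n choose k) * x ^ k * y ^ (m - k)) * y ^ n"
          by (simp only: mult_ac)
        then show ?thesis by (simp only:) (intro I(4) mult_mem power_mem of_nat m n)
      qed
    qed
    then show "x + y \<in> radical_ideal (rng B) I"
      using m(1) n(1) by (auto simp: radical_ideal_def)
  }
  fix b assume "b \<in> B"
  moreover from this have "(b * x) ^ m \<in> I"
    unfolding power_mult_distrib using m by (auto intro: I(4))
  ultimately show "b * x \<in> radical_ideal (rng B) I" using m(1) by (auto simp: radical_ideal_def)
qed

end

section \<open>Localization at a prime, inside the fraction field\<close>

definition frac_of :: "'a::idom \<Rightarrow> 'a fract" where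
  "frac_of a = Fract a 1"

lemma frac_of_simps [simp]:
  "frac_of (a + b) = frac_of a + frac_of b"
  "frac_of (a - b) = frac_of a - frac_of b"
  "frac_of (a * b) = frac_of a * frac_of b"
  "frac_of 0 = 0" "frac_of 1 = 1"
  "frac_of a = frac_of b \<longleftrightarrow> a = b"
  "frac_of a = 0 \<longleftrightarrow> a = 0"
  by (simp_all add: frac_of_def eq_fract Zero_fract_def One_fract_def)

lemma frac_of_power [simp]: "frac_of (a ^ n) = frac_of a ^ n"
  by (induction n) simp_all

lemma frac_of_divide_eq_iff:
  "s \<noteq> 0 \<Longrightarrow> t \<noteq> 0 \<Longrightarrow> frac_of a / frac_of s = frac_of b / frac_of t \<longleftrightarrow> a * t = b * s"
  by (metis (no_types) frac_eq_eq frac_of_simps(3,6,7))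

lemma frac_of_divide_add:
  "s \<noteq> 0 \<Longrightarrow> t \<noteq> 0 \<Longrightarrow>
    frac_of a / frac_of s + frac_of b / frac_of t = frac_of (a * t + b * s) / frac_of (s * t)"
  by (simp add: add_frac_eq)

locale localized_subring = subring_of B for B :: "'a::idom set" +
  fixes m :: "'a set"
  assumes prime_m: "primeideal m (rng B)"
begin

abbreviation M where "M \<equiv> B - m"

lemma m_subset: "m \<subseteq> B" and m_zero: "0 \<in> m"
  and m_add: "x \<in> m \<Longrightarrow> y \<in> m \<Longrightarrow> x + y \<in> m"
  and m_mult: "b \<in> B \<Longrightarrow> x \<in> m \<Longrightarrow> b * x \<in> m"
  and one_M: "1 \<in> M"
  using prime_m by (auto simp: primeideal_iff ideal_iff)

lemma M_mult: "s \<in> M \<Longrightarrow> t \<in> M \<Longrightarrow> s * t \<in> M"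
  using prime_m by (auto simp: primeideal_iff)

lemma M_B: "s \<in> M \<Longrightarrow> s \<in> B" by simp

lemma M_nonzero: "s \<in> M \<Longrightarrow> s \<noteq> 0"
  using m_zero by auto

text \<open>For an ideal this is its extension to the localization; for B itself it is the
  localization, so \<open>loc\<close> is an instance.\<close>

definition ext :: "'a set \<Rightarrow> 'a fract set" where
  "ext P = {frac_of a / frac_of s | a s. a \<in> P \<and> s \<in> M}"

abbreviation loc where "loc \<equiv> ext B"

lemma extI [intro]: "a \<in> P \<Longrightarrow> s \<in> M \<Longrightarrow> frac_of a / frac_of s \<in> ext P"
  by (auto simp: ext_def)

lemma extE:
  assumes "x \<in> ext P"
  obtains a s where "a \<in> P" "s \<in> M" "s \<noteq> 0" "x = frac_of a / frac_of s"
  using assms M_nonzero by (auto simp: ext_def)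

lemma frac_of_ext: "a \<in> P \<Longrightarrow> frac_of a \<in> ext P"
  using extI[OF _ one_M, of a P] by simp

lemma frac_of_loc [intro]: "a \<in> B \<Longrightarrow> frac_of a \<in> loc"
  by (rule frac_of_ext)

lemma inverse_M_loc: "s \<in> M \<Longrightarrow> 1 / frac_of s \<in> loc"
  using extI[of 1 B s] by simp

lemma loc_sub: "subring_of loc"
proof
  show "1 \<in> loc" using frac_of_loc[of 1] by simp
  fix x y assume "x \<in> loc" "y \<in> loc"
  then obtain a s b t where *: "a \<in> B" "s \<in> M" "s \<noteq> 0" "x = frac_of a / frac_of s"
    "b \<in> B" "t \<in> M" "t \<noteq> 0" "y = frac_of b / frac_of t"
    by (elim extE)
  then have "x - y = frac_of (a * t - b * s) / frac_of (s * t)"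
    by (simp add: diff_frac_eq)
  moreover have "x * y = frac_of (a * b) / frac_of (s * t)" using * by simp
  moreover have "s * t \<in> M" "a * t - b * s \<in> B" "a * b \<in> B"
    using * M_mult M_B by (auto intro!: diff_mem mult_mem)
  ultimately show "x - y \<in> loc" "x * y \<in> loc" by (auto simp only: extI)
qed

sublocale loc: subring_of loc by (rule loc_sub)

text \<open>The equivalence class of pairs that represents \<open>q\<close> in \<^const>\<open>localization\<close>.\<close>

definition cls :: "'a fract \<Rightarrow> ('a \<times> 'a) set" where
  "cls q = {(a, s). a \<in> B \<and> s \<in> M \<and> frac_of a / frac_of s = q}"

text \<open>B has no zero divisors and M avoids 0, so the factor u in \<open>fraction_rel\<close>
  cancels and a class consists of all pairs with the same quotient in the fraction field.\<close>

lemma fraction_eq_cls: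
  assumes "a \<in> B" "s \<in> M" shows "fraction (rng B) M a s = cls (frac_of a / frac_of s)"
proof -
  have "(b, t) \<in> fraction (rng B) M a s \<longleftrightarrow> (b, t) \<in> cls (frac_of a / frac_of s)" for b t
  proof (cases "b \<in> B \<and> t \<in> M")
    case True
    then have nz: "s \<noteq> 0" "t \<noteq> 0" using assms M_nonzero by auto
    have "(b, t) \<in> fraction (rng B) M a s \<longleftrightarrow> (\<exists>u\<in>M. u * (a * t) = u * (b * s))"
      using True assms by (simp add: fraction_def fraction_rel_def)
    also have "\<dots> \<longleftrightarrow> a * t = b * s" using one_M M_nonzero by auto
    also have "\<dots> \<longleftrightarrow> frac_of b / frac_of t = frac_of a / frac_of s"
      using nz by (auto simp: frac_of_divide_eq_iff)
    finally show ?thesis using True by (simp add: cls_def)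
  next
    case False then show ?thesis by (auto simp: fraction_def fraction_rel_def cls_def)
  qed
  then show ?thesis by auto
qed

lemma cls_nonempty: "q \<in> loc \<Longrightarrow> \<exists>a s. (a, s) \<in> cls q"
  by (auto simp: cls_def elim!: extE)

text \<open>\<open>localization\<close> defines its operations by unions over all representatives. A
  nonempty constant family has its common value as union.\<close>

lemma Union_cls:
  assumes "q \<in> loc" "q' \<in> loc"
    and "\<And>a s b t. (a, s) \<in> cls q \<Longrightarrow> (b, t) \<in> cls q' \<Longrightarrow> F a s b t = cls r"
  shows "\<Union>{F a s b t | a s b t. (a, s) \<in> cls q \<and> (b, t) \<in> cls q'} = cls r"
proof -
  have "{F a s b t | a s b t. (a, s) \<in> cls q \<and> (b, t) \<in> cls q'} = {cls r}"
    using cls_nonempty[OF assms(1)] cls_nonempty[OF assms(2)] assms(3) by fastforce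
  then show ?thesis by simp
qed

lemma localization_iso: "cring_iso (rng loc) (localization (rng B) M) cls"
proof -
  let ?L = "localization (rng B) M"
  have carr: "carrier ?L = cls ` loc"
  proof -
    have "carrier ?L = (\<lambda>p. fraction (rng B) M (fst p) (snd p)) ` (B \<times> M)"
      by (force simp: localization_def)
    also have "\<dots> = (\<lambda>p. cls (frac_of (fst p) / frac_of (snd p))) ` (B \<times> M)"
      by (intro image_cong refl fraction_eq_cls) auto
    also have "\<dots> = cls ` (\<lambda>p. frac_of (fst p) / frac_of (snd p)) ` (B \<times> M)"
      by (simp only: image_image)
    also have "(\<lambda>p. frac_of (fst p) / frac_of (snd p)) ` (B \<times> M) = loc"
      unfolding ext_def by force
    finally show ?thesis .
  qed
  have inj: "inj_on cls loc"
  proof (rule inj_onI)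
    fix q q' assume "q \<in> loc" "cls q = cls q'"
    then obtain a s where "(a, s) \<in> cls q" "(a, s) \<in> cls q'"
      using cls_nonempty by metis
    then show "q = q'" by (simp add: cls_def)
  qed
  have iso: "cls \<in> ring_iso (rng loc) ?L"
  proof (rule ring_iso_memI)
    show "bij_betw cls (carrier (rng loc)) (carrier ?L)"
      using inj by (simp add: bij_betw_def carr)
    show "cls x \<in> carrier ?L" if "x \<in> carrier (rng loc)" for x using that carr by auto
    show "cls \<one>\<^bsub>rng loc\<^esub> = \<one>\<^bsub>?L\<^esub>"
      using fraction_eq_cls[OF one_mem one_M] by (simp add: localization_def)
    fix x y assume "x \<in> carrier (rng loc)" "y \<in> carrier (rng loc)"
    then have xy: "x \<in> loc" "y \<in> loc" by simp_all
    show "cls (x \<otimes>\<^bsub>rng loc\<^esub> y) = cls x \<otimes>\<^bsub>?L\<^esub> cls y"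
    proof -
      have "fraction (rng B) M (a * b) (s * t) = cls (x * y)"
        if "(a, s) \<in> cls x" "(b, t) \<in> cls y" for a s b t
      proof -
        have "a \<in> B" "s \<in> M" "b \<in> B" "t \<in> M" "x = frac_of a / frac_of s" "y = frac_of b / frac_of t"
          using that by (auto simp: cls_def)
        then show ?thesis
          using fraction_eq_cls[OF mult_mem M_mult, of a b s t] by simp
      qed
      from Union_cls[OF xy, of "\<lambda>a s b t. fraction (rng B) M (a * b) (s * t)", OF this]
      show ?thesis by (simp add: localization_def)
    qed
    show "cls (x \<oplus>\<^bsub>rng loc\<^esub> y) = cls x \<oplus>\<^bsub>?L\<^esub> cls y"
    proof -
      have "fraction (rng B) M (a * t + b * s) (s * t) = cls (x + y)"
        if "(a, s) \<in> cls x" "(b, t) \<in> cls y" for a s b t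
      proof -
        have *: "a \<in> B" "s \<in> M" "b \<in> B" "t \<in> M" "x = frac_of a / frac_of s" "y = frac_of b / frac_of t"
          using that by (auto simp: cls_def)
        then have "a * t + b * s \<in> B" using M_B by (intro add_mem mult_mem)
        then show ?thesis
          using fraction_eq_cls[OF _ M_mult, of "a * t + b * s" s t] *
            frac_of_divide_add[OF M_nonzero M_nonzero, of s t a b] by (simp only:)
      qed
      from Union_cls[OF xy, of "\<lambda>a s b t. fraction (rng B) M (a * t + b * s) (s * t)", OF this]
      show ?thesis by (simp add: localization_def)
    qed
  qed
  \<comment> \<open>The transferred ring has the image of 0 as its zero by construction; the next
    step identifies it with the zero of \<open>localization\<close>.\<close>
  have "cring (?L\<lparr>zero := cls \<zero>\<^bsub>rng loc\<^esub>\<rparr>)"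
    by (rule cring.ring_iso_imp_img_cring[OF loc.ring_B.cring_axioms iso])
  moreover have "cls \<zero>\<^bsub>rng loc\<^esub> = \<zero>\<^bsub>?L\<^esub>"
    using fraction_eq_cls[OF zero_mem one_M] by (simp add: localization_def)
  ultimately have "cring ?L" by simp
  then show ?thesis
    by (intro cring_iso.intro loc.ring_B.cring_axioms cring_iso_axioms.intro iso)
qed

text \<open>Denominators lie outside m, hence outside P, so primality of P cancels them from a t = b
  s.\<close>

lemma ext_mem_iff:
  assumes "primeideal P (rng B)" "P \<subseteq> m" "a \<in> B" "s \<in> M"
  shows "frac_of a / frac_of s \<in> ext P \<longleftrightarrow> a \<in> P"
proof
  assume "frac_of a / frac_of s \<in> ext P"
  then obtain b t where bt: "b \<in> P" "t \<in> M" "t \<noteq> 0" "frac_of a / frac_of s = frac_of b / frac_of t"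
    by (elim extE)
  then have "a * t = b * s" using frac_of_divide_eq_iff[of s t a b] M_nonzero[OF assms(4)] by simp
  moreover have "s * b \<in> P" using assms bt by (auto simp: primeideal_iff ideal_iff)
  ultimately have "a * t \<in> P" by (simp add: mult.commute)
  then show "a \<in> P" using assms bt by (auto simp: primeideal_iff)
qed (use assms in auto)

lemma frac_of_ext_iff:
  "primeideal P (rng B) \<Longrightarrow> P \<subseteq> m \<Longrightarrow> a \<in> B \<Longrightarrow> frac_of a \<in> ext P \<longleftrightarrow> a \<in> P"
  using ext_mem_iff[of P a 1] one_M by simp

lemma ext_ideal: assumes "ideal I (rng B)" shows "ideal (ext I) (rng loc)"
  unfolding loc.ideal_iff
proof (intro conjI ballI)
  have I: "I \<subseteq> B" "0 \<in> I" "\<And>x y. x \<in> I \<Longrightarrow> y \<in> I \<Longrightarrow> x + y \<in> I"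
    "\<And>b x. b \<in> B \<Longrightarrow> x \<in> I \<Longrightarrow> b * x \<in> I"
    using assms by (auto simp: ideal_iff)
  show "ext I \<subseteq> loc" using I(1) by (auto simp: ext_def)
  show "0 \<in> ext I" using frac_of_ext[OF I(2)] by simp
  fix x assume "x \<in> ext I"
  then obtain a s where x: "a \<in> I" "s \<in> M" "s \<noteq> 0" "x = frac_of a / frac_of s" by (elim extE)
  {
    fix y assume "y \<in> ext I"
    then obtain b t where y: "b \<in> I" "t \<in> M" "t \<noteq> 0" "y = frac_of b / frac_of t" by (elim extE)
    have "x + y = frac_of (t * a + s * b) / frac_of (s * t)"
      using x y by (simp add: add_frac_eq mult.commute)
    moreover have "t * a + s * b \<in> I" using x y I M_B by auto
    ultimately show "x + y \<in> ext I" using x y M_mult by (simp only: extI)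
  }
  fix b assume "b \<in> loc"
  then obtain c t where b: "c \<in> B" "t \<in> M" "t \<noteq> 0" "b = frac_of c / frac_of t" by (elim extE)
  then have "b * x = frac_of (c * a) / frac_of (t * s)" using x by simp
  then show "b * x \<in> ext I" using x b I M_mult by (simp only: extI)
qed

lemma ext_prime:
  assumes "primeideal P (rng B)" "P \<subseteq> m" shows "primeideal (ext P) (rng loc)"
  unfolding loc.primeideal_iff
proof (intro conjI ballI impI)
  show "ideal (ext P) (rng loc)" using assms by (intro ext_ideal) (simp add: primeideal_iff)
  show "1 \<notin> ext P" using frac_of_ext_iff[OF assms, of 1] assms(1) by (simp add: primeideal_iff)
  fix x y assume "x \<in> loc" "y \<in> loc" "x * y \<in> ext P"
  moreover from this obtain a s b t where *: "a \<in> B" "s \<in> M" "x = frac_of a / frac_of s"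
    "b \<in> B" "t \<in> M" "y = frac_of b / frac_of t" by (elim extE)
  ultimately have "frac_of (a * b) / frac_of (s * t) \<in> ext P" by simp
  then have "a * b \<in> P" using ext_mem_iff[OF assms mult_mem M_mult] * by blast
  then have "a \<in> P \<or> b \<in> P" using assms * by (auto simp: primeideal_iff)
  then show "x \<in> ext P \<or> y \<in> ext P" using * by auto
qed

definition contr :: "'a fract set \<Rightarrow> 'a set" where
  "contr J = {a \<in> B. frac_of a \<in> J}"

lemma contr_ideal: assumes "ideal J (rng loc)" shows "ideal (contr J) (rng B)"
  using assms by (auto simp: contr_def ideal_iff loc.ideal_iff)

lemma loc_numerator:
  assumes "ideal J (rng loc)" "a \<in> B" "s \<in> M"
  shows "frac_of a / frac_of s \<in> J \<longleftrightarrow> a \<in> contr J"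
proof -
  have J: "\<And>b x. b \<in> loc \<Longrightarrow> x \<in> J \<Longrightarrow> b * x \<in> J"
    using assms(1) by (auto simp: loc.ideal_iff)
  have "frac_of s * (frac_of a / frac_of s) = frac_of a"
    "1 / frac_of s * frac_of a = frac_of a / frac_of s"
    using M_nonzero[OF assms(3)] by simp_all
  then show ?thesis
    using J[of "frac_of s" "frac_of a / frac_of s"] J[of "1 / frac_of s" "frac_of a"]
      assms frac_of_loc[of s] inverse_M_loc[of s] by (auto simp: contr_def)
qed

text \<open>Contraction is therefore injective on ideals, which keeps prime chains strict and
  carries finite generation from B to \<open>loc\<close>.\<close>

lemma ext_contr: assumes "ideal J (rng loc)" shows "ext (contr J) = J"
proof -
  have "J \<subseteq> loc" using assms by (auto simp: loc.ideal_iff)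
  show ?thesis
  proof (intro equalityI subsetI)
    fix x assume "x \<in> ext (contr J)"
    then obtain a s where "a \<in> contr J" "s \<in> M" "x = frac_of a / frac_of s" by (elim extE)
    then show "x \<in> J" using loc_numerator[OF assms, of a s] by (simp add: contr_def)
  next
    fix x assume "x \<in> J"
    with \<open>J \<subseteq> loc\<close> have "x \<in> loc" by blast
    then obtain a s where "a \<in> B" "s \<in> M" "x = frac_of a / frac_of s" by (elim extE)
    then show "x \<in> ext (contr J)"
      using \<open>x \<in> J\<close> loc_numerator[OF assms, of a s] by (simp add: extI)
  qed
qed

lemma contr_subset_m:
  assumes "ideal J (rng loc)" "1 \<notin> J" shows "contr J \<subseteq> m"
proof
  fix a assume a: "a \<in> contr J"
  then have aB: "a \<in> B" by (simp add: contr_def)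
  show "a \<in> m"
  proof (rule ccontr)
    assume "a \<notin> m"
    then have "frac_of a / frac_of a \<in> J" using a aB loc_numerator[OF assms(1), of a a] by simp
    moreover have "a \<noteq> 0" using \<open>a \<notin> m\<close> m_zero by auto
    ultimately show False using assms(2) by simp
  qed
qed

lemma contr_prime:
  assumes "primeideal P (rng loc)" shows "primeideal (contr P) (rng B)" "contr P \<subseteq> m"
proof -
  have P: "ideal P (rng loc)" "1 \<notin> P" "\<And>x y. x \<in> loc \<Longrightarrow> y \<in> loc \<Longrightarrow> x * y \<in> P \<Longrightarrow> x \<in> P \<or> y \<in> P"
    using assms by (auto simp: loc.primeideal_iff)
  then show "contr P \<subseteq> m" by (intro contr_subset_m)
  show "primeideal (contr P) (rng B)"
    unfolding primeideal_iff using contr_ideal[OF P(1)] P(2,3)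
    by (auto simp: contr_def)
qed

lemma maximal_loc_iff: "maximalideal J (rng loc) \<longleftrightarrow> J = ext m"
proof -
  \<comment> \<open>An element of J with numerator outside m would be invertible, so a proper ideal
    contracts into m and lies in \<open>ext m\<close>.\<close>
  have le: "J \<subseteq> ext m" if "ideal J (rng loc)" "J \<noteq> loc" for J
  proof -
    have "1 \<notin> J"
    proof
      assume "1 \<in> J"
      then have "x \<in> J" if "x \<in> loc" for x
        using that \<open>ideal J (rng loc)\<close> unfolding loc.ideal_iff by (metis mult.right_neutral)
      then show False using that by (auto simp: loc.ideal_iff)
    qed
    then have "ext (contr J) \<subseteq> ext m" using contr_subset_m[OF that(1)] by (auto simp: ext_def)
    then show ?thesis using ext_contr[OF that(1)] by simp
  qed
  have prime: "primeideal (ext m) (rng loc)" by (rule ext_prime[OF prime_m subset_refl])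
  then have ne: "ideal (ext m) (rng loc)" "loc \<noteq> ext m"
    by (auto simp: loc.primeideal_iff)
  show ?thesis
  proof
    assume J: "maximalideal J (rng loc)"
    interpret J: maximalideal J "rng loc" by fact
    have "J \<noteq> loc" using J.I_notcarr by auto
    moreover have "ext m \<subseteq> loc" using ne(1) by (auto simp: loc.ideal_iff)
    ultimately show "J = ext m"
      using le[OF J.is_ideal] J.I_maximal[OF ne(1)] ne(2) by auto
  next
    assume J: "J = ext m"
    have "K = ext m \<or> K = loc" if "ideal K (rng loc)" "ext m \<subseteq> K" for K
      using le[OF that(1)] that(2) by blast
    then show "maximalideal J (rng loc)"
      unfolding J using ne by (intro maximalidealI) auto
  qed
qed

lemma loc_noetherian: assumes "noetherian_ring (rng B)" shows "noetherian_ring (rng loc)"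
proof (rule loc.ring_B.noetherian_ringI)
  interpret N: noetherian_ring "rng B" by fact
  fix J assume J: "ideal J (rng loc)"
  obtain A where A: "A \<subseteq> B" "finite A" "contr J = Idl\<^bsub>rng B\<^esub> A"
    using N.finetely_gen[OF contr_ideal[OF J]] by auto
  have sub: "frac_of ` A \<subseteq> loc" using A(1) by auto
  have "A \<subseteq> contr J" using ring_B.genideal_self[of A] A by simp
  then have 1: "frac_of ` A \<subseteq> J" by (auto simp: contr_def)
  have K: "ideal K (rng loc) \<Longrightarrow> frac_of ` A \<subseteq> K \<Longrightarrow> J \<subseteq> K" for K
  proof -
    assume K: "ideal K (rng loc)" "frac_of ` A \<subseteq> K"
    then have "A \<subseteq> contr K" using A(1) by (auto simp: contr_def)
    then have "contr J \<subseteq> contr K"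
      unfolding A(3) by (rule ring_B.genideal_minimal[OF contr_ideal[OF K(1)]])
    then have "ext (contr J) \<subseteq> ext (contr K)" by (auto simp: ext_def)
    then show "J \<subseteq> K" by (simp only: ext_contr J K(1))
  qed
  have "Idl\<^bsub>rng loc\<^esub> (frac_of ` A) = J" by (rule loc.genideal_eqI[OF J 1 K])
  then show "\<exists>A\<subseteq>carrier (rng loc). finite A \<and> J = Idl\<^bsub>rng loc\<^esub> A"
    using sub A(2) by (intro exI[of _ "frac_of ` A"]) auto
qed

lemma buchsbaum_localization_iff:
  assumes "noetherian_ring (rng B)"
  shows "buchsbaum_local_ring (localization (rng B) M) \<longleftrightarrow>
    (\<forall>xs. system_of_parameters (rng loc) (ext m) xs \<longrightarrow> weak_sequence (rng loc) (ext m) xs)"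
proof -
  have "buchsbaum_local_ring (localization (rng B) M) \<longleftrightarrow> buchsbaum_local_ring (rng loc)"
    using cring_iso.buchsbaum_local_iff[OF localization_iso] by simp
  also have "\<dots> \<longleftrightarrow> (\<forall>xs. system_of_parameters (rng loc) (ext m) xs \<longrightarrow> weak_sequence (rng loc) (ext m) xs)"
    unfolding buchsbaum_local_ring_def maximal_loc_iff
    using loc.ring_B.cring_axioms loc_noetherian[OF assms] by auto
  finally show ?thesis .
qed

end

section \<open>Polynomials in two variables and their exponents\<close>

definition cf :: "'k::zero poly poly \<Rightarrow> nat \<times> nat \<Rightarrow> 'k" where
  "cf p x = Polynomial.coeff (Polynomial.coeff p (snd x)) (fst x)"

definition tmon :: "nat \<times> nat \<Rightarrow> 'k::zero \<Rightarrow> 'k poly poly" where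
  "tmon x c = Polynomial.monom (Polynomial.monom c (fst x)) (snd x)"

definition supp :: "'k::zero poly poly \<Rightarrow> (nat \<times> nat) set" where
  "supp p = {x. cf p x \<noteq> 0}"

definition supported :: "(nat \<times> nat) set \<Rightarrow> 'k::zero poly poly set" where
  "supported E = {p. supp p \<subseteq> E}"

lemma cf_simps [simp]:
  "cf 0 x = 0" "cf (p + q) x = cf p x + cf q x"
  for p q :: "'k::comm_monoid_add poly poly"
  by (simp_all add: cf_def)

lemma cf_diff [simp]: "cf (p - q) x = cf p x - cf q x" "cf (- p) x = - cf p x"
  for p q :: "'k::ab_group_add poly poly"
  by (simp_all add: cf_def)

lemma cf_sum [simp]: "cf (sum f A) x = (\<Sum>i\<in>A. cf (f i) x)"
  by (simp add: cf_def coeff_sum)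

lemma cf_mon: "cf (tmon x c) y = (if x = y then c else 0)"
  by (cases x; cases y) (simp add: cf_def tmon_def)

lemma cf_eqI: "(\<And>x. cf p x = cf q x) \<Longrightarrow> p = q"
proof (intro poly_eqI)
  fix i j assume "\<And>x. cf p x = cf q x"
  from this[of "(i, j)"]
  show "Polynomial.coeff (Polynomial.coeff p j) i = Polynomial.coeff (Polynomial.coeff q j) i"
    by (simp add: cf_def)
qed

lemma mem_supp: "x \<in> supp p \<longleftrightarrow> cf p x \<noteq> 0"
  by (simp add: supp_def)

lemma mem_supported: "p \<in> supported E \<longleftrightarrow> (\<forall>x. cf p x \<noteq> 0 \<longrightarrow> x \<in> E)"
  by (auto simp: supported_def supp_def)

lemma finite_supp [simp]: "finite (supp p)"
proof (rule finite_subset)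
  show "supp p \<subseteq> (\<Union>j\<le>Polynomial.degree p. (\<lambda>i. (i, j)) ` {..Polynomial.degree (Polynomial.coeff p j)})"
  proof
    fix x assume "x \<in> supp p"
    then have "Polynomial.coeff (Polynomial.coeff p (snd x)) (fst x) \<noteq> 0" by (simp add: supp_def cf_def)
    moreover from this have "Polynomial.coeff p (snd x) \<noteq> 0" by auto
    ultimately have "snd x \<le> Polynomial.degree p" "fst x \<le> Polynomial.degree (Polynomial.coeff p (snd x))"
      by (simp_all add: le_degree)
    then show "x \<in> (\<Union>j\<le>Polynomial.degree p. (\<lambda>i. (i, j)) ` {..Polynomial.degree (Polynomial.coeff p j)})"
      by (cases x) auto
  qed
qed auto

lemma poly_eq_sum_mon:
  fixes p :: "'k::comm_monoid_add poly poly"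
  assumes "finite E" "supp p \<subseteq> E" shows "p = (\<Sum>x\<in>E. tmon x (cf p x))"
  using assms by (intro cf_eqI) (auto simp: cf_mon supp_def)

lemma tmon_zero [simp]: "tmon x 0 = 0"
  by (simp add: tmon_def)

lemma tmon_eq_0_iff [simp]: "tmon x c = 0 \<longleftrightarrow> c = 0"
  by (simp add: tmon_def)

lemma tmon_one: "tmon 0 1 = 1"
  by (simp add: tmon_def zero_prod_def monom_0 one_pCons)

lemma tmon_add: "tmon x (a + b) = tmon x a + tmon x b"
  by (simp add: tmon_def add_monom)

lemma tmon_mult: "tmon x a * tmon y b = tmon (x + y) (a * b :: 'k::comm_semiring_0)"
  by (simp add: tmon_def mult_monom)

lemma cf_mult:
  fixes p q :: "'k::comm_ring_1 poly poly"
  shows "cf (p * q) (i, j) = (\<Sum>j'\<le>j. \<Sum>i'\<le>i. cf p (i', j') * cf q (i - i', j - j'))"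
  by (simp add: cf_def coeff_mult coeff_sum)

lemma cf_mon_mult:
  fixes p :: "'k::comm_ring_1 poly poly"
  shows "cf (tmon x c * p) (x + y) = c * cf p y"
proof -
  have "tmon x c * p = (\<Sum>z\<in>supp p. tmon (x + z) (c * cf p z))"
    by (subst (2) poly_eq_sum_mon[of "supp p"]) (simp_all add: sum_distrib_left tmon_mult)
  also have "cf \<dots> (x + y) = (\<Sum>z\<in>supp p. if z = y then c * cf p z else 0)"
    unfolding cf_sum by (intro sum.cong) (auto simp: cf_mon)
  also have "\<dots> = c * cf p y" by (simp add: mem_supp)
  finally show ?thesis .
qed

lemma supp_mult_subset:
  fixes p q :: "'k::comm_ring_1 poly poly"
  shows "supp (p * q) \<subseteq> {x + y | x y. x \<in> supp p \<and> y \<in> supp q}"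
proof
  fix z assume "z \<in> supp (p * q)"
  then have "cf (p * q) (fst z, snd z) \<noteq> 0" by (simp add: mem_supp)
  then obtain i j where ij: "i \<le> fst z" "j \<le> snd z"
    "cf p (i, j) * cf q (fst z - i, snd z - j) \<noteq> 0"
    unfolding cf_mult by (meson atMost_iff sum.neutral)
  then have "(i, j) \<in> supp p" "(fst z - i, snd z - j) \<in> supp q" by (auto simp: mem_supp)
  moreover have "z = (i, j) + (fst z - i, snd z - j)" using ij by (simp add: prod_eq_iff)
  ultimately show "z \<in> {x + y | x y. x \<in> supp p \<and> y \<in> supp q}" by blast
qed

lemma supported_zero [simp]: "0 \<in> supported E"
  by (simp add: mem_supported)

lemma supported_add: "p \<in> supported E \<Longrightarrow> q \<in> supported E \<Longrightarrow> p + q \<in> supported E"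
  for p q :: "'k::comm_monoid_add poly poly"
  unfolding mem_supported by (metis add.right_neutral cf_simps(2))

lemma supported_diff: "p \<in> supported E \<Longrightarrow> q \<in> supported E \<Longrightarrow> p - q \<in> supported E"
  for p q :: "'k::ab_group_add poly poly"
  unfolding mem_supported by (metis cf_diff(1) diff_zero)

lemma supported_sum: "(\<And>i. i \<in> A \<Longrightarrow> f i \<in> supported E) \<Longrightarrow> sum f A \<in> supported E"
  for f :: "_ \<Rightarrow> 'k::comm_monoid_add poly poly"
  by (induction A rule: infinite_finite_induct) (auto intro: supported_add)

lemma supported_mon: "x \<in> E \<Longrightarrow> tmon x c \<in> supported E"
  by (auto simp: mem_supported cf_mon)

lemma supported_mon_iff: "c \<noteq> 0 \<Longrightarrow> tmon x c \<in> supported E \<longleftrightarrow> x \<in> E"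
  unfolding mem_supported by (metis cf_mon)

lemma supported_mult:
  fixes p q :: "'k::comm_ring_1 poly poly"
  assumes "p \<in> supported E" "q \<in> supported F" "\<And>x y. x \<in> E \<Longrightarrow> y \<in> F \<Longrightarrow> x + y \<in> G"
  shows "p * q \<in> supported G"
  using assms supp_mult_subset[of p q] unfolding supported_def by blast

lemma supported_mono: "E \<subseteq> F \<Longrightarrow> p \<in> supported E \<Longrightarrow> p \<in> supported F"
  by (auto simp: mem_supported)

lemma supported_induct [consumes 1, case_names zero add_mon]:
  fixes p :: "'k::comm_monoid_add poly poly"
  assumes "p \<in> supported E" "P 0"
    and "\<And>x c q. x \<in> E \<Longrightarrow> q \<in> supported E \<Longrightarrow> P q \<Longrightarrow> P (tmon x c + q)"
  shows "P p"
proof -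
  have "P (\<Sum>x\<in>F. tmon x (f x)) \<and> (\<Sum>x\<in>F. tmon x (f x)) \<in> supported E"
    if "finite F" "F \<subseteq> E" for F f
    using that by (induction F rule: finite_induct)
      (auto intro!: assms(2,3) supported_add supported_mon)
  from this[of "supp p" "cf p"] show ?thesis
    using assms(1) poly_eq_sum_mon[of "supp p" p] by (simp add: supported_def)
qed

lemma subring_supported:
  assumes "0 \<in> S" "\<And>x y. x \<in> S \<Longrightarrow> y \<in> S \<Longrightarrow> x + y \<in> S"
  shows "subring_of (supported S :: 'k::field poly poly set)"
proof
  show "1 \<in> (supported S :: 'k poly poly set)"
    using supported_mon[OF assms(1), of "1::'k"] by (simp add: tmon_one)
qed (auto intro: supported_diff supported_mult[where E = S and F = S] assms(2))

text \<open>Constants \<open>tmon 0 c\<close> times monomials \<open>tmon x 1\<close> give all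
  terms. From here on the ring is handled through exponent sets alone.\<close>

lemma semigroup_ring_eq:
  assumes "0 \<in> S" "\<And>x y. x \<in> S \<Longrightarrow> y \<in> S \<Longrightarrow> x + y \<in> S"
  shows "(semigroup_ring S :: 'k::field poly poly ring) = rng (supported S)"
proof -
  let ?R = "ring_of_type_algebra :: 'k poly poly ring"
  let ?H = "range (\<lambda>c::'k. [:[:c:]:]) \<union> (\<lambda>(i, j). Polynomial.monom (Polynomial.monom 1 i) j) ` S"
  interpret R: ring ?R by (rule ring_from_type_algebra)
  interpret S: subring_of "supported S :: 'k poly poly set" by (rule subring_supported[OF assms])
  have ops: "x \<oplus>\<^bsub>?R\<^esub> y = x + y" "x \<otimes>\<^bsub>?R\<^esub> y = x * y" "\<one>\<^bsub>?R\<^esub> = 1" "\<zero>\<^bsub>?R\<^esub> = 0"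
    "carrier ?R = UNIV" for x y
    by (simp_all add: ring_of_type_algebra_def)
  have neg: "\<ominus>\<^bsub>?R\<^esub> x = - x" for x
    using R.minus_equality[of "- x" x] by (simp add: ops)
  have c: "[:[:c:]:] = tmon 0 c" for c :: 'k by (simp add: tmon_def zero_prod_def monom_0)
  have H: "?H = range (tmon 0) \<union> (\<lambda>x. tmon x 1) ` S"
    by (intro arg_cong2[where f = "(\<union>)"] image_cong refl) (auto simp: c tmon_def)
  have "generate_ring ?R ?H = supported S"
  proof (intro equalityI subsetI)
    fix p assume "p \<in> generate_ring ?R ?H"
    then show "p \<in> supported S"
    proof induction
      case (incl h)
      then show ?case unfolding H by (auto intro: supported_mon assms)
    qed (auto simp: ops neg)
  next
    fix p :: "'k poly poly" assume "p \<in> supported S"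
    then show "p \<in> generate_ring ?R ?H"
    proof (induction rule: supported_induct)
      case zero
      then show ?case using R.zero_in_generate[of ?H] by (simp add: ops)
    next
      case (add_mon x c q)
      have "tmon 0 c \<in> generate_ring ?R ?H" "tmon x 1 \<in> generate_ring ?R ?H"
        using add_mon(1) unfolding H by (auto intro!: generate_ring.incl)
      from generate_ring.eng_add[OF generate_ring.eng_mult[OF this] add_mon(3)]
      show ?case by (simp add: ops tmon_mult)
    qed
  qed
  then show ?thesis unfolding semigroup_ring_def by simp
qed

section \<open>Leading exponents for a lexicographic order\<close>

definition lexp :: "'k::zero poly poly \<Rightarrow> nat \<times> nat" where
  "lexp p = (Polynomial.degree (Polynomial.lead_coeff p), Polynomial.degree p)"

text \<open>The exponent of the outer variable is compared first. The leading term is then the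
  leading coefficient of the leading coefficient, and additivity of \<open>lexp\<close> reduces to
  that of the degree.\<close>

definition lx :: "nat \<times> nat \<Rightarrow> nat \<times> nat \<Rightarrow> bool" where
  "lx x y \<longleftrightarrow> snd x < snd y \<or> snd x = snd y \<and> fst x < fst y"

lemma wfp_lx: "wfp lx"
proof -
  have "{(x, y). lx x y} = inv_image (less_than <*lex*> less_than) (\<lambda>x. (snd x, fst x))"
    by (auto simp: lx_def)
  then show ?thesis unfolding wfp_def by (metis wf_inv_image wf_less_than wf_lex_prod)
qed

lemma cf_lexp: "p \<noteq> 0 \<Longrightarrow> cf p (lexp p) \<noteq> 0"
  by (simp add: cf_def lexp_def)

lemma supp_lexp: "x \<in> supp p \<Longrightarrow> x = lexp p \<or> lx x (lexp p)"
proof -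
  assume "x \<in> supp p"
  then have x: "Polynomial.coeff (Polynomial.coeff p (snd x)) (fst x) \<noteq> 0"
    by (simp add: supp_def cf_def)
  then have "Polynomial.coeff p (snd x) \<noteq> 0" by auto
  then have "snd x \<le> Polynomial.degree p" "fst x \<le> Polynomial.degree (Polynomial.coeff p (snd x))"
    using x by (simp_all add: le_degree)
  then show ?thesis by (cases x) (auto simp: lexp_def lx_def)
qed

lemma lexp_mult:
  fixes p q :: "'k::idom poly poly"
  shows "p \<noteq> 0 \<Longrightarrow> q \<noteq> 0 \<Longrightarrow> lexp (p * q) = lexp p + lexp q"
  using lead_coeff_mult[of p q] degree_mult_eq[of p q]
    degree_mult_eq[of "Polynomial.lead_coeff p" "Polynomial.lead_coeff q"]
  by (simp add: lexp_def)

lemma lexp_eqI: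
  assumes "cf p x \<noteq> 0" "\<And>y. y \<in> supp p \<Longrightarrow> y = x \<or> lx y x" shows "lexp p = x"
proof -
  have "p \<noteq> 0" using assms(1) by auto
  then have "lexp p = x \<or> lx (lexp p) x" using cf_lexp[of p] assms(2)[of "lexp p"] by (simp add: mem_supp)
  moreover have "x = lexp p \<or> lx x (lexp p)" using assms(1) supp_lexp by (simp add: mem_supp)
  ultimately show ?thesis by (auto simp: lx_def)
qed

lemma lexp_diff_less:
  fixes p q :: "'k::ab_group_add poly poly"
  assumes "p \<noteq> 0" "lexp q = lexp p" "cf q (lexp p) = cf p (lexp p)" "p - q \<noteq> 0"
  shows "lx (lexp (p - q)) (lexp p)"
proof -
  have "cf (p - q) (lexp (p - q)) \<noteq> 0" by (rule cf_lexp[OF assms(4)])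
  moreover from this have "cf p (lexp (p - q)) \<noteq> 0 \<or> cf q (lexp (p - q)) \<noteq> 0" by auto
  then have "lexp (p - q) = lexp p \<or> lx (lexp (p - q)) (lexp p)"
    using supp_lexp[of "lexp (p - q)" p] supp_lexp[of "lexp (p - q)" q] assms(2) by (auto simp: mem_supp)
  ultimately show ?thesis using assms(3) by auto
qed

section \<open>Algebraic relations and Krull dimension\<close>

text \<open>Stated for an indexed family because different exponents can give the same product of
  powers; such a coincidence f i = f j is itself a relation.\<close>

lemma (in vector_space) family_dependent:
  assumes "finite I" "finite t" "f ` I \<subseteq> span t" "card t < card I"
  shows "\<exists>c. (\<Sum>i\<in>I. scale (c i) (f i)) = 0 \<and> (\<exists>i\<in>I. c i \<noteq> 0)"
proof (cases "inj_on f I")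
  case True
  then have "card (f ` I) > card t" using assms(4) by (simp add: card_image)
  then have "dependent (f ` I)" using independent_span_bound[OF assms(2) _ assms(3)] by auto
  then obtain u where u: "(\<Sum>v\<in>f ` I. scale (u v) v) = 0" "\<exists>v\<in>f ` I. u v \<noteq> 0"
    using dependent_finite[of "f ` I"] assms(1) by auto
  then show ?thesis
    using True by (intro exI[of _ "\<lambda>i. u (f i)"]) (auto simp: sum.reindex)
next
  case False
  then obtain i j where ij: "i \<in> I" "j \<in> I" "i \<noteq> j" "f i = f j" by (auto simp: inj_on_def)
  define c :: "_ \<Rightarrow> 'a" where "c = (\<lambda>k. if k = i then 1 else if k = j then - 1 else 0)"
  have "(\<Sum>k\<in>I. scale (c k) (f k)) = (\<Sum>k\<in>{i, j}. scale (c k) (f k))"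
    using ij assms(1) by (intro sum.mono_neutral_right) (auto simp: c_def)
  also have "\<dots> = 0" using ij by (simp add: c_def)
  finally show ?thesis using ij by (intro exI[of _ c]) (auto simp: c_def)
qed

lemma sum_factor_low:
  fixes P :: "nat \<Rightarrow> 'a::comm_ring_1"
  assumes "\<And>i. i < a \<Longrightarrow> P i = 0"
  shows "(\<Sum>i<Suc a + m. P i * x ^ i) = x ^ a * (P a + x * (\<Sum>i<m. P (Suc a + i) * x ^ i))"
proof (induction m)
  case 0
  have "(\<Sum>i<a. P i * x ^ i) = 0" using assms by simp
  then show ?case by (simp add: mult.commute)
next
  case (Suc m)
  then show ?case by (simp add: algebra_simps power_add)
qed

text \<open>Evaluation of a one-variable polynomial at z, written as a sum so that supports and
  membership in subalgebras can be read off.\<close>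

definition aev :: "'k::field poly \<Rightarrow> 'k poly poly \<Rightarrow> 'k poly poly" where
  "aev \<phi> z = (\<Sum>l\<le>Polynomial.degree \<phi>. tmon 0 (Polynomial.coeff \<phi> l) * z ^ l)"

lemma aev_bound:
  assumes "Polynomial.degree \<phi> < n"
  shows "aev \<phi> z = (\<Sum>l<n. tmon 0 (Polynomial.coeff \<phi> l) * z ^ l)"
  unfolding aev_def
  using assms by (intro sum.mono_neutral_left) (auto simp: coeff_eq_0)

lemma box_mult:
  fixes p q :: "'k::comm_ring_1 poly poly"
  assumes "p \<in> supported ({..m} \<times> {..m})" "q \<in> supported ({..n} \<times> {..n})"
  shows "p * q \<in> supported ({..m + n} \<times> {..m + n})"
  using assms by (rule supported_mult) auto

lemma box_power:
  fixes p :: "'k::comm_ring_1 poly poly"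
  assumes "p \<in> supported ({..m} \<times> {..m})"
  shows "p ^ i \<in> supported ({..i * m} \<times> {..i * m})"
proof (induction i)
  case 0
  show ?case using supported_mon[of 0 "{..0} \<times> {..0}" "1::'k"] unfolding tmon_one by (simp add: zero_prod_def)
qed (use box_mult[OF assms] in simp)

lemma box_exists: "\<exists>n. p \<in> supported ({..n} \<times> {..n})"
proof -
  have "finite (fst ` supp p \<union> snd ` supp p)" by simp
  then obtain n where "\<forall>k\<in>fst ` supp p \<union> snd ` supp p. k \<le> n"
    using finite_nat_set_iff_bounded_le by blast
  then have "supp p \<subseteq> {..n} \<times> {..n}" by force
  then show ?thesis by (auto simp: supported_def)
qed

text \<open>There are N^3 products \<open>z^l y^j x^i\<close> with exponents below N, all supported
  in a box with \<open>(K + 1)^2\<close> monomials, where K is linear in N. For large N linear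
  dependence is forced.\<close>

lemma algebraic_relation:
  fixes x y z :: "'k::field poly poly"
  shows "\<exists>N c. (\<Sum>i<N. (\<Sum>j<N. (\<Sum>l<N. tmon 0 (c i j l) * z ^ l) * y ^ j) * x ^ i) = 0 \<and>
    (\<exists>i<N. \<exists>j<N. \<exists>l<N. c i j l \<noteq> (0::'k))"
proof -
  interpret V: vector_space "\<lambda>c p. tmon 0 c * (p :: 'k poly poly)"
    by unfold_locales (simp_all add: algebra_simps tmon_add tmon_one tmon_mult flip: mult.assoc)
  obtain dx dy dz where d: "x \<in> supported ({..dx} \<times> {..dx})" "y \<in> supported ({..dy} \<times> {..dy})"
    "z \<in> supported ({..dz} \<times> {..dz})"
    using box_exists by metis
  define d where "d = dx + dy + dz"
  have d: "x \<in> supported ({..d} \<times> {..d})" "y \<in> supported ({..d} \<times> {..d})" "z \<in> supported ({..d} \<times> {..d})"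
    using d by (auto simp: d_def elim!: supported_mono[rotated])
  \<comment> \<open>Chosen so that \<open>(K + 1)^2 <= (3d + 1)^2 N^2 < N^3\<close>.\<close>
  define N where "N = (3 * d + 1) ^ 2 + 1"
  define I where "I = {..<N} \<times> {..<N} \<times> {..<N}"
  define K where "K = 3 * d * N"
  define f where "f = (\<lambda>(i, j, l). z ^ l * (y ^ j * x ^ i))"
  define t where "t = (\<lambda>e. tmon e 1 :: 'k poly poly) ` ({..K} \<times> {..K})"
  have box_span: "p \<in> V.span t" if "p \<in> supported ({..K} \<times> {..K})" for p
    using that
  proof (induction rule: supported_induct)
    case zero show ?case by (rule V.span_zero)
  next
    case (add_mon e c q)
    have "tmon 0 c * tmon e 1 \<in> V.span t"
      using add_mon(1) by (intro V.span_scale V.span_base) (auto simp: t_def)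
    then show ?case using add_mon(3) by (intro V.span_add) (simp_all add: tmon_mult)
  qed
  have "f ` I \<subseteq> V.span t"
  proof
    fix p assume "p \<in> f ` I"
    then obtain i j l where ijl: "i < N" "j < N" "l < N" "p = z ^ l * (y ^ j * x ^ i)"
      by (auto simp: I_def f_def)
    have "p \<in> supported ({..l * d + (j * d + i * d)} \<times> {..l * d + (j * d + i * d)})"
      unfolding ijl(4) by (intro box_mult box_power d)
    moreover have "l * d + (j * d + i * d) \<le> K"
    proof -
      have "l * d \<le> N * d" "j * d \<le> N * d" "i * d \<le> N * d" using ijl by simp_all
      moreover have "K = N * d + (N * d + N * d)" by (simp add: K_def)
      ultimately show ?thesis by linarith
    qed
    ultimately show "p \<in> V.span t"
      by (intro box_span) (auto elim!: supported_mono[rotated])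
  qed
  moreover have "card t < card I"
  proof -
    have "card t \<le> card ({..K} \<times> {..K})" unfolding t_def by (intro card_image_le) simp
    also have "\<dots> = (K + 1) ^ 2" by (simp add: card_cartesian_product power2_eq_square)
    also have "\<dots> \<le> ((3 * d + 1) * N) ^ 2"
      unfolding K_def by (intro power_mono) (simp_all add: N_def)
    also have "\<dots> = (3 * d + 1) ^ 2 * N ^ 2" by (rule power_mult_distrib)
    also have "\<dots> < N * N ^ 2" by (intro mult_strict_right_mono) (simp_all add: N_def)
    also have "\<dots> = card I" by (simp add: I_def card_cartesian_product power2_eq_square)
    finally show ?thesis .
  qed
  ultimately obtain c where c: "(\<Sum>e\<in>I. tmon 0 (c e) * f e) = 0" "\<exists>e\<in>I. c e \<noteq> 0"
    using V.family_dependent[of I t f] by (auto simp: I_def t_def)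
  have "(\<Sum>e\<in>I. tmon 0 (c e) * f e) =
    (\<Sum>i<N. (\<Sum>j<N. (\<Sum>l<N. tmon 0 (c (i, j, l)) * z ^ l) * y ^ j) * x ^ i)"
    by (simp add: I_def f_def sum_distrib_right sum_distrib_left sum.cartesian_product
        case_prod_unfold mult.assoc)
  with c show ?thesis
    by (intro exI[of _ N] exI[of _ "\<lambda>i j l. c (i, j, l)"]) (auto simp: I_def)
qed

text \<open>The relation of \<open>algebraic_relation\<close>, sorted by its lowest power of \<open>x\<close> and then of \<open>y\<close>.
  For a chain \<open>P\<^sub>0 \<subset> P\<^sub>1 \<subset> P\<^sub>2\<close> of primes with \<open>x \<in> P\<^sub>1 - P\<^sub>0\<close> and \<open>y \<in> P\<^sub>2 - P\<^sub>1\<close> the factors can be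
  cancelled from the outside in, which leaves \<open>\<phi>(z) \<in> P\<^sub>2\<close>.\<close>

lemma lowest_relation:
  fixes x y z :: "'k::field poly poly"
  assumes "subring_of A" "\<And>c. tmon 0 c \<in> A" "x \<in> A" "y \<in> A" "z \<in> A"
  shows "\<exists>a b \<phi> r s. \<phi> \<noteq> 0 \<and> r \<in> A \<and> s \<in> A \<and>
    x ^ a * (y ^ b * (aev \<phi> z + y * r) + x * s) = 0"
proof -
  interpret A: subring_of A by fact
  obtain N c where c: "(\<Sum>i<N. (\<Sum>j<N. (\<Sum>l<N. tmon 0 (c i j l) * z ^ l) * y ^ j) * x ^ i) = 0"
    "\<exists>i<N. \<exists>j<N. \<exists>l<N. c i j l \<noteq> 0"
    using algebraic_relation[of z y x] by blast
  define R where "R i j = (\<Sum>l<N. tmon 0 (c i j l) * z ^ l)" for i j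
  define Q where "Q i = (\<Sum>j<N. R i j * y ^ j)" for i
  have RA: "R i j \<in> A" for i j unfolding R_def by (intro A.sum_mem A.mult_mem A.power_mem assms)
  have QA: "Q i \<in> A" for i unfolding Q_def by (intro A.sum_mem A.mult_mem A.power_mem RA assms)
  \<comment> \<open>Both a and, below, b are least with respect to the coefficients c, not to the
    values Q i and R a j; this keeps \<phi> nonzero even where \<open>aev \<phi> z\<close>
    vanishes.\<close>
  define a where "a = (LEAST i. i < N \<and> (\<exists>j<N. \<exists>l<N. c i j l \<noteq> 0))"
  have a: "a < N" "\<exists>j<N. \<exists>l<N. c a j l \<noteq> 0"
    using LeastI_ex[of "\<lambda>i. i < N \<and> (\<exists>j<N. \<exists>l<N. c i j l \<noteq> 0)"] c(2) by (auto simp: a_def)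
  have Q0: "Q i = 0" if "i < a" for i
    using not_less_Least[OF that[unfolded a_def]] that a(1) by (simp add: Q_def R_def)
  define b where "b = (LEAST j. j < N \<and> (\<exists>l<N. c a j l \<noteq> 0))"
  have b: "b < N" "\<exists>l<N. c a b l \<noteq> 0"
    using LeastI_ex[of "\<lambda>j. j < N \<and> (\<exists>l<N. c a j l \<noteq> 0)"] a(2) by (auto simp: b_def)
  have R0: "R a j = 0" if "j < b" for j
    using not_less_Least[OF that[unfolded b_def]] that b(1) by (simp add: R_def)
  define \<phi> where "\<phi> = (\<Sum>l<N. Polynomial.monom (c a b l) l)"
  have coeff: "Polynomial.coeff \<phi> l = (if l < N then c a b l else 0)" for l
    by (simp add: \<phi>_def coeff_sum)
  then have "\<phi> \<noteq> 0" using b(2) by (metis coeff_0)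
  have "Polynomial.degree \<phi> < N" using coeff b(1) \<open>\<phi> \<noteq> 0\<close>
    by (metis leading_coeff_0_iff)
  then have R: "R a b = aev \<phi> z" by (simp add: aev_bound R_def coeff)
  from a(1) obtain m where m: "N = Suc a + m" by (metis add_Suc less_imp_Suc_add)
  from b(1) obtain n where n: "N = Suc b + n" by (metis add_Suc less_imp_Suc_add)
  have "Q a = y ^ b * (R a b + y * (\<Sum>i<n. R a (Suc b + i) * y ^ i))"
    unfolding Q_def n by (rule sum_factor_low) (rule R0)
  moreover have "0 = x ^ a * (Q a + x * (\<Sum>i<m. Q (Suc a + i) * x ^ i))"
  proof -
    have "(\<Sum>i<N. Q i * x ^ i) = 0" using c(1) by (simp only: Q_def R_def)
    then show ?thesis
      using sum_factor_low[where a = a and P = Q and m = m and x = x, OF Q0] unfolding m by metis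
  qed
  ultimately have "x ^ a * (y ^ b * (aev \<phi> z + y * (\<Sum>i<n. R a (Suc b + i) * y ^ i)) +
    x * (\<Sum>i<m. Q (Suc a + i) * x ^ i)) = 0" by (simp add: R)
  moreover have "(\<Sum>i<n. R a (Suc b + i) * y ^ i) \<in> A" "(\<Sum>i<m. Q (Suc a + i) * x ^ i) \<in> A"
    by (intro A.sum_mem A.mult_mem A.power_mem RA QA assms)+
  ultimately show ?thesis using \<open>\<phi> \<noteq> 0\<close> by blast
qed

section \<open>Chains of primes and the dimension of localizations\<close>

locale k_subalgebra = subring_of A for A :: "'k::field poly poly set" +
  assumes const_mem: "tmon 0 c \<in> A"
begin

lemma aev_mem: "z \<in> A \<Longrightarrow> aev \<phi> z \<in> A"
  unfolding aev_def by (intro sum_mem mult_mem power_mem const_mem)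

lemma prime_chain_aev:
  assumes P: "primeideal P0 (rng A)" "primeideal P1 (rng A)" "primeideal P2 (rng A)"
    and "P0 \<subset> P1" "P1 \<subset> P2" and z: "z \<in> A"
  shows "\<exists>\<phi>. \<phi> \<noteq> 0 \<and> aev \<phi> z \<in> P2"
proof -
  obtain x where x: "x \<in> P1" "x \<notin> P0" using assms(4) by blast
  obtain y where y: "y \<in> P2" "y \<notin> P1" using assms(5) by blast
  have xA: "x \<in> A" and yA: "y \<in> A" using x y P by (auto simp: primeideal_iff ideal_iff)
  obtain a b \<phi> r s where *: "\<phi> \<noteq> 0" "r \<in> A" "s \<in> A"
    "x ^ a * (y ^ b * (aev \<phi> z + y * r) + x * s) = 0"
    using lowest_relation[OF subring_of_axioms const_mem xA yA z] by blast
  have pow: "u ^ n \<notin> P" if "primeideal P (rng A)" "u \<in> A" "u \<notin> P" for P u n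
  proof (induction n)
    case 0 then show ?case using that(1) by (simp add: primeideal_iff)
  next
    case (Suc n)
    then show ?case using that power_mem[OF that(2)] by (auto simp: primeideal_iff)
  qed
  have cancel: "v \<in> P" if "primeideal P (rng A)" "u \<in> A" "u \<notin> P" "v \<in> A" "u ^ n * v \<in> P" for P u v n
    using that pow[OF that(1-3)] power_mem[OF that(2)] by (auto simp: primeideal_iff)
  have drop: "u \<in> P" if "primeideal P (rng A)" "v \<in> P" "w \<in> A" "u + v * w \<in> P" for P u v w
  proof -
    have I: "\<And>x y. x \<in> P \<Longrightarrow> y \<in> P \<Longrightarrow> x + y \<in> P" "\<And>b x. b \<in> A \<Longrightarrow> x \<in> P \<Longrightarrow> b * x \<in> P"
      using that(1) by (auto simp: primeideal_iff ideal_iff)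
    have "- w * v \<in> P" using that(2,3) by (intro I) auto
    from I(1)[OF that(4) this] show ?thesis by (simp add: mult.commute)
  qed
  have mem: "aev \<phi> z + y * r \<in> A" "y ^ b * (aev \<phi> z + y * r) + x * s \<in> A"
    using * xA yA aev_mem[OF z] by auto
  have "x ^ a * (y ^ b * (aev \<phi> z + y * r) + x * s) \<in> P0"
    unfolding *(4) using P(1) by (simp add: primeideal_iff ideal_iff)
  from cancel[OF P(1) xA x(2) mem(2) this] have "y ^ b * (aev \<phi> z + y * r) + x * s \<in> P1"
    using assms(4) by blast
  from drop[OF P(2) x(1) *(3) this] have "y ^ b * (aev \<phi> z + y * r) \<in> P1" .
  from cancel[OF P(2) yA y(2) mem(1) this] have "aev \<phi> z + y * r \<in> P2" using assms(5) by blast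
  from drop[OF P(3) y(1) *(2) this] show ?thesis using *(1) by blast
qed

text \<open>Take z in P3 but not in P2. The shorter chain gives a nonzero \<phi> with \<phi>(z) in
  P2. Factors z can be cancelled modulo P2, and what remains has a nonzero constant term, which then
  lies in P3.\<close>

lemma no_prime_chain:
  assumes P: "primeideal P0 (rng A)" "primeideal P1 (rng A)" "primeideal P2 (rng A)"
    "primeideal P3 (rng A)" and "P0 \<subset> P1" "P1 \<subset> P2" "P2 \<subset> P3"
  shows False
proof -
  obtain z where z: "z \<in> P3" "z \<notin> P2" using assms(7) by blast
  have zA: "z \<in> A" using z P by (auto simp: primeideal_iff ideal_iff)
  have P2: "\<And>x y. x \<in> A \<Longrightarrow> y \<in> A \<Longrightarrow> x * y \<in> P2 \<Longrightarrow> x \<in> P2 \<or> y \<in> P2"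
    using P(3) by (auto simp: primeideal_iff)
  have P3: "\<And>x y. x \<in> P3 \<Longrightarrow> y \<in> P3 \<Longrightarrow> x + y \<in> P3" "\<And>b x. b \<in> A \<Longrightarrow> x \<in> P3 \<Longrightarrow> b * x \<in> P3"
    "1 \<notin> P3"
    using P(4) by (auto simp: primeideal_iff ideal_iff)
  have "aev \<phi> z \<notin> P2" if "\<phi> \<noteq> 0" for \<phi>
    using that
  proof (induction "Polynomial.degree \<phi>" arbitrary: \<phi> rule: less_induct)
    case (less \<phi>)
    obtain c \<psi> where \<phi>: "\<phi> = pCons c \<psi>" by (cases \<phi>)
    have aev: "aev \<phi> z = tmon 0 c + z * aev \<psi> z"
    proof -
      define n where "n = Suc (Polynomial.degree \<psi>)"
      have "aev \<phi> z = (\<Sum>l<Suc n. tmon 0 (Polynomial.coeff \<phi> l) * z ^ l)"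
        by (rule aev_bound) (simp add: \<phi> n_def degree_pCons_eq_if)
      also have "\<dots> = tmon 0 c + z * (\<Sum>l<n. tmon 0 (Polynomial.coeff \<psi> l) * z ^ l)"
        by (simp only: sum.lessThan_Suc_shift) (simp add: \<phi> sum_distrib_left mult_ac)
      also have "(\<Sum>l<n. tmon 0 (Polynomial.coeff \<psi> l) * z ^ l) = aev \<psi> z"
        by (rule aev_bound[symmetric]) (simp add: n_def)
      finally show ?thesis .
    qed
    show ?case
    proof
      assume *: "aev \<phi> z \<in> P2"
      show False
      proof (cases "c = 0")
        case True
        with less.prems \<phi> have "\<psi> \<noteq> 0" by auto
        then have "aev \<psi> z \<notin> P2" using less.hyps[of \<psi>] \<phi> by (simp add: degree_pCons_eq)
        then show False using P2[OF zA aev_mem[OF zA]] * z(2) aev True by auto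
      next
        case False
        have "(- aev \<psi> z) * z \<in> P3" using z(1) aev_mem[OF zA] by (intro P3(2)) auto
        then have "aev \<phi> z + (- aev \<psi> z) * z \<in> P3" using * assms(7) by (intro P3(1)) auto
        then have "tmon 0 c \<in> P3" by (simp add: aev mult.commute)
        from P3(2)[OF const_mem[of "inverse c"] this] show False
          using False P3(3) by (simp add: tmon_mult tmon_one)
      qed
    qed
  qed
  then show False using prime_chain_aev[OF P(1-3) assms(5,6) zA] by blast
qed

end

locale localized_k_subalgebra = k_subalgebra A + localized_subring A m
  for A :: "'k::field poly poly set" and m
begin

lemma contr_strict:
  assumes "primeideal P (rng loc)" "primeideal Q (rng loc)" "P \<subset> Q" shows "contr P \<subset> contr Q"
proof -
  have iP: "ideal P (rng loc)" "ideal Q (rng loc)"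
    by (rule primeideal.axioms(1)[OF assms(1)], rule primeideal.axioms(1)[OF assms(2)])
  have "contr P \<noteq> contr Q"
  proof
    assume eq: "contr P = contr Q"
    have "P = ext (contr P)" by (rule ext_contr[OF iP(1), symmetric])
    also have "\<dots> = Q" unfolding eq by (rule ext_contr[OF iP(2)])
    finally have "P = Q" .
    then show False using assms(3) by simp
  qed
  moreover have "contr P \<subseteq> contr Q" using assms(3) unfolding contr_def by blast
  ultimately show ?thesis by (rule psubsetI[rotated])
qed

lemma krull_dim_loc_le: "krull_dim (rng loc) \<le> 2"
  unfolding krull_dim_def
proof (intro Sup_least, elim CollectE exE conjE)
  fix x n and P :: "nat \<Rightarrow> 'k poly poly fract set"
  assume x: "x = enat n" and P: "\<forall>i\<le>n. primeideal (P i) (rng loc)" "\<forall>i<n. P i \<subset> P (Suc i)"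
  have "n \<le> 2"
  proof (rule ccontr)
    assume n: "\<not> n \<le> 2"
    have "primeideal (contr (P i)) (rng A)" if "i \<le> 3" for i
      using P(1) n that by (intro contr_prime(1)) auto
    moreover have "contr (P i) \<subset> contr (P (Suc i))" if "i < 3" for i
      using P n that by (intro contr_strict) auto
    ultimately show False
      using no_prime_chain[of "contr (P 0)" "contr (P 1)" "contr (P 2)" "contr (P 3)"]
      by (simp add: numeral_eq_Suc)
  qed
  then show "x \<le> 2" using x by (simp add: numeral_eq_enat)
qed

text \<open>A chain of length two contracts to one ending inside m, and
  \<open>prime_chain_aev\<close> applies to it. For z a monomial this yields the polynomials U and V
  of \<open>weak_sequence_loc\<close>.\<close>

lemma krull_dim_loc_2:
  assumes "krull_dim (rng loc) = 2" "z \<in> A"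
  shows "\<exists>\<phi>. \<phi> \<noteq> 0 \<and> aev \<phi> z \<in> m"
proof -
  let ?C = "\<lambda>n P. (\<forall>i\<le>n. primeideal (P i) (rng loc)) \<and> (\<forall>i<n. P i \<subset> P (Suc i))"
  have "\<exists>n\<ge>2. \<exists>P. ?C n P"
  proof (rule ccontr)
    assume *: "\<not> (\<exists>n\<ge>2. \<exists>P. ?C n P)"
    have "krull_dim (rng loc) \<le> enat 1"
      unfolding krull_dim_def
    proof (intro Sup_least, elim CollectE exE)
      fix x n assume n: "x = enat n \<and> (\<exists>P. ?C n P)"
      then have "\<not> n \<ge> 2" using * by blast
      then show "x \<le> enat 1" using n by simp
    qed
    then show False using assms(1) by (simp add: numeral_eq_enat)
  qed
  then obtain n P where n: "n \<ge> 2" "?C n P" by blast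
  then have P: "primeideal (P 0) (rng loc)" "primeideal (P 1) (rng loc)" "primeideal (P 2) (rng loc)"
    "P 0 \<subset> P 1" "P 1 \<subset> P 2"
    by (auto simp: numeral_2_eq_2)
  have "\<exists>\<phi>. \<phi> \<noteq> 0 \<and> aev \<phi> z \<in> contr (P 2)"
    using P assms(2) by (intro prime_chain_aev[of "contr (P 0)" "contr (P 1)"] contr_prime contr_strict)
  then show ?thesis using contr_prime(2)[OF P(3)] by blast
qed

text \<open>The witness is the chain {0}, P, m, extended to \<open>loc\<close>.\<close>

lemma krull_dim_loc_ge:
  assumes "primeideal P (rng A)" "P \<subset> m" "P \<noteq> {0}"
  shows "krull_dim (rng loc) = 2"
proof (rule antisym[OF krull_dim_loc_le])
  define Q where "Q = (\<lambda>i::nat. if i = 0 then ext {0} else if i = 1 then ext P else ext m)"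
  have zero: "primeideal {0} (rng A)" using ring_B.zeroprimeideal by simp
  have P0: "0 \<in> P" "P \<subseteq> A" using assms(1) by (auto simp: primeideal_iff ideal_iff)
  have strict: "ext I \<subset> ext J" if "primeideal I (rng A)" "J \<subseteq> m" "I \<subset> J" for I J
  proof -
    from that obtain a where a: "a \<in> J" "a \<notin> I" by blast
    moreover have "a \<in> A" using a that m_subset by blast
    ultimately have "frac_of a \<in> ext J" "frac_of a \<notin> ext I"
      using that frac_of_ext_iff[of I a] by (auto intro: frac_of_ext)
    moreover have "ext I \<subseteq> ext J" using that by (auto simp: ext_def)
    ultimately show ?thesis by blast
  qed
  have "ext {0} \<subset> ext P" using P0 assms by (intro strict zero) auto
  moreover have "ext P \<subset> ext m" using assms by (intro strict) auto
  ultimately have "\<forall>i<2. Q i \<subset> Q (Suc i)" by (auto simp: Q_def less_2_cases_iff)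
  moreover have "\<forall>i\<le>2. primeideal (Q i) (rng loc)"
    unfolding Q_def using zero prime_m assms m_zero by (auto intro!: ext_prime)
  ultimately show "2 \<le> krull_dim (rng loc)"
    unfolding krull_dim_def numeral_eq_enat by (intro Sup_upper CollectI exI[of _ "2::nat"] exI[of _ Q] conjI) auto
qed

end

section \<open>Simplicial semigroups in the plane\<close>

lemma supportedD: "p \<in> supported E \<Longrightarrow> cf p x \<noteq> 0 \<Longrightarrow> x \<in> E"
  unfolding mem_supported by blast

lemma lexp_mem: "p \<in> supported E \<Longrightarrow> p \<noteq> 0 \<Longrightarrow> lexp p \<in> E"
  by (rule supportedD[OF _ cf_lexp])

definition smul :: "nat \<Rightarrow> nat \<times> nat \<Rightarrow> nat \<times> nat" where
  "smul n x = (n * fst x, n * snd x)"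

text \<open>Integer valued because subtraction of naturals truncates; its sign tells on which side
  of the ray of x the point y lies.\<close>

definition pdet :: "nat \<times> nat \<Rightarrow> nat \<times> nat \<Rightarrow> int" where
  "pdet x y = int (fst x) * int (snd y) - int (snd x) * int (fst y)"

lemma smul_simps [simp]:
  "smul 0 x = 0" "smul (Suc 0) x = x" "smul n 0 = 0" "fst (smul n x) = n * fst x" "snd (smul n x) = n * snd x"
  by (simp_all add: smul_def prod_eq_iff)

lemma smul_add: "smul (m + n) x = smul m x + smul n x"
  and smul_add_right: "smul n (x + y) = smul n x + smul n y"
  and smul_smul: "smul m (smul n x) = smul (m * n) x"
  by (simp_all add: prod_eq_iff algebra_simps)

lemma smul_eq_0_iff: "smul n x = 0 \<longleftrightarrow> n = 0 \<or> x = 0"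
  by (auto simp: prod_eq_iff)

lemma tmon_power: "tmon x c ^ n = tmon (smul n x) (c ^ n :: 'k::comm_semiring_1)"
  by (simp add: tmon_def smul_def monom_power mult.commute)

lemma pdet_simps [simp]:
  "pdet (x + y) z = pdet x z + pdet y z" "pdet x (y + z) = pdet x y + pdet x z"
  "pdet (smul n x) y = int n * pdet x y" "pdet x (smul n y) = int n * pdet x y"
  "pdet x x = 0" "pdet 0 x = 0" "pdet x 0 = 0"
  by (simp_all add: pdet_def algebra_simps)

lemma pdet_swap: "pdet y x = - pdet x y"
  by (simp add: pdet_def)

lemma lx_add: "lx x y \<Longrightarrow> lx (z + x) (z + y)"
  by (auto simp: lx_def)

text \<open>Points of the cone of \<open>s\<^sub>1, s\<^sub>2\<close> have nonnegative coordinates \<open>pdet x s2 / D\<close> and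
  \<open>pdet s1 x / D\<close> with respect to \<open>s\<^sub>1, s\<^sub>2\<close>, where \<open>D = pdet s1 s2\<close>.\<close>

locale plane_semigroup =
  fixes S :: "(nat \<times> nat) set" and s1 s2 :: "nat \<times> nat"
  assumes zero_S [simp, intro]: "0 \<in> S"
    and add_S: "x \<in> S \<Longrightarrow> y \<in> S \<Longrightarrow> x + y \<in> S"
    and s1_S: "s1 \<in> S" and s2_S: "s2 \<in> S"
    and det_pos: "0 < pdet s1 s2"
    and S_cone: "x \<in> S \<Longrightarrow> 0 \<le> pdet x s2 \<and> 0 \<le> pdet s1 x"
begin

lemma smul_S: "x \<in> S \<Longrightarrow> smul n x \<in> S"
proof (induction n)
  case (Suc n)
  then show ?case using add_S[of x "smul n x"] smul_add[of 1 n x] by simp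
qed simp

lemma s1_nonzero: "s1 \<noteq> 0" and s2_nonzero: "s2 \<noteq> 0"
  using det_pos by auto

abbreviation D where "D \<equiv> nat (pdet s1 s2)"

lemma cramer:
  assumes "0 \<le> pdet x s2" "0 \<le> pdet s1 x"
  shows "smul D x = smul (nat (pdet x s2)) s1 + smul (nat (pdet s1 x)) s2"
proof -
  have "pdet s1 s2 * int (fst x) = pdet x s2 * int (fst s1) + pdet s1 x * int (fst s2)"
    "pdet s1 s2 * int (snd x) = pdet x s2 * int (snd s1) + pdet s1 x * int (snd s2)"
    by (simp_all add: pdet_def algebra_simps)
  then have "int (D * fst x) = int (nat (pdet x s2) * fst s1 + nat (pdet s1 x) * fst s2)"
    "int (D * snd x) = int (nat (pdet x s2) * snd s1 + nat (pdet s1 x) * snd s2)"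
    using assms det_pos by simp_all
  then show ?thesis unfolding of_nat_eq_iff by (simp add: prod_eq_iff)
qed

text \<open>f and g are the coordinates of D e_n in the basis s1, s2. If neither decreases from i to
  j and both agree modulo D, then e_j - e_i is a natural combination of s1 and s2. Fixing the
  residues by the pigeonhole principle leaves Dickson's lemma in \<nat>^2.\<close>

lemma sequence_dickson:
  fixes e :: "nat \<Rightarrow> nat \<times> nat"
  assumes "\<And>n. e n \<in> S"
  shows "\<exists>i j. i < j \<and> (\<exists>s\<in>S. e j = e i + s)"
proof -
  define f where "f n = nat (pdet (e n) s2)" for n
  define g where "g n = nat (pdet s1 (e n))" for n
  have D: "D > 0" using det_pos by simp
  have eD: "smul D (e n) = smul (f n) s1 + smul (g n) s2" for n
    unfolding f_def g_def using S_cone[OF assms] by (intro cramer) auto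
  have step: "\<exists>s\<in>S. e j = e i + s"
    if "f i \<le> f j" "g i \<le> g j" "f i mod D = f j mod D" "g i mod D = g j mod D" for i j
  proof -
    have "D dvd f j - f i" "D dvd g j - g i"
      using that mod_eq_dvd_iff_nat by metis+
    then obtain k l where kl: "f j - f i = D * k" "g j - g i = D * l" by (auto simp: dvd_def)
    then have "f j = f i + D * k" "g j = g i + D * l" using that by linarith+
    then have "smul D (e j) = smul D (e i + (smul k s1 + smul l s2))"
      by (simp only: eD smul_add smul_add_right smul_smul) (simp add: ac_simps)
    then have "e j = e i + (smul k s1 + smul l s2)" using D by (simp add: prod_eq_iff)
    then show ?thesis using smul_S s1_S s2_S add_S by blast
  qed
  have "finite ((\<lambda>n. (f n mod D, g n mod D)) ` UNIV)"
    by (rule finite_subset[of _ "{..<D} \<times> {..<D}"]) (use D in auto)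
  then obtain n0 where inf: "infinite {n. (f n mod D, g n mod D) = (f n0 mod D, g n0 mod D)}"
    using pigeonhole_infinite[of UNIV "\<lambda>n. (f n mod D, g n mod D)"] by auto
  define A where "A = {n. (f n mod D, g n mod D) = (f n0 mod D, g n0 mod D)}"
  have A: "infinite A" "\<And>i j. i \<in> A \<Longrightarrow> j \<in> A \<Longrightarrow> f i mod D = f j mod D \<and> g i mod D = g j mod D"
    using inf by (auto simp: A_def)
  have least: "\<exists>i\<in>C. \<forall>j\<in>C. f i \<le> f j" if "infinite C" for C
  proof -
    from that have "C \<noteq> {}" by auto
    then obtain k where "k \<in> C" by blast
    then show ?thesis using ex_has_least_nat[of "\<lambda>i. i \<in> C" k f] by blast
  qed
  \<comment> \<open>i minimizes f, so a later index in A whose g is at least g i finishes. Otherwise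
    g is bounded on the later indices, some value recurs infinitely often, and f alone has to be
    compared.\<close>
  obtain i where i: "i \<in> A" "\<And>j. j \<in> A \<Longrightarrow> f i \<le> f j" using least[OF A(1)] by blast
  define A' where "A' = A \<inter> {i<..}"
  have "A = A' \<union> (A \<inter> {..i})" by (auto simp: A'_def)
  then have A': "infinite A'" using A(1) by (metis finite_Int finite_UnI finite_atMost)
  show ?thesis
  proof (cases "\<exists>j\<in>A'. g i \<le> g j")
    case True
    then obtain j where "j \<in> A" "i < j" "g i \<le> g j" by (auto simp: A'_def)
    then show ?thesis using step[of i j] i A(2)[of i j] by blast
  next
    case False
    then have "g j < g i" if "j \<in> A'" for j using that not_le by blast
    then have "g ` A' \<subseteq> {..<g i}" by (intro image_subsetI) simp
    then have "finite (g ` A')" by (rule finite_subset) simp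
    from pigeonhole_infinite[OF A' this] obtain a where inf': "infinite {n\<in>A'. g n = g a}" ..
    from least[OF inf'] obtain i' where i': "i' \<in> {n\<in>A'. g n = g a}"
      "\<forall>j\<in>{n\<in>A'. g n = g a}. f i' \<le> f j" ..
    obtain j where j: "j > i'" "j \<in> {n\<in>A'. g n = g a}"
      using inf'[unfolded infinite_nat_iff_unbounded, rule_format, of i'] by blast
    have "i' \<in> A'" "j \<in> A'" "g i' \<le> g j" "f i' \<le> f j" using i' j by simp_all
    moreover from this have "i' \<in> A" "j \<in> A" unfolding A'_def by blast+
    ultimately have "i' \<in> A" "j \<in> A" "g i' \<le> g j" "f i' \<le> f j" by simp_all
    then show ?thesis using step[of i' j] A(2)[of i' j] j(1) by blast
  qed
qed

lemma subring_S: "subring_of (supported S :: 'k::field poly poly set)"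
  by (rule subring_supported[OF zero_S add_S])

text \<open>If \<open>I\<close> is not finitely generated, pick \<open>f\<^sub>0, f\<^sub>1, \<dots> \<in> I\<close>, each with the least leading exponent
  outside the ideal of its predecessors. By Dickson's lemma some leading exponent is a translate by
  an element of \<open>S\<close> of an earlier one, and subtracting a multiple contradicts minimality.\<close>

lemma noetherian: "noetherian_ring (rng (supported S :: 'k::field poly poly set))"
proof -
  let ?B = "supported S :: 'k poly poly set"
  interpret B: subring_of ?B by (rule subring_S)
  have "\<exists>A\<subseteq>?B. finite A \<and> I = Idl\<^bsub>rng ?B\<^esub> A" if I: "ideal I (rng ?B)" for I
  proof (rule ccontr)
    assume neg: "\<not> (\<exists>A\<subseteq>?B. finite A \<and> I = Idl\<^bsub>rng ?B\<^esub> A)"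
    have IB: "I \<subseteq> ?B" and I_ops: "\<And>x y. x \<in> I \<Longrightarrow> y \<in> I \<Longrightarrow> x + y \<in> I"
      "\<And>b x. b \<in> ?B \<Longrightarrow> x \<in> I \<Longrightarrow> b * x \<in> I"
      using I by (auto simp: B.ideal_iff)
    define good where "good F p \<longleftrightarrow> p \<in> I - Idl\<^bsub>rng ?B\<^esub> F \<and>
      (\<forall>q\<in>I. lx (lexp q) (lexp p) \<longrightarrow> q \<in> Idl\<^bsub>rng ?B\<^esub> F)" for F p
    have ex: "\<exists>p. good F p" if "finite F" "F \<subseteq> I" for F
    proof -
      have "Idl\<^bsub>rng ?B\<^esub> F \<subseteq> I" by (rule B.ring_B.genideal_minimal[OF I that(2)])
      moreover have "I \<noteq> Idl\<^bsub>rng ?B\<^esub> F" using neg that IB by blast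
      ultimately obtain p where "p \<in> I - Idl\<^bsub>rng ?B\<^esub> F" by blast
      then have "lexp ` (I - Idl\<^bsub>rng ?B\<^esub> F) \<noteq> {}" by blast
      then obtain x where "x \<in> lexp ` (I - Idl\<^bsub>rng ?B\<^esub> F)"
        "\<And>y. lx y x \<Longrightarrow> y \<notin> lexp ` (I - Idl\<^bsub>rng ?B\<^esub> F)"
        using wfp_lx unfolding wfp_iff_ex_minimal by metis
      then show ?thesis unfolding good_def by blast
    qed
    define F where "F = rec_nat {} (\<lambda>_ F. insert (SOME p. good F p) F)"
    define f where "f n = (SOME p. good (F n) p)" for n
    have F: "F 0 = {}" "F (Suc n) = insert (f n) (F n)" for n by (simp_all add: F_def f_def)
    have FI: "finite (F n) \<and> F n \<subseteq> I" for n
    proof (induction n)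
      case (Suc n)
      then have "good (F n) (f n)" unfolding f_def using ex someI_ex[of "good (F n)"] by blast
      then show ?case using Suc F by (simp add: good_def)
    qed (simp add: F)
    have good: "good (F n) (f n)" for n
      unfolding f_def using ex[of "F n"] FI[of n] someI_ex[of "good (F n)"] by blast
    have f_F: "f i \<in> F j" if "i < j" for i j
      using that by (induction j) (auto simp: F less_Suc_eq)
    have J: "ideal (Idl\<^bsub>rng ?B\<^esub> (F n)) (rng ?B)" for n
      using FI[of n] IB by (intro B.ring_B.genideal_ideal) auto
    have fB: "f n \<in> ?B" for n using good[of n] IB by (auto simp: good_def)
    have nz: "f n \<noteq> 0" for n using good[of n] J[of n] by (auto simp: good_def B.ideal_iff)
    have "lexp (f n) \<in> S" for n by (rule lexp_mem[OF fB nz])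
    then obtain i j s where ij: "i < j" "s \<in> S" "lexp (f j) = lexp (f i) + s"
      using sequence_dickson[of "\<lambda>n. lexp (f n)"] by blast
    define c where "c = cf (f j) (lexp (f j)) / cf (f i) (lexp (f i))"
    define q where "q = tmon s c * f i"
    have c: "c \<noteq> 0" using cf_lexp[OF nz[of i]] cf_lexp[OF nz[of j]] by (simp add: c_def)
    have lq: "lexp q = lexp (f j)"
    proof -
      have "lexp (tmon s c) = s" using c
        by (intro lexp_eqI) (auto simp: cf_mon mem_supp split: if_splits)
      then show ?thesis using lexp_mult[of "tmon s c" "f i"] c nz ij(3)
        by (simp add: q_def add.commute)
    qed
    have cq: "cf q (lexp (f j)) = cf (f j) (lexp (f j))"
      using cf_mon_mult[of s c "f i" "lexp (f i)"] cf_lexp[OF nz[of i]] ij(3)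
      by (simp add: q_def c_def add.commute)
    have "F j \<subseteq> Idl\<^bsub>rng ?B\<^esub> (F j)"
      using FI[of j] IB by (intro B.ring_B.genideal_self) auto
    then have q: "q \<in> Idl\<^bsub>rng ?B\<^esub> (F j)"
      using f_F[OF ij(1)] J[of j] supported_mon[OF ij(2)] unfolding q_def B.ideal_iff by blast
    have "f j - q \<in> Idl\<^bsub>rng ?B\<^esub> (F j)"
    proof (cases "f j - q = 0")
      case True then show ?thesis using J[of j] by (simp add: B.ideal_iff)
    next
      case False
      have "f j - q = f j + tmon 0 (- 1) * q"
      proof -
        have "tmon 0 (- 1) + 1 = (0 :: 'k poly poly)"
          using tmon_add[of 0 "- 1 :: 'k" 1] by (simp add: tmon_one)
        then have "tmon 0 (- 1) = (- 1 :: 'k poly poly)" by (simp only: eq_neg_iff_add_eq_0)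
        then show ?thesis by simp
      qed
      moreover have "q \<in> I" "f j \<in> I" "tmon 0 (- 1) \<in> ?B"
        using good[of i] good[of j] ij(2)
        by (auto simp: good_def q_def intro!: I_ops supported_mon)
      then have "f j + tmon 0 (- 1) * q \<in> I" by (intro I_ops)
      ultimately have "f j - q \<in> I" by (simp only:)
      moreover have "lx (lexp (f j - q)) (lexp (f j))"
        by (rule lexp_diff_less[OF nz lq cq False])
      ultimately show ?thesis using good[of j] by (simp add: good_def)
    qed
    then have "f j - q + q \<in> Idl\<^bsub>rng ?B\<^esub> (F j)" using q J[of j] unfolding B.ideal_iff by blast
    then show False using good[of j] by (simp add: good_def)
  qed
  then show ?thesis by (intro B.ring_B.noetherian_ringI) simp
qed

end

text \<open>\<open>T\<close> plays the role of the exponents of a Cohen--Macaulay overring; the last assumption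
  says that \<open>\<gamma> = \<beta> - ns\<^sub>2 = \<alpha> - ms\<^sub>1\<close> lies in \<open>T\<close> as soon as \<open>\<gamma> + ms\<^sub>1\<close> and \<open>\<gamma> + ns\<^sub>2\<close> do.\<close>

locale plane_module =
  fixes T :: "(nat \<times> nat) set" and s1 s2 :: "nat \<times> nat"
  assumes T_add: "x \<in> T \<Longrightarrow> x + s1 \<in> T" "x \<in> T \<Longrightarrow> x + s2 \<in> T"
    and T_quadrant: "\<alpha> \<in> T \<Longrightarrow> \<beta> \<in> T \<Longrightarrow> \<alpha> + smul n s2 = \<beta> + smul m s1 \<Longrightarrow> \<exists>\<gamma>\<in>T. \<beta> = \<gamma> + smul n s2"
begin

lemma T_add_smul: "x \<in> T \<Longrightarrow> x + smul n s1 \<in> T" "x \<in> T \<Longrightarrow> x + smul n s2 \<in> T"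
proof -
  show "x \<in> T \<Longrightarrow> x + smul n s1 \<in> T"
  proof (induction n)
    case (Suc n)
    then show ?case using T_add(1)[of "x + smul n s1"] smul_add[of n 1 s1] by (simp add: add.assoc)
  qed simp
  show "x \<in> T \<Longrightarrow> x + smul n s2 \<in> T"
  proof (induction n)
    case (Suc n)
    then show ?case using T_add(2)[of "x + smul n s2"] smul_add[of n 1 s2] by (simp add: add.assoc)
  qed simp
qed

text \<open>Divide \<open>q\<close> by \<open>V\<close> inside \<open>\<bbbk>[T]\<close>, with a remainder none of whose exponents is divisible by
  the leading exponent of \<open>V\<close>. Comparing leading exponents, a nonzero remainder is impossible.\<close>

lemma coprime_dvd:
  fixes U V p q :: "'k::field poly poly"
  assumes U: "U \<in> supported (range (\<lambda>n. smul n s1))" "U \<noteq> 0"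
    and V: "V \<in> supported (range (\<lambda>n. smul n s2))" "V \<noteq> 0"
    and pq: "p \<in> supported T" "q \<in> supported T" "U * q = V * p"
  shows "\<exists>p'\<in>supported T. p = U * p'"
proof -
  obtain m where m: "lexp U = smul m s1" using lexp_mem[OF U] by blast
  obtain n where n: "lexp V = smul n s2" using lexp_mem[OF V] by blast
  define Red where "Red = {\<alpha>\<in>T. \<not> (\<exists>\<gamma>\<in>T. \<alpha> = \<gamma> + smul n s2)}"
  define Dec where "Dec = {r. \<exists>q'\<in>supported T. \<exists>\<rho>\<in>supported Red. r = V * q' + \<rho>}"
  have Dec_zero: "0 \<in> Dec" unfolding Dec_def
    by (intro CollectI bexI[of _ 0]) simp_all
  have Dec_add: "r + r' \<in> Dec" if "r \<in> Dec" "r' \<in> Dec" for r r'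
  proof -
    from that obtain a \<rho> a' \<rho>' where *: "a \<in> supported T" "\<rho> \<in> supported Red"
      "a' \<in> supported T" "\<rho>' \<in> supported Red" "r = V * a + \<rho>" "r' = V * a' + \<rho>'"
      by (auto simp: Dec_def)
    show ?thesis unfolding Dec_def
      by (intro CollectI bexI[of _ "a + a'"] bexI[of _ "\<rho> + \<rho>'"] supported_add *)
        (simp add: * algebra_simps)
  qed
  have Dec_V: "V * a \<in> Dec" if "a \<in> supported T" for a
    unfolding Dec_def using that by (intro CollectI bexI[of _ a] bexI[of _ 0]) simp_all
  have mon_Dec: "tmon \<alpha> c \<in> Dec" if "\<alpha> \<in> T" for \<alpha> c
    using wfp_lx that
  proof (induction \<alpha> arbitrary: c rule: wfp_induct_rule)
    case (less \<alpha>)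
    show ?case
    proof (cases "\<alpha> \<in> Red")
      case True
      then show ?thesis unfolding Dec_def
        by (intro CollectI bexI[of _ 0] bexI[of _ "tmon \<alpha> c"]) (simp_all add: supported_mon)
    next
      case False
      then obtain \<gamma> where \<gamma>: "\<gamma> \<in> T" "\<alpha> = \<gamma> + smul n s2" using less.prems by (auto simp: Red_def)
      define c' where "c' = c / cf V (smul n s2)"
      \<comment> \<open>The multiple of V cancels the term at \<alpha>. The new exponents are
        smaller and stay in T, since all exponents of V are multiples of s2.\<close>
      define r where "r = tmon \<alpha> c - tmon \<gamma> c' * V"
      have supp_r: "x \<in> T \<and> lx x \<alpha>" if "x \<in> supp r" for x
      proof -
        have "x \<noteq> \<alpha>"
        proof
          assume "x = \<alpha>"
          then have "cf r x = 0"
            using cf_mon_mult[of \<gamma> c' V "smul n s2"] cf_lexp[OF V(2)] n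
            by (simp add: r_def \<gamma> c'_def cf_mon)
          then show False using that by (simp add: mem_supp)
        qed
        then have "cf (tmon \<gamma> c' * V) x \<noteq> 0" using that by (simp add: mem_supp r_def cf_mon)
        then obtain y z where yz: "y \<in> supp (tmon \<gamma> c')" "z \<in> supp V" "x = y + z"
          using supp_mult_subset[of "tmon \<gamma> c'" V] by (auto simp: mem_supp)
        then have "y = \<gamma>" by (auto simp: mem_supp cf_mon split: if_splits)
        moreover obtain k where "z = smul k s2" using yz(2) supportedD[OF V(1), of z] unfolding mem_supp by blast
        ultimately have "x \<in> T" using yz \<gamma> T_add_smul(2) by simp
        moreover have "z \<noteq> smul n s2" using \<open>x \<noteq> \<alpha>\<close> yz \<open>y = \<gamma>\<close> \<gamma> by auto
        then have "lx x \<alpha>" using supp_lexp[OF yz(2)] n \<open>y = \<gamma>\<close> yz(3) \<gamma>(2) lx_add by auto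
        ultimately show ?thesis by blast
      qed
      have "r \<in> supported (supp r)" by (simp add: supported_def)
      then have "r \<in> Dec"
      proof (induction rule: supported_induct)
        case (add_mon x d w)
        then show ?case using supp_r less.IH[of x d] by (auto intro: Dec_add)
      qed (rule Dec_zero)
      moreover have "tmon \<alpha> c = V * tmon \<gamma> c' + r" by (simp add: r_def mult.commute)
      ultimately show ?thesis using Dec_V[OF supported_mon[OF \<gamma>(1)]] Dec_add by simp
    qed
  qed
  from pq(2) have "q \<in> Dec"
  proof (induction rule: supported_induct)
    case (add_mon x c w)
    then show ?case using mon_Dec Dec_add by blast
  qed (rule Dec_zero)
  then obtain q' \<rho> where q': "q' \<in> supported T" "\<rho> \<in> supported Red" "q = V * q' + \<rho>"
    by (auto simp: Dec_def)
  \<comment> \<open>Subtracting U q' leaves V p2 = U \<rho>. Comparing leading exponents,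
    \<open>T_quadrant\<close> would split off n s2 from the leading exponent of \<rho>, contrary to
    the choice of \<open>Red\<close>.\<close>
  define p2 where "p2 = p - U * q'"
  have eq: "V * p2 = U * \<rho>" using pq(3) by (simp add: p2_def q'(3) algebra_simps)
  have "U * q' \<in> supported T"
    by (rule supported_mult[OF U(1) q'(1)]) (auto simp: T_add_smul(1) add.commute[of "smul _ _"])
  then have p2: "p2 \<in> supported T" unfolding p2_def by (intro supported_diff pq)
  have "\<rho> = 0"
  proof (rule ccontr)
    assume \<rho>: "\<rho> \<noteq> 0"
    then have "p2 \<noteq> 0" using eq U(2) by auto
    then have "smul n s2 + lexp p2 = smul m s1 + lexp \<rho>"
      using lexp_mult[OF V(2), of p2] lexp_mult[OF U(2) \<rho>] eq m n by simp
    moreover have "lexp p2 \<in> T" by (rule lexp_mem[OF p2 \<open>p2 \<noteq> 0\<close>])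
    moreover have "lexp \<rho> \<in> Red" by (rule lexp_mem[OF q'(2) \<rho>])
    ultimately show False
      using T_quadrant[of "lexp p2" "lexp \<rho>" n m] by (simp add: Red_def add.commute)
  qed
  then have "p = U * q'" using eq V(2) by (simp add: p2_def)
  then show ?thesis using q'(1) by blast
qed

end

section \<open>Buchsbaum rings from finite Cohen--Macaulay extensions\<close>

context plane_semigroup
begin

lemma k_subalgebra_S: "k_subalgebra (supported S :: 'k::field poly poly set)"
  by (intro k_subalgebra.intro subring_S k_subalgebra_axioms.intro supported_mon zero_S)

lemma localized_S:
  assumes "primeideal m (rng (supported S))"
  shows "localized_k_subalgebra (supported S) (m :: 'k::field poly poly set)"
  by (intro localized_k_subalgebra.intro k_subalgebra_S localized_subring.intro subring_S
      localized_subring_axioms.intro assms)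

lemma buchsbaum_S_iff:
  "buchsbaum_ring (rng (supported S :: 'k::field poly poly set)) \<longleftrightarrow>
    (\<forall>m :: 'k poly poly set. maximalideal m (rng (supported S)) \<longrightarrow>
      (\<forall>xs. system_of_parameters (rng (localized_subring.ext (supported S) m (supported S)))
              (localized_subring.ext (supported S) m m) xs \<longrightarrow>
            weak_sequence (rng (localized_subring.ext (supported S) m (supported S)))
              (localized_subring.ext (supported S) m m) xs))"
proof -
  let ?B = "supported S :: 'k poly poly set"
  interpret B: subring_of ?B by (rule subring_S)
  have "buchsbaum_local_ring (localization (rng ?B) (carrier (rng ?B) - m)) \<longleftrightarrow>
      (\<forall>xs. system_of_parameters (rng (localized_subring.ext ?B m ?B))
              (localized_subring.ext ?B m m) xs \<longrightarrow>
            weak_sequence (rng (localized_subring.ext ?B m ?B)) (localized_subring.ext ?B m m) xs)"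
    if "maximalideal m (rng ?B)" for m
  proof -
    have "primeideal m (rng ?B)" by (rule B.ring_B.maximalideal_prime[OF that])
    then have "localized_subring ?B m"
      by (intro localized_subring.intro subring_S localized_subring_axioms.intro)
    from localized_subring.buchsbaum_localization_iff[OF this noetherian] show ?thesis
      by (simp only: rng_simps)
  qed
  then show ?thesis
    unfolding buchsbaum_ring_def using noetherian[where ?'k = 'k] B.ring_B.cring_axioms by simp
qed

lemma const_notin_prime:
  assumes "primeideal m (rng (supported S :: 'k::field poly poly set))" "c \<noteq> 0"
  shows "tmon 0 c \<notin> m"
proof
  interpret B: subring_of "supported S :: 'k poly poly set" by (rule subring_S)
  assume "tmon 0 c \<in> m"
  moreover have "tmon 0 (inverse c) \<in> supported S" by (intro supported_mon zero_S)
  ultimately have "tmon 0 (inverse c) * tmon 0 c \<in> m"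
    using assms(1) unfolding B.primeideal_iff B.ideal_iff by blast
  then show False using assms by (simp add: tmon_mult tmon_one B.primeideal_iff)
qed

end

text \<open>\<open>T_absorb\<close> says that every monomial of S other than 1 annihilates the
  quotient of k[T] by k[S]. T is later instantiated by \<open>bar\<close>.\<close>

locale plane_semigroup_module = plane_semigroup S s1 s2 + plane_module T s1 s2 for S T s1 s2 +
  assumes S_T: "S \<subseteq> T"
    and T_absorb: "x \<in> T \<Longrightarrow> e \<in> S \<Longrightarrow> e \<noteq> 0 \<Longrightarrow> x + e \<in> S"
begin

text \<open>Either some t^e with e nonzero in S lies outside m and carries k[T] into k[S], or m is
  the ideal of the origin and m k[T] is contained in m already. One statement thus serves all
  maximal ideals.\<close>

lemma absorb:
  fixes m :: "'k::field poly poly set"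
  assumes "primeideal m (rng (supported S))"
  shows "\<exists>t\<in>supported S - m. \<forall>g\<in>m. \<forall>p\<in>supported T. t * g * p \<in> m"
proof -
  interpret B: subring_of "supported S :: 'k poly poly set" by (rule subring_S)
  have m: "m \<subseteq> supported S" "0 \<in> m" "\<And>x y. x \<in> m \<Longrightarrow> y \<in> m \<Longrightarrow> x + y \<in> m"
    "\<And>b x. b \<in> supported S \<Longrightarrow> x \<in> m \<Longrightarrow> b * x \<in> m" "1 \<notin> m"
    using assms by (auto simp: B.primeideal_iff B.ideal_iff)
  show ?thesis
  proof (cases "\<exists>e\<in>S. e \<noteq> 0 \<and> tmon e 1 \<notin> m")
    case True
    then obtain e where e: "e \<in> S" "e \<noteq> 0" "tmon e 1 \<notin> m" by blast
    have "tmon e 1 * g * p \<in> m" if "g \<in> m" "p \<in> supported T" for g p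
    proof -
      have "tmon e 1 * p \<in> supported S"
        using that(2) e T_absorb
        by (intro supported_mult[of _ "{e}" _ T]) (auto intro: supported_mon simp: add.commute)
      from m(4)[OF this that(1)] show ?thesis by (simp add: mult_ac)
    qed
    then show ?thesis using e by (intro bexI[of _ "tmon e 1"]) (auto intro: supported_mon)
  next
    case False
    have tmon_m: "tmon e c \<in> m" if "e \<in> S" "e \<noteq> 0" for e c
    proof -
      have "tmon e 1 \<in> m" using False that by blast
      from m(4)[OF supported_mon[OF zero_S, of c] this] show ?thesis by (simp add: tmon_mult)
    qed
    have pos: "p \<in> m" if "p \<in> supported (S - {0})" for p
      using that
    proof (induction rule: supported_induct)
      case (add_mon x c q)
      then show ?case by (intro m(3) tmon_m) auto
    qed (rule m(2))
    \<comment> \<open>A nonzero constant term would put a unit into m.\<close>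
    have g: "g \<in> supported (S - {0})" if "g \<in> m" for g
    proof -
      have gS: "g \<in> supported S" using that m(1) by blast
      define g' where "g' = g - tmon 0 (cf g 0)"
      have "g' \<in> supported (S - {0})"
        unfolding mem_supported g'_def using supportedD[OF gS] by (auto simp: cf_mon)
      then have "- 1 * g' \<in> m" using pos B.uminus_mem[OF B.one_mem] by (intro m(4))
      then have "g + - 1 * g' \<in> m" using that by (intro m(3))
      then have "tmon 0 (cf g 0) \<in> m" by (simp add: g'_def)
      then have "cf g 0 = 0" using const_notin_prime[OF assms] by blast
      then show ?thesis using supportedD[OF gS] unfolding mem_supported by fastforce
    qed
    have "1 * g * p \<in> m" if "g \<in> m" "p \<in> supported T" for g p
    proof (rule pos)
      show "1 * g * p \<in> supported (S - {0})"
        unfolding mult_1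
      proof (rule supported_mult[OF g[OF that(1)] that(2)])
        fix x y assume "x \<in> S - {0}" "y \<in> T"
        then show "x + y \<in> S - {0}" using T_absorb[of y x] by (auto simp: add.commute prod_eq_iff)
      qed
    qed
    then show ?thesis using m(5) by (intro bexI[of _ 1]) auto
  qed
qed

text \<open>A system of parameters has at most two elements by the dimension bound, and a nonzero
  first element is regular in a domain. The work is in the second colon: powers of U and V lie in
  (x, y), and their coprimality over k[T] is passed on to x and y.\<close>

lemma weak_sequence_loc:
  fixes m :: "'k::field poly poly set"
  assumes prime: "primeideal m (rng (supported S))"
    and sop: "system_of_parameters (rng (localized_subring.ext (supported S) m (supported S)))
              (localized_subring.ext (supported S) m m) xs"
  shows "weak_sequence (rng (localized_subring.ext (supported S) m (supported S)))
              (localized_subring.ext (supported S) m m) xs"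
proof -
  let ?B = "supported S :: 'k poly poly set"
  interpret L: localized_k_subalgebra ?B m by (rule localized_S[OF prime])
  let ?M = "L.ext m"
  have xs: "set xs \<subseteq> L.loc" and len: "enat (length xs) = krull_dim (rng L.loc)"
    and rad: "radical_ideal (rng L.loc) (Idl\<^bsub>rng L.loc\<^esub> (set xs)) = ?M"
    using sop by (auto simp: system_of_parameters_def)
  have M_loc: "?M \<subseteq> L.loc" using L.m_subset by (auto simp: L.ext_def)
  have xs_M: "set xs \<subseteq> ?M"
  proof
    fix x assume "x \<in> set xs"
    moreover have "set xs \<subseteq> Idl\<^bsub>rng L.loc\<^esub> (set xs)"
      by (rule L.loc.ring_B.genideal_self) (simp add: xs)
    ultimately have "x ^ 1 \<in> Idl\<^bsub>rng L.loc\<^esub> (set xs)" "x \<in> L.loc" using xs by auto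
    then show "x \<in> ?M" unfolding rad[symmetric] radical_ideal_def by (auto intro: exI[of _ 1])
  qed
  have colon0: "colon_ideal (rng L.loc) {0} E = {0}" if "x \<in> E" "x \<noteq> 0" for E x
    unfolding colon_ideal_def using that by auto
  have first: "colon_ideal (rng L.loc) {0} {x} = colon_ideal (rng L.loc) {0} ?M"
    if "x \<in> ?M" "x \<noteq> 0" for x
    using colon0[of x "{x}"] colon0[of x ?M] that by simp
  have "length xs \<le> 2"
    using L.krull_dim_loc_le len by (metis enat_ord_simps(1) numeral_eq_enat)
  then consider "xs = []" | x where "xs = [x]" | x y where "xs = [x, y]"
    by (cases xs; cases "tl xs"; cases "tl (tl xs)") auto
  then show ?thesis
  proof cases
    case 1
    then show ?thesis by (simp add: weak_sequence_def)
  next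
    case (2 x)
    have "colon_ideal (rng L.loc) {0} {x} = colon_ideal (rng L.loc) {0} ?M"
    proof (cases "x = 0")
      case True
      \<comment> \<open>The radical of the zero ideal of a domain is zero, so the maximal ideal
        vanishes and both colons agree.\<close>
      have "?M = {0}"
        unfolding rad[symmetric] using L.loc.ring_B.genideal_zero True 2
        by (auto simp: radical_ideal_def)
      then show ?thesis using True by simp
    next
      case False
      then show ?thesis using first xs_M 2 by simp
    qed
    then show ?thesis
      using 2 by (simp add: weak_sequence_def L.loc.genideal_empty)
  next
    case (3 x y)
    have dim: "krull_dim (rng L.loc) = 2" using len[symmetric] unfolding 3 by (simp add: numeral_eq_enat)
    have xy: "x \<in> ?M" "y \<in> ?M" using xs_M 3 by auto
    then obtain x0 sx y0 sy where x0: "x0 \<in> m" "sx \<in> L.M" "sx \<noteq> 0" "x = frac_of x0 / frac_of sx"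
      and y0: "y0 \<in> m" "sy \<in> L.M" "sy \<noteq> 0" "y = frac_of y0 / frac_of sy"
      by (elim L.extE)
    have B: "x0 \<in> ?B" "y0 \<in> ?B" "sx \<in> ?B" "sy \<in> ?B" using x0 y0 L.m_subset by auto
    have xyl: "x \<in> L.loc" "y \<in> L.loc" using xy M_loc by auto
    \<comment> \<open>Membership of u in the radical of (x, y), with all denominators
      cleared.\<close>
    have in_radical: "\<exists>s\<in>L.M. \<exists>n. \<exists>a\<in>?B. \<exists>b\<in>?B. s * u ^ n = a * x0 + b * y0" if "u \<in> m" for u
    proof -
      have "frac_of u \<in> ?M" using that by (rule L.frac_of_ext)
      then obtain n where "frac_of u ^ n \<in> Idl\<^bsub>rng L.loc\<^esub> {x, y}"
        unfolding rad[symmetric] by (auto simp: radical_ideal_def 3)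
      then obtain \<alpha> \<beta> where ab: "\<alpha> \<in> L.loc" "\<beta> \<in> L.loc" "frac_of u ^ n = \<alpha> * x + \<beta> * y"
        unfolding L.loc.genideal_pair[OF xyl] by blast
      then obtain a sa b sb where a: "a \<in> ?B" "sa \<in> L.M" "sa \<noteq> 0" "\<alpha> = frac_of a / frac_of sa"
        and b: "b \<in> ?B" "sb \<in> L.M" "sb \<noteq> 0" "\<beta> = frac_of b / frac_of sb"
        by (elim L.extE)
      have "frac_of (sa * sb * sx * sy * u ^ n) = frac_of ((a * sb * sy) * x0 + (b * sa * sx) * y0)"
        using x0(3) y0(3) a(3) b(3) ab(3) unfolding a(4) b(4) x0(4) y0(4) by (simp add: field_simps)
      then have "sa * sb * sx * sy * u ^ n = (a * sb * sy) * x0 + (b * sa * sx) * y0"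
        by (simp only: frac_of_simps(6))
      moreover have "sa * sb * sx * sy \<in> L.M" by (intro L.M_mult a b x0 y0)
      moreover have "a * sb * sy \<in> ?B" "b * sa * sx \<in> ?B" using a b B L.M_B by auto
      ultimately show ?thesis by blast
    qed
    obtain t where t: "t \<in> L.M" "\<And>g p. g \<in> m \<Longrightarrow> p \<in> supported T \<Longrightarrow> t * g * p \<in> m"
      using absorb[OF prime] by blast
    have BT: "p \<in> supported T" if "p \<in> ?B" for p using that S_T by (rule supported_mono[rotated])
    have param: "\<exists>U\<in>m. U \<noteq> 0 \<and> (\<forall>n. U ^ n \<in> supported (range (\<lambda>n. smul n e)))"
      if e: "e \<in> S" "e \<noteq> 0" for e
    proof -
      obtain \<phi> where \<phi>: "\<phi> \<noteq> 0" "aev \<phi> (tmon e 1) \<in> m"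
        using L.krull_dim_loc_2[OF dim supported_mon[OF e(1)]] by blast
      let ?N = "range (\<lambda>n. smul n e)"
      have N: "0 \<in> ?N" "\<And>x y. x \<in> ?N \<Longrightarrow> y \<in> ?N \<Longrightarrow> x + y \<in> ?N"
        using smul_add[of _ _ e, symmetric] by (auto intro: rev_image_eqI[of 0])
      interpret N: subring_of "supported ?N :: 'k poly poly set" by (rule subring_supported[OF N])
      have eq: "aev \<phi> (tmon e 1) = (\<Sum>l\<le>Polynomial.degree \<phi>. tmon (smul l e) (Polynomial.coeff \<phi> l))"
        by (simp add: aev_def tmon_power tmon_mult)
      \<comment> \<open>The exponents l e are distinct because e is nonzero, so the terms of \<phi>
        do not collide.\<close>
      have "cf (aev \<phi> (tmon e 1)) (smul (Polynomial.degree \<phi>) e) = Polynomial.lead_coeff \<phi>"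
      proof -
        have "smul l e = smul (Polynomial.degree \<phi>) e \<longleftrightarrow> l = Polynomial.degree \<phi>" for l
          using e(2) by (auto simp: prod_eq_iff)
        then show ?thesis by (simp add: eq cf_mon)
      qed
      then have "aev \<phi> (tmon e 1) \<noteq> 0" using \<phi>(1) by auto
      moreover have "aev \<phi> (tmon e 1) \<in> supported ?N"
        unfolding eq by (intro supported_sum supported_mon) auto
      ultimately show ?thesis using \<phi>(2) N.power_mem by blast
    qed
    obtain U where U: "U \<in> m" "U \<noteq> 0" "\<And>n. U ^ n \<in> supported (range (\<lambda>n. smul n s1))"
      using param[OF s1_S s1_nonzero] by blast
    obtain V where V: "V \<in> m" "V \<noteq> 0" "\<And>n. V ^ n \<in> supported (range (\<lambda>n. smul n s2))"
      using param[OF s2_S s2_nonzero] by blast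
    obtain sU n a b where U': "sU \<in> L.M" "a \<in> ?B" "b \<in> ?B" "sU * U ^ n = a * x0 + b * y0"
      using in_radical[OF U(1)] by blast
    obtain sV k a' b' where V': "sV \<in> L.M" "a' \<in> ?B" "b' \<in> ?B" "sV * V ^ k = a' * x0 + b' * y0"
      using in_radical[OF V(1)] by blast
    have UB: "U \<in> ?B" "V \<in> ?B" "sU \<in> ?B" "sV \<in> ?B" using U V U' V' L.m_subset by auto
    have nz: "U ^ n \<noteq> 0" "V ^ k \<noteq> 0" "sU \<noteq> 0" "sV \<noteq> 0" using U V U' V' L.M_nonzero by auto
    have factor: "\<exists>p'\<in>supported T. p = U ^ n * p'"
      if "p \<in> ?B" "q \<in> ?B" "U ^ n * q = V ^ k * p" for p q
      using coprime_dvd[OF U(3) nz(1) V(3) nz(2) BT BT] that by blast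
    \<comment> \<open>With x0 = 0 both U^n and V^k divide out y0 up to factors outside m.
      Coprimality then makes y0 a divisor over k[T] of sU sV, and \<open>absorb\<close> puts t sU sV
      into m although its factors lie outside m.\<close>
    have "x0 \<noteq> 0"
    proof
      assume "x0 = 0"
      then have eqs: "sU * U ^ n = b * y0" "sV * V ^ k = b' * y0" using U' V' by simp_all
      have y0nz: "y0 \<noteq> 0" using eqs(1) nz by auto
      have "(U ^ n * (sU * b')) * y0 = (V ^ k * (sV * b)) * y0"
        using eqs by (simp add: algebra_simps)
      then have "U ^ n * (sU * b') = V ^ k * (sV * b)" by (simp only: mult_right_cancel[OF y0nz])
      then obtain p' where p': "p' \<in> supported T" "sV * b = U ^ n * p'"
        using factor[of "sV * b" "sU * b'"] UB U' V' by auto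
      have "U ^ n * (sU * sV) = U ^ n * (y0 * p')"
      proof -
        have "U ^ n * (sU * sV) = sV * (sU * U ^ n)" by (simp only: mult_ac)
        also have "\<dots> = (sV * b) * y0" unfolding eqs(1) by (simp only: mult_ac)
        also have "\<dots> = U ^ n * (y0 * p')" unfolding p'(2) by (simp only: mult_ac)
        finally show ?thesis .
      qed
      then have "sU * sV = y0 * p'" by (simp only: mult_left_cancel[OF nz(1)])
      then have "t * (sU * sV) \<in> m" using t(2)[OF y0(1) p'(1)] by (simp add: mult.assoc)
      moreover have "t * (sU * sV) \<in> L.M" by (intro L.M_mult t U' V')
      ultimately show False by blast
    qed
    then have xnz: "x \<noteq> 0" using x0 by simp
    have second: "v * g \<in> Idl\<^bsub>rng L.loc\<^esub> {x}"
      if v: "v \<in> L.loc" "v * y \<in> Idl\<^bsub>rng L.loc\<^esub> {x}" and g: "g \<in> ?M" for v g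
    proof -
      obtain w where w: "w \<in> L.loc" "v * y = w * x"
        using v(2) unfolding L.loc.genideal_single[OF xyl(1)] by blast
      obtain v0 sv where v0: "v0 \<in> ?B" "sv \<in> L.M" "sv \<noteq> 0" "v = frac_of v0 / frac_of sv"
        using v(1) by (elim L.extE)
      obtain w0 sw where w0: "w0 \<in> ?B" "sw \<in> L.M" "sw \<noteq> 0" "w = frac_of w0 / frac_of sw"
        using w(1) by (elim L.extE)
      obtain g0 sg where g0: "g0 \<in> m" "sg \<in> L.M" "sg \<noteq> 0" "g = frac_of g0 / frac_of sg"
        using g by (elim L.extE)
      define z where "z = v0 * sx * sw"
      define w1 where "w1 = w0 * sv * sy"
      have zB: "z \<in> ?B" "w1 \<in> ?B" using v0 w0 B L.M_B by (auto simp: z_def w1_def)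
      have "frac_of (z * y0) = frac_of (w1 * x0)"
        using w(2) x0(3) y0(3) v0(3) w0(3) unfolding x0(4) y0(4) v0(4) w0(4)
        by (simp add: z_def w1_def field_simps)
      then have zy: "z * y0 = w1 * x0" by (simp only: frac_of_simps(6))
      \<comment> \<open>Combining the expressions for U^n and V^k with z y0 = w1 x0 gives U^n z = x0
        p and V^k z = x0 q up to the factor sU sV, hence U^n q = V^k p.\<close>
      define p where "p = sV * (a * z + b * w1)"
      define q where "q = sU * (a' * z + b' * w1)"
      have pq: "p \<in> ?B" "q \<in> ?B" using zB U' V' UB by (auto simp: p_def q_def)
      have eqU: "U ^ n * (sU * sV * z) = x0 * p"
      proof -
        have "U ^ n * (sU * sV * z) = sV * ((sU * U ^ n) * z)" by (simp add: mult_ac)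
        also have "\<dots> = sV * (a * x0 * z + b * (z * y0))" unfolding U'(4) by (simp add: algebra_simps)
        also have "\<dots> = x0 * p" unfolding zy p_def by (simp add: algebra_simps)
        finally show ?thesis .
      qed
      have eqV: "V ^ k * (sU * sV * z) = x0 * q"
      proof -
        have "V ^ k * (sU * sV * z) = sU * ((sV * V ^ k) * z)" by (simp add: mult_ac)
        also have "\<dots> = sU * (a' * x0 * z + b' * (z * y0))" unfolding V'(4) by (simp add: algebra_simps)
        also have "\<dots> = x0 * q" unfolding zy q_def by (simp add: algebra_simps)
        finally show ?thesis .
      qed
      have "x0 * (U ^ n * q) = U ^ n * (V ^ k * (sU * sV * z))" unfolding eqV by (simp add: mult_ac)
      also have "\<dots> = V ^ k * (U ^ n * (sU * sV * z))" by (simp add: mult_ac)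
      also have "\<dots> = x0 * (V ^ k * p)" unfolding eqU by (simp add: mult_ac)
      finally have "U ^ n * q = V ^ k * p" by (simp only: mult_left_cancel[OF \<open>x0 \<noteq> 0\<close>])
      then obtain p' where p': "p' \<in> supported T" "p = U ^ n * p'" using factor pq by blast
      have "U ^ n * (sU * sV * z) = U ^ n * (x0 * p')" unfolding eqU p'(2) by (simp add: mult_ac)
      then have sz: "sU * sV * z = x0 * p'" by (simp only: mult_left_cancel[OF nz(1)])
      \<comment> \<open>p' lies only in k[T]; the factors t and g0 bring it back into k[S]. The
        remaining denominators are collected in s.\<close>
      define c where "c = t * g0 * p'"
      have c: "c \<in> ?B" unfolding c_def using t(2)[OF g0(1) p'(1)] L.m_subset by blast
      define s where "s = sU * sV * sw * sv * sg * t"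
      have "s \<in> L.M" unfolding s_def by (intro L.M_mult U' V' w0 v0 g0 t)
      then have cs: "frac_of c / frac_of s \<in> L.loc" using c by (rule L.extI[rotated])
      have "t * g0 * (sU * sV * z) = c * x0" unfolding sz c_def by (simp add: mult_ac)
      then have "frac_of t * frac_of g0 * (frac_of sU * frac_of sV * (frac_of v0 * frac_of sx * frac_of sw)) =
        frac_of c * frac_of x0"
        unfolding z_def by (simp flip: frac_of_simps(3))
      then have "v * g = frac_of c / frac_of s * x"
        using x0(3) v0(3) w0(3) g0(3) nz(3,4) L.M_nonzero[OF t(1)]
        unfolding x0(4) v0(4) g0(4) by (simp add: s_def field_simps)
      then show ?thesis unfolding L.loc.genideal_single[OF xyl(1)] using cs by blast
    qed
    have "colon_ideal (rng L.loc) (Idl\<^bsub>rng L.loc\<^esub> {x}) {y} =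
        colon_ideal (rng L.loc) (Idl\<^bsub>rng L.loc\<^esub> {x}) ?M"
      unfolding colon_ideal_def using second xy(2) by auto
    moreover have "colon_ideal (rng L.loc) {0} {x} = colon_ideal (rng L.loc) {0} ?M"
      by (rule first[OF xy(1) xnz])
    ultimately show ?thesis
      unfolding weak_sequence_def 3 by (auto simp: less_Suc_eq L.loc.genideal_empty)
  qed
qed

lemma buchsbaum: "buchsbaum_ring (rng (supported S :: 'k::field poly poly set))"
proof -
  interpret B: subring_of "supported S :: 'k poly poly set" by (rule subring_S)
  show ?thesis
    by (subst buchsbaum_S_iff) (intro allI impI weak_sequence_loc B.ring_B.maximalideal_prime)
qed

end

section \<open>Consequences of the Buchsbaum property at the origin\<close>

context plane_semigroup
begin

text \<open>Dropping all terms outside the face F sends k[S] to the domain k[F]. \<open>res\<close>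
  is this map, and a nonzero product of restrictions has its leading exponent in F.\<close>

lemma face_prime:
  assumes F: "F \<subseteq> S" "0 \<in> F" "\<And>x y. x \<in> S \<Longrightarrow> y \<in> S \<Longrightarrow> x + y \<in> F \<longleftrightarrow> x \<in> F \<and> y \<in> F"
  shows "primeideal (supported (S - F)) (rng (supported S :: 'k::field poly poly set))"
proof -
  let ?B = "supported S :: 'k poly poly set" and ?P = "supported (S - F) :: 'k poly poly set"
  interpret B: subring_of ?B by (rule subring_S)
  have mult: "b * x \<in> ?P" if "b \<in> ?B" "x \<in> ?P" for b x
    using F(3) add_S by (intro supported_mult[OF that]) auto
  have I: "ideal ?P (rng ?B)"
    unfolding B.ideal_iff using mult by (auto intro: supported_add supported_mono[of "S - F" S])
  have one: "1 \<notin> ?P"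
    using supported_mon_iff[of "1::'k" 0 "S - F"] F(2) by (simp add: tmon_one)
  define res where "res p = (\<Sum>x\<in>supp p \<inter> F. tmon x (cf p x))" for p :: "'k poly poly"
  have cf_res: "cf (res p) x = (if x \<in> F then cf p x else 0)" for p x
    by (simp add: res_def cf_mon mem_supp)
  have res_F: "res p \<in> supported F" for p
    unfolding mem_supported cf_res by simp
  have res_P: "p - res p \<in> ?P" if "p \<in> ?B" for p
    unfolding mem_supported cf_diff cf_res using supportedD[OF that] by simp
  have res_0: "res p \<noteq> 0" if "p \<in> ?B" "p \<notin> ?P" for p
    using res_P[OF that(1)] that(2) by auto
  have "x \<in> ?P \<or> y \<in> ?P" if xy: "x \<in> ?B" "y \<in> ?B" "x * y \<in> ?P" for x y
  proof (rule ccontr)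
    assume "\<not> (x \<in> ?P \<or> y \<in> ?P)"
    then have nz: "res x * res y \<noteq> 0" using res_0 xy by simp
    have "res x \<in> ?B" by (rule supported_mono[OF F(1) res_F])
    then have "y * (x - res x) + res x * (y - res y) \<in> ?P"
      by (intro supported_add mult res_P xy)
    from supported_diff[OF xy(3) this] have "res x * res y \<in> ?P" by (simp add: algebra_simps)
    moreover have "res x * res y \<in> supported F"
      using F by (intro supported_mult[OF res_F res_F]) blast
    ultimately have "lexp (res x * res y) \<in> S - F" "lexp (res x * res y) \<in> F"
      using lexp_mem nz by blast+
    then show False by blast
  qed
  then show ?thesis unfolding B.primeideal_iff using I one by blast
qed

text \<open>Every element is congruent to its constant term, and a nonzero constant is
  invertible.\<close>

lemma origin_maximal: "maximalideal (supported (S - {0})) (rng (supported S :: 'k::field poly poly set))"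
proof -
  let ?B = "supported S :: 'k poly poly set" and ?m = "supported (S - {0}) :: 'k poly poly set"
  interpret B: subring_of ?B by (rule subring_S)
  have prime: "primeideal ?m (rng ?B)"
    by (rule face_prime) (auto simp: prod_eq_iff)
  show ?thesis
  proof (rule maximalidealI)
    show "ideal ?m (rng ?B)" "carrier (rng ?B) \<noteq> ?m"
      using prime unfolding B.primeideal_iff by auto
    fix J assume J: "ideal J (rng ?B)" "?m \<subseteq> J" "J \<subseteq> carrier (rng ?B)"
    show "J = ?m \<or> J = carrier (rng ?B)"
    proof (rule disjCI)
      assume ne: "J \<noteq> carrier (rng ?B)"
      have "p \<in> ?m" if p: "p \<in> J" for p
      proof (rule ccontr)
        assume np: "p \<notin> ?m"
        have pB: "p \<in> ?B" using p J(3) by auto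
        then have c: "cf p 0 \<noteq> 0" using np supportedD[OF pB] unfolding mem_supported by blast
        have "tmon 0 (cf p 0) - p \<in> ?m"
          unfolding mem_supported using supportedD[OF pB] by (auto simp: cf_mon)
        then have "tmon 0 (cf p 0) - p + p \<in> J" using J p unfolding B.ideal_iff by blast
        then have 1: "tmon 0 (cf p 0) \<in> J" by simp
        have "tmon 0 (inverse (cf p 0)) \<in> ?B" by (intro supported_mon zero_S)
        with 1 have "tmon 0 (inverse (cf p 0)) * tmon 0 (cf p 0) \<in> J"
          using J(1) unfolding B.ideal_iff by blast
        then have "1 \<in> J" using c by (simp add: tmon_mult tmon_one)
        then have "b * 1 \<in> J" if "b \<in> ?B" for b using that J(1) unfolding B.ideal_iff by blast
        then show False using ne J(3) by auto
      qed
      then show "J = ?m" using J(2) by blast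
    qed
  qed
qed

text \<open>Put x = t^(N s1), y = t^(N s2) and z = t^(\<alpha> + N s1). Then z y = t^(\<alpha> + N
  s2) x, although t^\<alpha> may lie outside k[S]. So z belongs to (x) : y = (x) : m, and z t^e in
  (x) yields the claim.\<close>

lemma buchsbaum_imp:
  assumes "buchsbaum_ring (rng (supported S :: 'k::field poly poly set))"
    and N: "0 < N" and \<alpha>: "\<alpha> + smul N s1 \<in> S" "\<alpha> + smul N s2 \<in> S" and e: "e \<in> S" "e \<noteq> 0"
  shows "\<alpha> + e \<in> S"
proof -
  let ?B = "supported S :: 'k poly poly set" and ?m = "supported (S - {0}) :: 'k poly poly set"
  interpret B: subring_of ?B by (rule subring_S)
  have prime: "primeideal ?m (rng ?B)"
    by (rule B.ring_B.maximalideal_prime[OF origin_maximal])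
  interpret L: localized_k_subalgebra ?B ?m by (rule localized_S[OF prime])
  define h1 where "h1 = smul N s1"
  define h2 where "h2 = smul N s2"
  have h: "h1 \<in> S" "h2 \<in> S" "h1 \<noteq> 0" "h2 \<noteq> 0"
    using smul_S s1_S s2_S N s1_nonzero s2_nonzero by (auto simp: h1_def h2_def smul_eq_0_iff)
  define x where "x = frac_of (tmon h1 1 :: 'k poly poly)"
  define y where "y = frac_of (tmon h2 1 :: 'k poly poly)"
  have tm: "tmon u c \<in> ?m" if "u \<in> S" "u \<noteq> 0" for u c using that by (intro supported_mon) simp
  have xy: "x \<in> L.loc" "y \<in> L.loc" "x \<in> L.ext ?m" "y \<in> L.ext ?m"
    unfolding x_def y_def using h by (auto intro!: L.frac_of_ext supported_mon)
  have dim: "krull_dim (rng L.loc) = 2"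
  proof (rule L.krull_dim_loc_ge)
    \<comment> \<open>The face of S on the ray of s1. Its prime contains t^s2 but not t^s1, so it
      lies strictly between 0 and m.\<close>
    define F where "F = {u\<in>S. pdet s1 u = 0}"
    show "primeideal (supported (S - F)) (rng ?B)"
      using S_cone by (intro face_prime) (auto simp: F_def add_S add_nonneg_eq_0_iff)
    have "tmon s1 1 \<in> ?m" using s1_S s1_nonzero by (rule tm)
    moreover have "(tmon s1 1 :: 'k poly poly) \<notin> supported (S - F)"
      using supported_mon_iff[of "1::'k" s1 "S - F"] s1_S by (simp add: F_def)
    moreover have "supported (S - F) \<subseteq> ?m"
      by (intro subsetI supported_mono[of "S - F" "S - {0}"]) (auto simp: F_def)
    ultimately show "supported (S - F) \<subset> ?m" by blast
    have mem: "(tmon s2 1 :: 'k poly poly) \<in> supported (S - F)"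
      using s2_S det_pos by (intro supported_mon) (simp add: F_def)
    show "supported (S - F) \<noteq> ({0} :: 'k poly poly set)"
    proof
      assume "supported (S - F) = ({0} :: 'k poly poly set)"
      from mem[unfolded this] show False by simp
    qed
  qed
  let ?I = "Idl\<^bsub>rng L.loc\<^esub> {x, y}"
  have I: "ideal ?I (rng L.loc)" using xy by (intro L.loc.ring_B.genideal_ideal) simp
  have R: "ideal (radical_ideal (rng L.loc) ?I) (rng L.loc)" by (rule L.loc.ideal_radical[OF I])
  have mem_rad: "frac_of (tmon u 1 :: 'k poly poly) \<in> radical_ideal (rng L.loc) ?I"
    if u: "u \<in> S" "u \<noteq> 0" for u
  proof -
    have "D > 0" using det_pos by simp
    define i where "i = nat (pdet u s2)"
    define j where "j = nat (pdet s1 u)"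
    have Du: "smul D u = smul i s1 + smul j s2"
      unfolding i_def j_def using S_cone[OF u(1)] by (intro cramer) auto
    have NDu: "smul (N * D) u = smul i h1 + smul j h2"
      unfolding h1_def h2_def smul_smul[symmetric] Du smul_add_right by (simp add: smul_smul mult.commute)
    \<comment> \<open>One of the coefficients of h1 and h2 is positive, so a power of t^u is
      divisible by x or by y.\<close>
    have "i > 0 \<or> j > 0" using Du u(2) \<open>D > 0\<close> smul_eq_0_iff[of D u] by (cases i; cases j) auto
    then have "frac_of (tmon u 1 :: 'k poly poly) ^ (N * D) \<in> ?I"
    proof
      assume "i > 0"
      then obtain i' where i': "i = Suc i'" using gr0_implies_Suc by blast
      have "smul (N * D) u = (smul i' h1 + smul j h2) + h1"
        using smul_add[of i' 1 h1] unfolding NDu i' by (simp add: ac_simps)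
      then have "frac_of (tmon u 1 :: 'k poly poly) ^ (N * D) = frac_of (tmon (smul i' h1 + smul j h2) 1) * x + 0 * y"
        unfolding x_def by (simp add: tmon_power tmon_mult flip: frac_of_power frac_of_simps(3))
      moreover have "frac_of (tmon (smul i' h1 + smul j h2) 1 :: 'k poly poly) \<in> L.loc"
        using h by (intro L.frac_of_ext supported_mon add_S smul_S)
      ultimately show ?thesis unfolding L.loc.genideal_pair[OF xy(1,2)] using L.loc.zero_mem by blast
    next
      assume "j > 0"
      then obtain j' where j': "j = Suc j'" using gr0_implies_Suc by blast
      have "smul (N * D) u = (smul i h1 + smul j' h2) + h2"
        using smul_add[of j' 1 h2] unfolding NDu j' by (simp add: ac_simps)
      then have "frac_of (tmon u 1 :: 'k poly poly) ^ (N * D) = 0 * x + frac_of (tmon (smul i h1 + smul j' h2) 1) * y"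
        unfolding y_def by (simp add: tmon_power tmon_mult flip: frac_of_power frac_of_simps(3))
      moreover have "frac_of (tmon (smul i h1 + smul j' h2) 1 :: 'k poly poly) \<in> L.loc"
        using h by (intro L.frac_of_ext supported_mon add_S smul_S)
      ultimately show ?thesis unfolding L.loc.genideal_pair[OF xy(1,2)] using L.loc.zero_mem by blast
    qed
    moreover have "frac_of (tmon u 1 :: 'k poly poly) \<in> L.loc" using u by (intro L.frac_of_ext supported_mon)
    ultimately show ?thesis unfolding radical_ideal_def by auto
  qed
  have sop: "system_of_parameters (rng L.loc) (L.ext ?m) [x, y]"
  proof -
    have "radical_ideal (rng L.loc) ?I = L.ext ?m"
    proof (intro equalityI subsetI)
      have pr: "primeideal (L.ext ?m) (rng L.loc)" by (rule L.ext_prime[OF prime subset_refl])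
      have sub: "?I \<subseteq> L.ext ?m"
        using xy(3,4) pr by (intro L.loc.ring_B.genideal_minimal) (auto simp: L.loc.primeideal_iff)
      fix v assume "v \<in> radical_ideal (rng L.loc) ?I"
      then obtain n where v: "v \<in> L.loc" "v ^ n \<in> L.ext ?m" using sub by (auto simp: radical_ideal_def)
      from v(2) show "v \<in> L.ext ?m"
      proof (induction n)
        case 0
        then show ?case using pr by (simp add: L.loc.primeideal_iff)
      next
        case (Suc n)
        then show ?case using pr v(1) L.loc.power_mem[OF v(1)] by (auto simp: L.loc.primeideal_iff)
      qed
    next
      fix v assume "v \<in> L.ext ?m"
      then obtain a s where v: "a \<in> ?m" "s \<in> L.M" "v = frac_of a / frac_of s" by (elim L.extE)
      from v(1) have "frac_of a \<in> radical_ideal (rng L.loc) ?I"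
      proof (induction rule: supported_induct)
        case zero
        then show ?case using R by (simp add: L.loc.ideal_iff)
      next
        case (add_mon u c q)
        have "frac_of (tmon 0 c) \<in> L.loc" by (intro L.frac_of_ext supported_mon zero_S)
        then have "frac_of (tmon 0 c) * frac_of (tmon u 1) \<in> radical_ideal (rng L.loc) ?I"
          using R mem_rad[of u] add_mon(1) unfolding L.loc.ideal_iff by blast
        then have "frac_of (tmon 0 c) * frac_of (tmon u 1) + frac_of q \<in> radical_ideal (rng L.loc) ?I"
          using R add_mon(3) unfolding L.loc.ideal_iff by blast
        moreover have "frac_of (tmon u c + q) = frac_of (tmon 0 c) * frac_of (tmon u 1) + frac_of q"
          by (simp add: tmon_mult flip: frac_of_simps(3))
        ultimately show ?case by (simp only:)
      qed
      then have "1 / frac_of s * frac_of a \<in> radical_ideal (rng L.loc) ?I"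
        using R L.inverse_M_loc[OF v(2)] unfolding L.loc.ideal_iff by blast
      then show "v \<in> radical_ideal (rng L.loc) ?I" by (simp add: v(3))
    qed
    then show ?thesis
      unfolding system_of_parameters_def using xy dim by (simp add: numeral_eq_enat)
  qed
  have weak: "weak_sequence (rng L.loc) (L.ext ?m) [x, y]"
    using assms(1)[unfolded buchsbaum_S_iff, rule_format, OF origin_maximal sop] .
  have colon: "colon_ideal (rng L.loc) (Idl\<^bsub>rng L.loc\<^esub> {x}) {y} =
      colon_ideal (rng L.loc) (Idl\<^bsub>rng L.loc\<^esub> {x}) (L.ext ?m)"
    using weak[unfolded weak_sequence_def, rule_format, of 1] by simp
  define z where "z = frac_of (tmon (\<alpha> + h1) 1 :: 'k poly poly)"
  define w where "w = frac_of (tmon (\<alpha> + h2) 1 :: 'k poly poly)"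
  have zw: "z \<in> L.loc" "w \<in> L.loc"
    unfolding z_def w_def using \<alpha> by (auto intro!: L.frac_of_ext supported_mon simp: h1_def h2_def)
  have "z * y = w * x"
    unfolding z_def w_def x_def y_def by (simp add: tmon_mult ac_simps flip: frac_of_simps(3))
  then have "z \<in> colon_ideal (rng L.loc) (Idl\<^bsub>rng L.loc\<^esub> {x}) {y}"
    unfolding colon_ideal_def L.loc.genideal_single[OF xy(1)] using zw by auto
  moreover have "frac_of (tmon e 1 :: 'k poly poly) \<in> L.ext ?m" by (intro L.frac_of_ext tm e)
  ultimately have "z * frac_of (tmon e 1) \<in> Idl\<^bsub>rng L.loc\<^esub> {x}"
    unfolding colon by (simp add: colon_ideal_def)
  then obtain v where v: "v \<in> L.loc" "z * frac_of (tmon e 1) = v * x"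
    unfolding L.loc.genideal_single[OF xy(1)] by blast
  then obtain a s where a: "a \<in> ?B" "s \<in> L.M" "s \<noteq> 0" "v = frac_of a / frac_of s" by (elim L.extE)
  have "frac_of (s * (tmon (\<alpha> + h1) 1 * tmon e 1)) = frac_of (a * tmon h1 1)"
    using v(2) a(3) unfolding a(4) z_def x_def by (simp add: field_simps)
  then have "s * (tmon (\<alpha> + h1) 1 * tmon e 1) = a * tmon h1 1" by (simp only: frac_of_simps(6))
  then have "tmon h1 1 * (tmon (\<alpha> + e) 1 * s) = tmon h1 1 * a"
    by (simp add: tmon_mult ac_simps flip: mult.assoc)
  then have "tmon (\<alpha> + e) 1 * s = a" by simp
  \<comment> \<open>s lies outside m and so has a constant term, which makes \<alpha> + e an
    exponent of a.\<close>
  moreover have "cf s 0 \<noteq> 0"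
  proof
    assume "cf s 0 = 0"
    then have "s \<in> ?m" using a(2) unfolding mem_supported by (metis DiffD1 DiffI mem_supported singletonD)
    then show False using a(2) by simp
  qed
  then have "cf (tmon (\<alpha> + e) 1 * s) (\<alpha> + e + 0) \<noteq> 0" unfolding cf_mon_mult by simp
  ultimately show "\<alpha> + e \<in> S" using supportedD[OF a(1)] by simp
qed

end

section \<open>Multiples of a disk\<close>

lemma pt_simps [simp]:
  "pt (x + y) = pt x + pt y" "pt (smul n x) = real n *\<^sub>R pt x" "pt 0 = 0"
  by (simp_all add: pt_def zero_prod_def)

lemma pt_eq_iff: "pt x = pt y \<longleftrightarrow> x = y"
  by (simp add: pt_def prod_eq_iff)

section \<open>Cyclic monoids on a ray\<close>

lemma submonoid_gen_single: "submonoid_gen {g} = range (\<lambda>n. smul n g)"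
proof (intro equalityI subsetI)
  fix x assume "x \<in> submonoid_gen {g}"
  then show "x \<in> range (\<lambda>n. smul n g)"
  proof induction
    case zero
    then show ?case by (intro rev_image_eqI[of 0]) simp_all
  next
    case (add y x)
    then obtain n where "x = smul n g" "y = g" by blast
    then show ?case using smul_add[of 1 n g] by (intro rev_image_eqI[of "Suc n"]) simp_all
  qed
next
  fix x assume "x \<in> range (\<lambda>n. smul n g)"
  then obtain n where "x = smul n g" by blast
  moreover have "smul n g \<in> submonoid_gen {g}"
  proof (induction n)
    case (Suc n)
    then show ?case using submonoid_gen.add[of g "{g}" "smul n g"] smul_add[of 1 n g] by simp
  qed (simp add: submonoid_gen.zero)
  ultimately show "x \<in> submonoid_gen {g}" by simp
qed

text \<open>If the subtracted multiple of g is the larger one, then x plus the excess is 0, and in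
  \<nat>^2 this forces x = 0.\<close>

lemma smul_range_diff:
  assumes "x + y = z" "y \<in> range (\<lambda>n. smul n g)" "z \<in> range (\<lambda>n. smul n g)"
  shows "x \<in> range (\<lambda>n. smul n g)"
proof -
  obtain l k where lk: "y = smul l g" "z = smul k g" using assms by blast
  show ?thesis
  proof (cases "l \<le> k")
    case True
    then have "x + smul l g = smul (k - l) g + smul l g"
      using assms(1) lk smul_add[of "k - l" l g] by simp
    then show ?thesis by simp
  next
    case False
    then have "(x + smul (l - k) g) + smul k g = smul k g"
      using assms(1) lk smul_add[of "l - k" k g] by (simp add: add.assoc)
    then have "x = 0" by (simp add: prod_eq_iff)
    then show ?thesis by (intro rev_image_eqI[of 0]) simp_all
  qed
qed

text \<open>Subtractive Euclid: let g have the least coordinate sum among the nonzero elements.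
  Every other one is parallel to g and at least as long, so g can be subtracted within E until 0 is
  reached.\<close>

lemma ray_monoid_singly_generated:
  assumes zero: "0 \<in> E" and add: "\<And>x y. x \<in> E \<Longrightarrow> y \<in> E \<Longrightarrow> x + y \<in> E"
    and diff: "\<And>x y. x + y \<in> E \<Longrightarrow> y \<in> E \<Longrightarrow> x \<in> E"
    and ray: "\<And>x y. x \<in> E \<Longrightarrow> y \<in> E \<Longrightarrow> pdet x y = 0"
  shows "\<exists>g. E = submonoid_gen {g}"
proof (cases "E = {0}")
  case True
  \<comment> \<open>The trivial monoid counts as generated by 0.\<close>
  then show ?thesis by (intro exI[of _ 0]) (simp add: submonoid_gen_single)
next
  case False
  then obtain y where "y \<in> E \<and> y \<noteq> 0" using zero by blast
  then obtain g where g: "g \<in> E" "g \<noteq> 0"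
    and min: "\<And>x. x \<in> E \<Longrightarrow> x \<noteq> 0 \<Longrightarrow> fst g + snd g \<le> fst x + snd x"
    using ex_has_least_nat[of "\<lambda>x. x \<in> E \<and> x \<noteq> 0" y "\<lambda>x. fst x + snd x"] by blast
  have "smul n g \<in> E" for n
  proof (induction n)
    case (Suc n)
    then show ?case using add[OF g(1)] smul_add[of 1 n g] by simp
  qed (simp add: zero)
  moreover have "x \<in> range (\<lambda>n. smul n g)" if "x \<in> E" for x
    using that
  proof (induction "fst x + snd x" arbitrary: x rule: less_induct)
    case (less x)
    show ?case
    proof (cases "x = 0")
      case True
      then show ?thesis by (intro rev_image_eqI[of 0]) simp_all
    next
      case False
      have "fst x * snd g = snd x * fst g"
      proof -
        have "int (fst x * snd g) = int (snd x * fst g)"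
          using ray[OF less.prems g(1)] by (simp add: pdet_def)
        then show ?thesis by (simp only: of_nat_eq_iff)
      qed
      moreover have s: "fst g + snd g \<le> fst x + snd x" by (rule min[OF less.prems False])
      \<comment> \<open>Parallel vectors are comparable coordinatewise, so comparing the sums
        decides both inequalities.\<close>
      ultimately have le: "fst g \<le> fst x" "snd g \<le> snd x"
      proof -
        assume eq: "fst x * snd g = snd x * fst g"
        show "fst g \<le> fst x"
        proof (rule ccontr)
          assume "\<not> fst g \<le> fst x"
          then have *: "fst x < fst g" "snd g < snd x" using s by linarith+
          then have "snd x * fst x < snd x * fst g" "fst x * snd g \<le> fst x * snd x" by simp_all
          then show False using eq by (simp add: mult.commute)
        qed
        show "snd g \<le> snd x"
        proof (rule ccontr)
          assume "\<not> snd g \<le> snd x"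
          then have *: "snd x < snd g" "fst g < fst x" using s by linarith+
          then have "fst x * snd x < fst x * snd g" "snd x * fst g \<le> snd x * fst x" by simp_all
          then show False using eq by (simp add: mult.commute)
        qed
      qed
      define z where "z = (fst x - fst g, snd x - snd g)"
      have x: "x = z + g" using le by (simp add: z_def prod_eq_iff)
      then have "z \<in> E" using diff less.prems g(1) by blast
      moreover have "fst z + snd z < fst x + snd x"
        using g(2) x by (auto simp: prod_eq_iff)
      ultimately obtain n where "z = smul n g" using less.hyps by blast
      then show ?thesis using x smul_add[of n 1 g] by (intro rev_image_eqI[of "Suc n"]) simp_all
    qed
  qed
  ultimately show ?thesis by (intro exI[of _ g]) (auto simp: submonoid_gen_single)
qed

lemma parallel_scaled:
  assumes "pdet h x = 0" "h \<noteq> 0"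
  obtains k l where "k > 0" "smul k x = smul l h"
proof -
  have eq: "fst h * snd x = snd h * fst x"
  proof -
    have "int (fst h * snd x) = int (snd h * fst x)" using assms(1) by (simp add: pdet_def)
    then show ?thesis by (simp only: of_nat_eq_iff)
  qed
  show ?thesis
  proof (cases "fst h > 0")
    case True
    moreover have "smul (fst h) x = smul (fst x) h" using eq by (simp add: prod_eq_iff mult.commute)
    ultimately show ?thesis using that by blast
  next
    case False
    then have "snd h > 0" using assms(2) by (auto simp: prod_eq_iff)
    moreover have "smul (snd h) x = smul (snd x) h" using eq by (simp add: prod_eq_iff mult.commute)
    ultimately show ?thesis using that by blast
  qed
qed

section \<open>Lattice points in multiples of the disk\<close>

locale disk =
  fixes a b r :: real
  assumes r_pos: "r > 0"
begin

abbreviation S where "S \<equiv> disk_semigroup a b r"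
definition c where "c = (a, b)"

lemma mem_S: "x \<in> S \<longleftrightarrow> (\<exists>i::nat. norm (pt x - real i *\<^sub>R c) \<le> real i * r)"
  by (simp add: disk_semigroup_def c_def dist_norm norm_minus_commute)

lemma zero_mem_S: "0 \<in> S"
  unfolding mem_S by (intro exI[of _ 0]) simp

lemma add_mem_S: assumes "x \<in> S" "y \<in> S" shows "x + y \<in> S"
proof -
  obtain i j :: nat where "norm (pt x - real i *\<^sub>R c) \<le> real i * r" "norm (pt y - real j *\<^sub>R c) \<le> real j * r"
    using assms unfolding mem_S by blast
  moreover have eq: "pt (x + y) - real (i + j) *\<^sub>R c = (pt x - real i *\<^sub>R c) + (pt y - real j *\<^sub>R c)"
    by (simp add: scaleR_add_left)
  ultimately have "norm (pt (x + y) - real (i + j) *\<^sub>R c) \<le> real (i + j) * r"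
    using norm_triangle_ineq[of "pt x - real i *\<^sub>R c" "pt y - real j *\<^sub>R c"]
    unfolding eq by (simp add: distrib_right)
  then show ?thesis unfolding mem_S by blast
qed

text \<open>If x is the sum of q_i f_i and the q_i add up to n/d, then d x lies in n C by convexity.
  Conversely, d x in i C with i > 0 says that (d/i) x is a point of C in the quadrant.\<close>

lemma mem_cone: "x \<in> disk_cone a b r \<longleftrightarrow> (\<exists>d>0. smul d x \<in> S)"
proof
  assume "x \<in> disk_cone a b r"
  then obtain p :: nat and q f where pq: "pt x = (\<Sum>i<p. q i *\<^sub>R f i)"
    "\<forall>i<p. q i \<in> \<rat> \<and> 0 \<le> q i \<and> f i \<in> cball c r \<inter> {0..} \<times> {0..}"
    unfolding disk_cone_def rat_cone_def c_def by blast
  have "(\<Sum>i<p. q i) \<in> \<rat>" "0 \<le> (\<Sum>i<p. q i)" using pq(2) by (auto intro: sum_nonneg)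
  then obtain n d :: nat where nd: "d \<noteq> 0" "(\<Sum>i<p. q i) = real n / real d"
    by (metis Rats_abs_nat_div_natE abs_of_nonneg)
  have n: "real n = real d * (\<Sum>i<p. q i)" using nd by simp
  have "pt (smul d x) - real n *\<^sub>R c = (\<Sum>i<p. (real d * q i) *\<^sub>R (f i - c))"
    by (simp add: pq(1) n scaleR_right.sum sum_distrib_left scaleR_left.sum scaleR_right_diff_distrib
        sum_subtractf)
  also have "norm \<dots> \<le> (\<Sum>i<p. (real d * q i) * r)"
  proof (rule sum_norm_le)
    fix i assume "i \<in> {..<p}"
    then have "norm (f i - c) \<le> r" "0 \<le> real d * q i"
      using pq(2) by (auto simp: dist_norm norm_minus_commute)
    then show "norm ((real d * q i) *\<^sub>R (f i - c)) \<le> (real d * q i) * r"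
      unfolding norm_scaleR by (simp add: mult_left_mono)
  qed
  also have "\<dots> = real n * r" by (simp add: n sum_distrib_left sum_distrib_right)
  finally have "smul d x \<in> S" unfolding mem_S by blast
  then show "\<exists>d>0. smul d x \<in> S" using nd(1) by blast
next
  assume "\<exists>d>0. smul d x \<in> S"
  then obtain d i :: nat where d: "d > 0" and i: "norm (real d *\<^sub>R pt x - real i *\<^sub>R c) \<le> real i * r"
    unfolding mem_S pt_simps by blast
  show "x \<in> disk_cone a b r"
  proof (cases "i = 0")
    case True
    \<comment> \<open>The multiple with i = 0 is a single point and forces x = 0, the value of the
      empty combination.\<close>
    then have "norm (real d *\<^sub>R pt x) \<le> 0" using i by simp
    then have "real d *\<^sub>R pt x = 0" by (simp only: norm_le_zero_iff)
    then have "pt x = 0" using d by simp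
    then show ?thesis unfolding disk_cone_def rat_cone_def by (auto intro!: exI[of _ "0::nat"])
  next
    case False
    define f where "f = (real d / real i) *\<^sub>R pt x"
    have "real i * norm (f - c) = norm (real i *\<^sub>R (f - c))" by simp
    also have "real i *\<^sub>R (f - c) = real d *\<^sub>R pt x - real i *\<^sub>R c"
      using False by (simp add: f_def scaleR_right_diff_distrib)
    finally have "real i * norm (f - c) \<le> real i * r" using i by simp
    then have "norm (f - c) \<le> r" using False by simp
    moreover have "0 \<le> fst f" "0 \<le> snd f" by (simp_all add: f_def pt_def)
    ultimately have f: "f \<in> cball c r \<inter> {0..} \<times> {0..}"
      by (cases f) (simp add: dist_norm norm_minus_commute)
    have "pt x = (\<Sum>k<(1::nat). (real i / real d) *\<^sub>R f)" using d False by (simp add: f_def)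
    then show ?thesis unfolding disk_cone_def rat_cone_def
      using f unfolding c_def by (intro CollectI exI[of _ 1] exI[of _ "\<lambda>_. real i / real d"] exI[of _ "\<lambda>_. f"]) auto
  qed
qed

text \<open>If the ray of \<open>h\<close> is tangent to the disk, then a multiple of the disk lies on one side of the
  tangent line and meets it only in the point of tangency, by the equality case of the
  Cauchy--Schwarz inequality.\<close>

lemma tangent:
  fixes i0 i :: nat and y :: "real \<times> real" and h :: "nat \<times> nat"
  defines "u \<equiv> pt h - real i0 *\<^sub>R c"
  assumes h: "norm u = real i0 * r" "u \<bullet> pt h = 0" "i0 > 0"
    and y: "norm (y - real i *\<^sub>R c) \<le> real i * r"
  shows "u \<bullet> y \<le> 0" "u \<bullet> y = 0 \<Longrightarrow> real i0 *\<^sub>R y = real i *\<^sub>R pt h"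
proof -
  define v where "v = y - real i *\<^sub>R c"
  have hu: "pt h = u + real i0 *\<^sub>R c" by (simp add: u_def)
  have uu: "u \<bullet> u = (real i0 * r)\<^sup>2" using h(1) by (simp add: power2_norm_eq_inner[symmetric])
  have "real i0 * (u \<bullet> c) = - (real i0 * r)\<^sup>2"
    using h(2) uu unfolding hu by (simp add: inner_add_right)
  then have "real i0 * (u \<bullet> c) = real i0 * (- real i0 * r\<^sup>2)" by (simp add: power2_eq_square)
  then have uc: "u \<bullet> c = - real i0 * r\<^sup>2" using h(3) by (simp only: mult_left_cancel of_nat_0_eq_iff)
  have uy: "u \<bullet> y = u \<bullet> v - real i * real i0 * r\<^sup>2"
    using uc by (simp add: v_def inner_diff_right)
  have "u \<bullet> v \<le> norm u * norm v" by (rule norm_cauchy_schwarz)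
  also have "\<dots> \<le> (real i0 * r) * (real i * r)"
    using y r_pos unfolding h(1) v_def by (intro mult_left_mono) auto
  finally show "u \<bullet> y \<le> 0" unfolding uy by (simp add: power2_eq_square mult_ac)
  assume "u \<bullet> y = 0"
  then have uv: "u \<bullet> v = real i * real i0 * r\<^sup>2" using uy by simp
  have vv: "v \<bullet> v \<le> (real i * r)\<^sup>2"
    unfolding power2_norm_eq_inner[symmetric] v_def using y by (intro power_mono) auto
  have "(real i0 *\<^sub>R v - real i *\<^sub>R u) \<bullet> (real i0 *\<^sub>R v - real i *\<^sub>R u) =
    (real i0)\<^sup>2 * (v \<bullet> v) - 2 * real i0 * real i * (u \<bullet> v) + (real i)\<^sup>2 * (u \<bullet> u)"
    by (simp add: inner_diff_left inner_diff_right inner_commute[of v u] power2_eq_square algebra_simps)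
  also have "\<dots> \<le> (real i0)\<^sup>2 * (real i * r)\<^sup>2 - 2 * real i0 * real i * (u \<bullet> v) + (real i)\<^sup>2 * (u \<bullet> u)"
    using vv by (simp add: mult_left_mono)
  also have "\<dots> = 0" unfolding uv uu by (simp add: power2_eq_square)
  finally have "real i0 *\<^sub>R v = real i *\<^sub>R u" by (simp add: inner_gt_zero_iff not_less[symmetric])
  then show "real i0 *\<^sub>R y = real i *\<^sub>R pt h"
    unfolding v_def hu by (simp add: algebra_simps)
qed

text \<open>Here h = i0 c + u. If |u| < i0 r, the slack N (i0 r - |u|) eventually exceeds |x|. If h
  lies on the boundary circle of i0 C, the disk with factor i = N i0 + m is used: in |x + N h - i
  c|^2 <= (i r)^2 the quadratic terms in N cancel and the linear one decides.\<close>

lemma eventually_in_S: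
  fixes i0 :: nat and h :: "nat \<times> nat"
  defines "u \<equiv> pt h - real i0 *\<^sub>R c"
  assumes h: "norm u \<le> real i0 * r" "i0 > 0"
    and x: "smul d x \<in> S" "d > 0"
    and nt: "norm u = real i0 * r \<Longrightarrow> u \<bullet> pt h = 0 \<Longrightarrow> pdet h x \<noteq> 0"
  shows "\<exists>N0. \<forall>N\<ge>N0. x + smul N h \<in> S"
proof (cases "norm u < real i0 * r")
  case True
  obtain N0 :: nat where N0: "norm (pt x) / (real i0 * r - norm u) \<le> real N0"
    using real_arch_simple by blast
  have "x + smul N h \<in> S" if "N \<ge> N0" for N
  proof -
    have "norm (pt x) / (real i0 * r - norm u) \<le> real N" using N0 that by linarith
    then have "norm (pt x) \<le> real N * (real i0 * r - norm u)"
      using True by (simp add: divide_le_eq)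
    moreover have "pt (x + smul N h) - real (N * i0) *\<^sub>R c = pt x + real N *\<^sub>R u"
      by (simp add: u_def algebra_simps)
    then have "norm (pt (x + smul N h) - real (N * i0) *\<^sub>R c) \<le> norm (pt x) + real N * norm u"
      using norm_triangle_ineq[of "pt x" "real N *\<^sub>R u"] by (simp only: norm_scaleR abs_of_nat)
    ultimately have "norm (pt (x + smul N h) - real (N * i0) *\<^sub>R c) \<le> real (N * i0) * r"
      by (simp add: algebra_simps)
    then show ?thesis unfolding mem_S by blast
  qed
  then show ?thesis by blast
next
  case False
  then have nu: "norm u = real i0 * r" using h(1) by simp
  have hu: "pt h = u + real i0 *\<^sub>R c" by (simp add: u_def)
  have uu: "u \<bullet> u = (real i0 * r)\<^sup>2" using nu by (simp add: power2_norm_eq_inner[symmetric])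
  \<comment> \<open>This inequality gives the linear term the right sign. If u is not orthogonal to
    h, some m satisfies it. On a tangent ray m = 0 does, because x is off the ray and hence strictly
    on the inner side of the tangent line.\<close>
  have "\<exists>m::int. real i0 * (u \<bullet> pt x) < real_of_int m * (u \<bullet> pt h)"
  proof -
    consider "u \<bullet> pt h > 0" | "u \<bullet> pt h < 0" | "u \<bullet> pt h = 0" by linarith
    then show ?thesis
    proof cases
      case 1
      obtain m :: int where "real i0 * (u \<bullet> pt x) / (u \<bullet> pt h) < real_of_int m" using ex_less_of_int by blast
      then show ?thesis using 1 by (intro exI[of _ m]) (simp add: pos_divide_less_eq)
    next
      case 2
      obtain m :: int where "real_of_int m < real i0 * (u \<bullet> pt x) / (u \<bullet> pt h)" using ex_of_int_less by blast
      then show ?thesis using 2 by (intro exI[of _ m]) (simp add: neg_less_divide_eq)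
    next
      case 3
      obtain i :: nat where i: "norm (pt (smul d x) - real i *\<^sub>R c) \<le> real i * r" using x(1) unfolding mem_S by blast
      note t = tangent[where h = h and ?i0.0 = i0, folded u_def, OF nu 3 h(2) i]
      have "u \<bullet> pt (smul d x) \<noteq> 0"
      proof
        assume "u \<bullet> pt (smul d x) = 0"
        from t(2)[OF this] have "pt (smul i0 (smul d x)) = pt (smul i h)" by simp
        then have "smul i0 (smul d x) = smul i h" by (simp only: pt_eq_iff)
        then have "pdet h (smul i0 (smul d x)) = 0" by simp
        then show False using nt[OF nu 3] h(2) x(2) by simp
      qed
      then have "u \<bullet> pt (smul d x) < 0" using t(1) by linarith
      then have "real d * (u \<bullet> pt x) < 0" by simp
      then have "u \<bullet> pt x < 0" by (simp add: mult_less_0_iff)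
      then show ?thesis using 3 h(2) by (intro exI[of _ 0]) (simp add: mult_less_0_iff)
    qed
  qed
  then obtain m :: int where m: "real i0 * (u \<bullet> pt x) < real_of_int m * (u \<bullet> pt h)" by blast
  define y where "y = pt x - real_of_int m *\<^sub>R c"
  \<comment> \<open>Half the coefficient of N in (i r)^2 - |y + N u|^2.\<close>
  define \<delta> where "\<delta> = real i0 * real_of_int m * r\<^sup>2 - u \<bullet> y"
  have "real i0 * \<delta> = real_of_int m * (u \<bullet> pt h) - real i0 * (u \<bullet> pt x)"
    unfolding \<delta>_def y_def hu using uu
    by (simp add: inner_diff_right inner_add_right algebra_simps power2_eq_square)
  then have "0 < real i0 * \<delta>" using m by linarith
  then have \<delta>: "\<delta> > 0" by (simp add: zero_less_mult_iff)
  obtain N0 :: nat where N0: "(y \<bullet> y - (real_of_int m * r)\<^sup>2) / (2 * \<delta>) \<le> real N0"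
    using real_arch_simple by blast
  \<comment> \<open>The summand |m| keeps N i0 + m nonnegative, so that it is the factor of an
    actual C_i.\<close>
  have "x + smul N h \<in> S" if "N \<ge> N0 + nat \<bar>m\<bar>" for N
  proof -
    have "(y \<bullet> y - (real_of_int m * r)\<^sup>2) / (2 * \<delta>) \<le> real N" using N0 that by linarith
    then have 1: "y \<bullet> y - (real_of_int m * r)\<^sup>2 \<le> real N * (2 * \<delta>)"
      using \<delta> by (simp add: divide_le_eq)
    have "N \<le> N * i0" using h(2) by simp
    then have "int N \<le> int (N * i0)" by (simp only: of_nat_le_iff)
    then have pos: "0 \<le> int (N * i0) + m" using that by linarith
    define i where "i = nat (int (N * i0) + m)"
    have i: "real i = real N * real i0 + real_of_int m"
    proof -
      have "int i = int (N * i0) + m" unfolding i_def by (rule int_nat_eq[THEN trans]) (simp only: pos if_True)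
      then have "real_of_int (int i) = real_of_int (int (N * i0) + m)" by (simp only:)
      then show ?thesis by simp
    qed
    have "pt (x + smul N h) - real i *\<^sub>R c = y + real N *\<^sub>R u"
      unfolding i y_def u_def by (simp add: algebra_simps)
    then have "(norm (pt (x + smul N h) - real i *\<^sub>R c))\<^sup>2 =
        y \<bullet> y + 2 * real N * (u \<bullet> y) + (real N)\<^sup>2 * (u \<bullet> u)"
      unfolding power2_norm_eq_inner
      by (simp add: inner_add_left inner_add_right inner_commute[of y u] power2_eq_square distrib_left)
    also have "\<dots> \<le> (real i * r)\<^sup>2"
      using 1 unfolding i uu \<delta>_def by (simp add: power2_eq_square algebra_simps)
    finally have "norm (pt (x + smul N h) - real i *\<^sub>R c) \<le> real i * r"
      using r_pos by (simp add: power2_le_iff_abs_le)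
    then show ?thesis unfolding mem_S by blast
  qed
  then show ?thesis by blast
qed

end

section \<open>Semigroups of a disk\<close>

lemma submonoid_gen_minus_zero: "submonoid_gen (G - {0}) = submonoid_gen G"
proof (intro equalityI subsetI)
  fix x assume "x \<in> submonoid_gen (G - {0})"
  then show "x \<in> submonoid_gen G" by induction (auto intro: submonoid_gen.intros)
next
  fix x assume "x \<in> submonoid_gen G"
  then show "x \<in> submonoid_gen (G - {0})"
  proof induction
    case (add g x)
    then show ?case by (cases "g = 0") (auto intro: submonoid_gen.add)
  qed (rule submonoid_gen.zero)
qed

lemma generators_mem: "g \<in> G \<Longrightarrow> g \<in> submonoid_gen G"
  using submonoid_gen.add[OF _ submonoid_gen.zero, of g G] by simp

text \<open>A nonzero element of S has a generator as first summand, so generators suffice for the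
  test. Minimality keeps 0 out of G; a generator 0 would demand x in S.\<close>

lemma semigroup_bar_eq:
  assumes "minimal_generators G S" "\<And>x y. x \<in> S \<Longrightarrow> y \<in> S \<Longrightarrow> x + y \<in> S"
  shows "semigroup_bar G S = {x. \<forall>e\<in>S - {0}. x + e \<in> S}"
proof (intro equalityI subsetI CollectI ballI)
  have G: "submonoid_gen G = S" and "\<And>H. H \<subset> G \<Longrightarrow> submonoid_gen H \<noteq> S"
    using assms(1) by (auto simp: minimal_generators_def)
  then have "0 \<notin> G" using submonoid_gen_minus_zero[of G] by blast
  {
    fix x e assume x: "x \<in> semigroup_bar G S" and e: "e \<in> S - {0}"
    then have "e \<in> submonoid_gen G" using G by simp
    then show "x + e \<in> S"
    proof cases
      case zero
      then show ?thesis using e by simp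
    next
      case (add g y)
      then have "x + g \<in> S" "y \<in> S" using x G by (simp_all add: semigroup_bar_def)
      then have "(x + g) + y \<in> S" by (rule assms(2))
      then show ?thesis using add by (simp add: add.assoc)
    qed
  next
    fix x assume "x \<in> {x. \<forall>e\<in>S - {0}. x + e \<in> S}"
    then show "x \<in> semigroup_bar G S"
      using generators_mem[of _ G] \<open>0 \<notin> G\<close> unfolding G semigroup_bar_def by auto
  }
qed

section \<open>The real cone and its extremal rays\<close>

definition rdet :: "real \<times> real \<Rightarrow> real \<times> real \<Rightarrow> real" where
  "rdet u v = fst u * snd v - snd u * fst v"

lemma rdet_pt: "rdet (pt x) (pt y) = of_int (pdet x y)"
  by (simp add: rdet_def pt_def pdet_def)

lemma rdet_simps [simp]:
  "rdet (u + v) w = rdet u w + rdet v w" "rdet w (u + v) = rdet w u + rdet w v"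
  "rdet (t *\<^sub>R u) v = t * rdet u v" "rdet u (t *\<^sub>R v) = t * rdet u v" "rdet u u = 0"
  "rdet 0 u = 0" "rdet u 0 = 0"
  by (simp_all add: rdet_def algebra_simps)

lemma rdet_sum: "rdet (sum f A) v = (\<Sum>i\<in>A. rdet (f i) v)" "rdet v (sum f A) = (\<Sum>i\<in>A. rdet v (f i))"
  by (induction A rule: infinite_finite_induct) simp_all

lemma rdet_cramer:
  "rdet u w *\<^sub>R v = rdet v w *\<^sub>R u + rdet u v *\<^sub>R w"
  by (simp add: rdet_def prod_eq_iff algebra_simps)

lemma independent_rdet:
  assumes "independent {u, v}" "u \<noteq> v" shows "rdet u v \<noteq> 0"
proof
  assume 0: "rdet u v = 0"
  have "v \<noteq> 0" using assms(1) dependent_zero[of "{u, v}"] by auto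
  then consider "fst v \<noteq> 0" | "snd v \<noteq> 0" by (auto simp: prod_eq_iff)
  then have "\<exists>k. u = k *\<^sub>R v"
  proof cases
    case 1
    then show ?thesis using 0 by (intro exI[of _ "fst u / fst v"]) (simp add: prod_eq_iff rdet_def field_simps)
  next
    case 2
    then show ?thesis using 0 by (intro exI[of _ "snd u / snd v"]) (simp add: prod_eq_iff rdet_def field_simps)
  qed
  then have "u \<in> span {v}" by (auto simp: span_singleton)
  then show False using assms by (simp add: independent_insert)
qed

definition ray :: "real \<times> real \<Rightarrow> (real \<times> real) set" where
  "ray v = {t *\<^sub>R v | t. 0 \<le> t}"

text \<open>Exchanging s1 and s2 makes the determinant positive, which makes s2 the steeper of the
  two. The rays are later compared as an unordered pair.\<close>

locale simplicial_disk = disk +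
  fixes s1 s2 :: "nat \<times> nat"
  assumes s1_mem: "s1 \<in> S" and s2_mem: "s2 \<in> S"
    and orientation: "0 < pdet s1 s2"
    and cone_eq: "rat_cone (pt ` S) = rat_cone {pt s1, pt s2}"
begin

abbreviation "dcone \<equiv> disk_cone a b r"

sublocale plane_semigroup S s1 s2
proof
  show "0 \<in> S" "s1 \<in> S" "s2 \<in> S" "0 < pdet s1 s2"
    by (simp_all add: zero_mem_S s1_mem s2_mem orientation)
  show "x \<in> S \<Longrightarrow> y \<in> S \<Longrightarrow> x + y \<in> S" for x y by (rule add_mem_S)
  fix x assume "x \<in> S"
  then have "pt x \<in> rat_cone (pt ` S)"
    unfolding rat_cone_def
    by (intro CollectI exI[of _ "1::nat"] exI[of _ "\<lambda>_. 1"] exI[of _ "\<lambda>_. pt x"]) auto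
  then have "pt x \<in> rat_cone {pt s1, pt s2}" by (simp only: cone_eq)
  then obtain p :: nat and q f where pq: "pt x = (\<Sum>i<p. q i *\<^sub>R f i)"
    "\<forall>i<p. q i \<in> \<rat> \<and> 0 \<le> q i \<and> f i \<in> {pt s1, pt s2}"
    unfolding rat_cone_def by blast
  have "0 \<le> rdet (f i) (pt s2)" "0 \<le> rdet (pt s1) (f i)" if "i < p" for i
    using pq(2) that orientation by (auto simp: rdet_pt)
  then have "0 \<le> rdet (pt x) (pt s2)" "0 \<le> rdet (pt s1) (pt x)"
    unfolding pq(1) rdet_sum rdet_simps using pq(2) by (auto intro!: sum_nonneg mult_nonneg_nonneg)
  then show "0 \<le> pdet x s2 \<and> 0 \<le> pdet s1 x" by (simp add: rdet_pt)
qed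

lemma S_subset_cone: "x \<in> S \<Longrightarrow> x \<in> dcone"
  unfolding mem_cone by (intro exI[of _ 1]) simp

text \<open>By \<open>cramer\<close>, D x is a natural combination of s1 and s2, hence in S. The
  cone is thus given by two integer inequalities.\<close>

lemma mem_cone_det: "x \<in> dcone \<longleftrightarrow> 0 \<le> pdet x s2 \<and> 0 \<le> pdet s1 x"
proof
  assume "x \<in> dcone"
  then obtain d where d: "d > 0" "smul d x \<in> S" unfolding mem_cone by blast
  then show "0 \<le> pdet x s2 \<and> 0 \<le> pdet s1 x"
    using S_cone[OF d(2)] by (simp add: zero_le_mult_iff)
next
  assume *: "0 \<le> pdet x s2 \<and> 0 \<le> pdet s1 x"
  have "smul D x \<in> S"
    unfolding cramer[OF conjunct1[OF *] conjunct2[OF *]] by (intro add_S smul_S s1_S s2_S)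
  moreover have "D > 0" using orientation by simp
  ultimately show "x \<in> dcone" unfolding mem_cone by blast
qed

lemma hull_cone: "convex_cone hull (pt ` dcone) = {v. 0 \<le> rdet v (pt s2) \<and> 0 \<le> rdet (pt s1) v}"
proof
  have "convex_cone {v. 0 \<le> rdet v (pt s2) \<and> 0 \<le> rdet (pt s1) v}"
    unfolding convex_cone_iff by auto
  then show "convex_cone hull (pt ` dcone) \<subseteq> {v. 0 \<le> rdet v (pt s2) \<and> 0 \<le> rdet (pt s1) v}"
    by (intro hull_minimal) (auto simp: mem_cone_det rdet_pt)
  show "{v. 0 \<le> rdet v (pt s2) \<and> 0 \<le> rdet (pt s1) v} \<subseteq> convex_cone hull (pt ` dcone)"
  proof
    fix v assume v: "v \<in> {v. 0 \<le> rdet v (pt s2) \<and> 0 \<le> rdet (pt s1) v}"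
    let ?d = "rdet (pt s1) (pt s2)"
    have d: "?d > 0" using orientation by (simp add: rdet_pt)
    have "v = (1 / ?d) *\<^sub>R (?d *\<^sub>R v)" using d by simp
    also have "\<dots> = (rdet v (pt s2) / ?d) *\<^sub>R pt s1 + (rdet (pt s1) v / ?d) *\<^sub>R pt s2"
      unfolding rdet_cramer[of "pt s1" "pt s2" v] by (simp add: scaleR_add_right)
    also have "\<dots> \<in> convex_cone hull (pt ` dcone)"
      using v d s1_mem s2_mem
      by (intro convex_cone_hull_add convex_cone_hull_mul hull_inc imageI S_subset_cone) auto
    finally show "v \<in> convex_cone hull (pt ` dcone)" .
  qed
qed

text \<open>If both coordinates \<alpha>, \<beta> of v were positive, v would be the midpoint of
  2\<alpha> s1 and 2\<beta> s2, and the face property would put these independent vectors on one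
  ray.\<close>

lemma extremal_ray_cases:
  assumes "extremal_ray \<tau> (convex_cone hull (pt ` dcone))"
  shows "\<tau> = ray (pt s1) \<or> \<tau> = ray (pt s2)"
proof -
  let ?K = "convex_cone hull (pt ` dcone)" and ?d = "rdet (pt s1) (pt s2)"
  have d: "?d > 0" using orientation by (simp add: rdet_pt)
  obtain v where v: "v \<noteq> 0" "\<tau> = ray v" and face: "\<tau> face_of ?K"
    using assms unfolding extremal_ray_def ray_def by blast
  have "v \<in> \<tau>" unfolding v(2) ray_def by (auto intro!: exI[of _ 1])
  then have "v \<in> ?K" using face face_of_imp_subset by blast
  then have ab: "0 \<le> rdet v (pt s2)" "0 \<le> rdet (pt s1) v" unfolding hull_cone by auto
  define \<alpha> where "\<alpha> = rdet v (pt s2) / ?d"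
  define \<beta> where "\<beta> = rdet (pt s1) v / ?d"
  have "v = (1 / ?d) *\<^sub>R (?d *\<^sub>R v)" using d by simp
  also have "\<dots> = \<alpha> *\<^sub>R pt s1 + \<beta> *\<^sub>R pt s2"
    unfolding rdet_cramer[of "pt s1" "pt s2" v] \<alpha>_def \<beta>_def by (simp add: scaleR_add_right)
  finally have v_eq: "v = \<alpha> *\<^sub>R pt s1 + \<beta> *\<^sub>R pt s2" .
  have nonneg: "\<alpha> \<ge> 0" "\<beta> \<ge> 0" using ab d by (simp_all add: \<alpha>_def \<beta>_def)
  have ray_scale: "ray (t *\<^sub>R w) = ray w" if "t > 0" for t w
  proof (intro equalityI subsetI)
    fix x assume "x \<in> ray w"
    then obtain k where "x = k *\<^sub>R w" "0 \<le> k" by (auto simp: ray_def)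
    then show "x \<in> ray (t *\<^sub>R w)" using that
      unfolding ray_def by (intro CollectI exI[of _ "k / t"]) simp
  next
    fix x assume "x \<in> ray (t *\<^sub>R w)"
    then show "x \<in> ray w" using that unfolding ray_def by auto
  qed
  have "\<not> (\<alpha> > 0 \<and> \<beta> > 0)"
  proof
    assume pos: "\<alpha> > 0 \<and> \<beta> > 0"
    let ?p = "(2 * \<alpha>) *\<^sub>R pt s1" and ?q = "(2 * \<beta>) *\<^sub>R pt s2"
    have det: "rdet ?p ?q \<noteq> 0" using pos d by simp
    have ne: "?p \<noteq> ?q"
    proof
      assume eq: "?p = ?q"
      have "rdet ?p ?q = 0" unfolding eq by (rule rdet_simps(5))
      with det show False by contradiction
    qed
    have "?p \<in> ?K" "?q \<in> ?K" unfolding hull_cone using pos d by simp_all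
    moreover have "v \<in> open_segment ?p ?q"
      unfolding in_segment using ne
      by (intro conjI exI[of _ "1 / 2"]) (simp_all add: v_eq)
    ultimately have "?p \<in> \<tau>" "?q \<in> \<tau>"
      using face \<open>v \<in> \<tau>\<close> unfolding face_of_def by blast+
    then obtain k l where "?p = k *\<^sub>R v" "?q = l *\<^sub>R v" unfolding v(2) ray_def by blast
    then have "rdet ?p ?q = rdet (k *\<^sub>R v) (l *\<^sub>R v)" by (simp only:)
    then show False using det by simp
  qed
  then consider "\<alpha> > 0" "\<beta> = 0" | "\<beta> > 0" "\<alpha> = 0" using nonneg v(1) v_eq by fastforce
  then show ?thesis
    by cases (simp_all add: v(2) v_eq ray_scale)
qed

lemma pt_mem_ray:
  assumes "x \<in> dcone"
  shows "pt x \<in> ray (pt s1) \<longleftrightarrow> pdet s1 x = 0" "pt x \<in> ray (pt s2) \<longleftrightarrow> pdet x s2 = 0"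
proof -
  let ?d = "rdet (pt s1) (pt s2)"
  have d: "?d > 0" using orientation by (simp add: rdet_pt)
  have nn: "0 \<le> rdet (pt x) (pt s2)" "0 \<le> rdet (pt s1) (pt x)"
    using assms by (simp_all add: mem_cone_det rdet_pt)
  have cr: "?d *\<^sub>R pt x = rdet (pt x) (pt s2) *\<^sub>R pt s1 + rdet (pt s1) (pt x) *\<^sub>R pt s2"
    by (rule rdet_cramer)
  show "pt x \<in> ray (pt s1) \<longleftrightarrow> pdet s1 x = 0"
  proof
    assume "pt x \<in> ray (pt s1)"
    then have "rdet (pt s1) (pt x) = 0" by (auto simp: ray_def)
    then show "pdet s1 x = 0" by (simp add: rdet_pt)
  next
    assume "pdet s1 x = 0"
    then have "?d *\<^sub>R pt x = rdet (pt x) (pt s2) *\<^sub>R pt s1" using cr by (simp add: rdet_pt)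
    then have "(1 / ?d) *\<^sub>R (?d *\<^sub>R pt x) = (1 / ?d) *\<^sub>R (rdet (pt x) (pt s2) *\<^sub>R pt s1)" by (simp only:)
    then have "pt x = (rdet (pt x) (pt s2) / ?d) *\<^sub>R pt s1" using d by simp
    moreover have "0 \<le> rdet (pt x) (pt s2) / ?d" using nn d by simp
    ultimately show "pt x \<in> ray (pt s1)" unfolding ray_def by (intro CollectI exI conjI)
  qed
  show "pt x \<in> ray (pt s2) \<longleftrightarrow> pdet x s2 = 0"
  proof
    assume "pt x \<in> ray (pt s2)"
    then have "rdet (pt x) (pt s2) = 0" by (auto simp: ray_def)
    then show "pdet x s2 = 0" by (simp add: rdet_pt)
  next
    assume "pdet x s2 = 0"
    then have "?d *\<^sub>R pt x = rdet (pt s1) (pt x) *\<^sub>R pt s2" using cr by (simp add: rdet_pt)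
    then have "(1 / ?d) *\<^sub>R (?d *\<^sub>R pt x) = (1 / ?d) *\<^sub>R (rdet (pt s1) (pt x) *\<^sub>R pt s2)" by (simp only:)
    then have "pt x = (rdet (pt s1) (pt x) / ?d) *\<^sub>R pt s2" using d by simp
    moreover have "0 \<le> rdet (pt s1) (pt x) / ?d" using nn d by simp
    ultimately show "pt x \<in> ray (pt s2)" unfolding ray_def by (intro CollectI exI conjI)
  qed
qed

section \<open>The criterion, with rays given by vanishing determinants\<close>

definition bar where "bar = {x. \<forall>e\<in>S - {0}. x + e \<in> S}"

lemma S_subset_bar: "x \<in> S \<Longrightarrow> x \<in> bar"
  unfolding bar_def using add_S by auto

text \<open>Adding s1 leaves \<open>pdet s1 x\<close> unchanged and adding s2 leaves
  \<open>pdet x s2\<close> unchanged, so both signs can be read off in S.\<close>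

lemma bar_subset_cone: assumes "x \<in> bar" shows "x \<in> dcone"
proof -
  have "x + s1 \<in> S" "x + s2 \<in> S"
    using assms s1_S s2_S s1_nonzero s2_nonzero by (auto simp: bar_def)
  then have "0 \<le> pdet s1 (x + s1)" "0 \<le> pdet (x + s2) s2" using S_cone by blast+
  then show ?thesis by (simp add: mem_cone_det)
qed

lemma bar_add: assumes "x \<in> bar" "y \<in> bar" shows "x + y \<in> bar"
  unfolding bar_def
proof (intro CollectI ballI)
  fix e assume e: "e \<in> S - {0}"
  then have "y + e \<in> S - {0}" using assms(2) by (auto simp: bar_def prod_eq_iff)
  then have "x + (y + e) \<in> S" using assms(1) by (simp only: bar_def mem_Collect_eq)
  then show "x + y + e \<in> S" by (simp add: add.assoc)
qed

lemma buchsbaum_criterion: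
  "buchsbaum_ring (rng (supported S :: 'k::field poly poly set)) \<longleftrightarrow>
    {x \<in> dcone. pdet s1 x \<noteq> 0 \<and> pdet x s2 \<noteq> 0} \<subseteq> bar \<and>
    (\<exists>g. {x \<in> bar. pdet s1 x = 0} = submonoid_gen {g}) \<and>
    (\<exists>g. {x \<in> bar. pdet x s2 = 0} = submonoid_gen {g})"
proof (intro iffI conjI)
  assume B: "buchsbaum_ring (rng (supported S :: 'k::field poly poly set))"
  have barI: "x \<in> bar"
    if "\<forall>N\<ge>N1. x + smul N s1 \<in> S" "\<forall>N\<ge>N2. x + smul N s2 \<in> S" for x N1 N2
  proof -
    let ?N = "max 1 (max N1 N2)"
    have "x + smul ?N s1 \<in> S" "x + smul ?N s2 \<in> S" "0 < ?N" using that by auto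
    then show ?thesis unfolding bar_def using buchsbaum_imp[OF B, of ?N x] by simp
  qed
  have off_ray: "\<exists>N0. \<forall>N\<ge>N0. x + smul N h \<in> S"
    if xc: "x \<in> dcone" and hS: "h \<in> S" "h \<noteq> 0" and hx: "pdet h x \<noteq> 0" for x h
  proof -
    obtain i0 :: nat where i0: "norm (pt h - real i0 *\<^sub>R c) \<le> real i0 * r"
      using hS(1) unfolding mem_S by blast
    moreover have "i0 > 0" using i0 hS(2) pt_eq_iff[of h 0] by (intro gr0I) simp
    moreover obtain d where "d > 0" "smul d x \<in> S" using xc unfolding mem_cone by blast
    ultimately show ?thesis using eventually_in_S hx by blast
  qed
  show "{x \<in> dcone. pdet s1 x \<noteq> 0 \<and> pdet x s2 \<noteq> 0} \<subseteq> bar"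
  proof
    fix x assume "x \<in> {x \<in> dcone. pdet s1 x \<noteq> 0 \<and> pdet x s2 \<noteq> 0}"
    then have "x \<in> dcone" "pdet s1 x \<noteq> 0" "pdet s2 x \<noteq> 0" by (auto simp: pdet_swap[of s2])
    then obtain N1 N2 where "\<forall>N\<ge>N1. x + smul N s1 \<in> S" "\<forall>N\<ge>N2. x + smul N s2 \<in> S"
      using off_ray[OF _ s1_S s1_nonzero] off_ray[OF _ s2_S s2_nonzero] by metis
    then show "x \<in> bar" by (rule barI)
  qed
  \<comment> \<open>h' spans the other ray; allowing both orders treats the two rays at
    once.\<close>
  have ray_bar: "\<exists>g. {x \<in> bar. pdet h x = 0} = submonoid_gen {g}"
    if h: "h \<in> S" "h \<noteq> 0" and h': "h' \<in> S" "h' \<noteq> 0" and hh: "(h, h') = (s1, s2) \<or> (h, h') = (s2, s1)"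
    for h h'
  proof (rule ray_monoid_singly_generated)
    have par: "pdet x y = 0" if hx: "pdet h x = 0" and hy: "pdet h y = 0" for x y
    proof -
      obtain k l where k: "k > 0" "smul k x = smul l h" using parallel_scaled[OF hx h(2)] .
      have "int k * pdet x y = pdet (smul k x) y" by simp
      also have "\<dots> = 0" unfolding k(2) using hy by simp
      finally show ?thesis using k(1) by simp
    qed
    have ray_cone: "x \<in> dcone" if hx: "pdet h x = 0" for x
    proof -
      obtain k l where "k > 0" "smul k x = smul l h" using parallel_scaled[OF hx h(2)] .
      then show ?thesis unfolding mem_cone using smul_S[OF h(1), of l] by metis
    qed
    show "0 \<in> {x \<in> bar. pdet h x = 0}" using S_subset_bar[OF zero_S] by simp
    show "x + y \<in> {x \<in> bar. pdet h x = 0}"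
      if "x \<in> {x \<in> bar. pdet h x = 0}" "y \<in> {x \<in> bar. pdet h x = 0}" for x y
      using that bar_add by simp
    show "pdet x y = 0" if "x \<in> {x \<in> bar. pdet h x = 0}" "y \<in> {x \<in> bar. pdet h x = 0}" for x y
      using that par by blast
    fix x y assume xy: "x + y \<in> {x \<in> bar. pdet h x = 0}" "y \<in> {x \<in> bar. pdet h x = 0}"
    then have hx: "pdet h x = 0" by simp
    obtain i0 :: nat where i0: "norm (pt h - real i0 *\<^sub>R c) \<le> real i0 * r"
      using h(1) unfolding mem_S by blast
    have i0_pos: "i0 > 0" using i0 h(2) pt_eq_iff[of h 0] by (intro gr0I) simp
    define u where "u = pt h - real i0 *\<^sub>R c"
    have "x \<in> bar"
    \<comment> \<open>The condition says that the ray of h touches i0 C at h.\<close>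
    proof (cases "norm u = real i0 * r \<and> u \<bullet> pt h = 0")
      case True
      \<comment> \<open>i C touches the ray only at (i/i0) h, so every element of S on the ray
        becomes a multiple of h after scaling by i0.\<close>
      have tan: "\<exists>i. smul i0 z = smul i h" if z: "z \<in> S" "pdet h z = 0" for z
      proof -
        obtain i :: nat where i: "norm (pt z - real i *\<^sub>R c) \<le> real i * r" using z(1) unfolding mem_S by blast
        obtain k l where k: "k > 0" "smul k z = smul l h" using parallel_scaled[OF z(2) h(2)] .
        have "real k * (u \<bullet> pt z) = u \<bullet> pt (smul k z)" by simp
        also have "\<dots> = 0" unfolding k(2) using True by simp
        finally have "u \<bullet> pt z = 0" using k(1) by simp
        from tangent(2)[where h = h and ?i0.0 = i0, folded u_def, OF conjunct1[OF True] conjunct2[OF True] i0_pos i this]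
        have "pt (smul i0 z) = pt (smul i h)" by simp
        then show ?thesis unfolding pt_eq_iff by blast
      qed
      \<comment> \<open>x + y and y are known to lie in \<open>bar\<close> only; the summand h moves
        both into S.\<close>
      have "x + y + h \<in> S" "y + h \<in> S" using xy h unfolding bar_def by auto
      moreover have "pdet h (x + y + h) = 0" "pdet h (y + h) = 0" using xy by simp_all
      ultimately obtain i j where ij: "smul i0 (x + y + h) = smul i h" "smul i0 (y + h) = smul j h"
        using tan by metis
      have "smul i0 x + smul j h = smul i h" using ij by (simp add: smul_add_right add.assoc)
      then have "smul i0 x \<in> range (\<lambda>n. smul n h)" by (rule smul_range_diff) auto
      then obtain n where n: "smul i0 x = smul n h" by blast
      have "real i0 *\<^sub>R (pt x - (real n / real i0) *\<^sub>R pt h) = 0"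
      proof -
        have "pt (smul i0 x) = pt (smul n h)" by (simp only: n)
        then show ?thesis using i0_pos by (simp add: scaleR_right_diff_distrib)
      qed
      then have x: "real i0 *\<^sub>R pt x = real n *\<^sub>R pt h" using i0_pos by (simp add: scaleR_right_diff_distrib)
      \<comment> \<open>i0 x = n h makes x the point of tangency of n C, which lies on its boundary
        and hence in S.\<close>
      have "real i0 *\<^sub>R (pt x - real n *\<^sub>R c) = real n *\<^sub>R u"
        unfolding u_def by (simp add: scaleR_right_diff_distrib x mult.commute)
      then have "real i0 * norm (pt x - real n *\<^sub>R c) = real n * norm u"
        by (metis abs_of_nat norm_scaleR)
      then have "real i0 * norm (pt x - real n *\<^sub>R c) = real i0 * (real n * r)" using True by (simp add: mult_ac)
      then have "norm (pt x - real n *\<^sub>R c) = real n * r" using i0_pos by simp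
      then have "x \<in> S" unfolding mem_S by (intro exI[of _ n]) simp
      then show ?thesis by (rule S_subset_bar)
    next
      case False
      have xc: "x \<in> dcone" by (rule ray_cone[OF hx])
      obtain d where d: "d > 0" "smul d x \<in> S" using xc unfolding mem_cone by blast
      \<comment> \<open>Off tangency the last condition of \<open>eventually_in_S\<close> is
        vacuous, so x may lie on the ray of h itself.\<close>
      obtain N1 where N1: "\<forall>N\<ge>N1. x + smul N h \<in> S"
        using eventually_in_S[OF i0 i0_pos d(2,1)] False unfolding u_def by blast
      show ?thesis
      proof (cases "x = 0")
        case True
        then show ?thesis using S_subset_bar[OF zero_S] by simp
      next
        case False
        \<comment> \<open>A nonzero point on the ray of h is off the other ray, so translation along
          h' works as in the interior.\<close>
        have "pdet h' x \<noteq> 0"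
        proof
          assume h'x: "pdet h' x = 0"
          obtain k l where k: "k > 0" "smul k x = smul l h'" using parallel_scaled[OF h'x h'(2)] .
          then have "l > 0" using False smul_eq_0_iff[of k x] by (intro gr0I) simp
          have "int l * pdet h h' = pdet h (smul k x)" unfolding k(2) by simp
          also have "\<dots> = 0" using hx by simp
          finally have "pdet h h' = 0" using \<open>l > 0\<close> by simp
          then show False using hh orientation pdet_swap[of s2 s1] by auto
        qed
        then obtain N2 where N2: "\<forall>N\<ge>N2. x + smul N h' \<in> S" using off_ray[OF xc h'] by blast
        show ?thesis using hh barI[of N1 x N2] barI[of N2 x N1] N1 N2 by auto
      qed
    qed
    then show "x \<in> {x \<in> bar. pdet h x = 0}" using hx by simp
  qed
  show "\<exists>g. {x \<in> bar. pdet s1 x = 0} = submonoid_gen {g}"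
    using ray_bar[of s1 s2] s1_S s2_S s1_nonzero s2_nonzero by simp
  have "pdet x s2 = 0 \<longleftrightarrow> pdet s2 x = 0" for x using pdet_swap[of s2 x] by simp
  then show "\<exists>g. {x \<in> bar. pdet x s2 = 0} = submonoid_gen {g}"
    using ray_bar[of s2 s1] s1_S s2_S s1_nonzero s2_nonzero by simp
next
  assume *: "{x \<in> dcone. pdet s1 x \<noteq> 0 \<and> pdet x s2 \<noteq> 0} \<subseteq> bar \<and>
    (\<exists>g. {x \<in> bar. pdet s1 x = 0} = submonoid_gen {g}) \<and>
    (\<exists>g. {x \<in> bar. pdet x s2 = 0} = submonoid_gen {g})"
  then obtain g1 g2 where int: "{x \<in> dcone. pdet s1 x \<noteq> 0 \<and> pdet x s2 \<noteq> 0} \<subseteq> bar"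
    and g1: "{x \<in> bar. pdet s1 x = 0} = range (\<lambda>n. smul n g1)"
    and g2: "{x \<in> bar. pdet x s2 = 0} = range (\<lambda>n. smul n g2)"
    unfolding submonoid_gen_single by blast
  interpret plane_semigroup_module S bar s1 s2
  proof
    show "x + s1 \<in> bar" "x + s2 \<in> bar" if "x \<in> bar" for x
      by (rule bar_add[OF that S_subset_bar[OF s1_S]], rule bar_add[OF that S_subset_bar[OF s2_S]])
    show "S \<subseteq> bar" using S_subset_bar by blast
    show "x + e \<in> S" if "x \<in> bar" "e \<in> S" "e \<noteq> 0" for x e using that by (simp add: bar_def)
    fix \<alpha> \<beta> n m assume ab: "\<alpha> \<in> bar" "\<beta> \<in> bar" "\<alpha> + smul n s2 = \<beta> + smul m s1"
    have pos: "0 \<le> pdet \<beta> s2" "0 \<le> pdet s1 \<alpha>"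
      using bar_subset_cone ab(1,2) by (auto simp: mem_cone_det)
    have "pdet s1 (\<alpha> + smul n s2) = pdet s1 (\<beta> + smul m s1)" by (simp only: ab(3))
    then have det: "pdet s1 \<beta> = pdet s1 \<alpha> + int n * pdet s1 s2" by simp
    \<comment> \<open>\<gamma> = \<beta> - n s2 has determinants \<open>pdet \<beta> s2\<close> and
      \<open>pdet s1 \<alpha>\<close>, both nonnegative. By Cramer's rule its coordinates are
      nonnegative, so the subtraction of naturals does not truncate.\<close>
    have comp: "pdet s1 s2 * (int (fst \<beta>) - int n * int (fst s2)) = pdet \<beta> s2 * int (fst s1) + pdet s1 \<alpha> * int (fst s2)"
      "pdet s1 s2 * (int (snd \<beta>) - int n * int (snd s2)) = pdet \<beta> s2 * int (snd s1) + pdet s1 \<alpha> * int (snd s2)"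
    proof -
      have e: "pdet s1 s2 * int (fst \<beta>) = pdet \<beta> s2 * int (fst s1) + pdet s1 \<beta> * int (fst s2)"
        "pdet s1 s2 * int (snd \<beta>) = pdet \<beta> s2 * int (snd s1) + pdet s1 \<beta> * int (snd s2)"
        by (simp_all add: pdet_def algebra_simps)
      show "pdet s1 s2 * (int (fst \<beta>) - int n * int (fst s2)) = pdet \<beta> s2 * int (fst s1) + pdet s1 \<alpha> * int (fst s2)"
        "pdet s1 s2 * (int (snd \<beta>) - int n * int (snd s2)) = pdet \<beta> s2 * int (snd s1) + pdet s1 \<alpha> * int (snd s2)"
        using e unfolding det by (simp_all add: algebra_simps)
    qed
    have "0 \<le> pdet s1 s2 * (int (fst \<beta>) - int n * int (fst s2))"
      "0 \<le> pdet s1 s2 * (int (snd \<beta>) - int n * int (snd s2))"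
      unfolding comp using pos by simp_all
    then have "int (n * fst s2) \<le> int (fst \<beta>)" "int (n * snd s2) \<le> int (snd \<beta>)"
      using orientation by (simp_all add: zero_le_mult_iff)
    then have le: "n * fst s2 \<le> fst \<beta>" "n * snd s2 \<le> snd \<beta>" by (simp_all only: of_nat_le_iff)
    define \<gamma> where "\<gamma> = (fst \<beta> - n * fst s2, snd \<beta> - n * snd s2)"
    have \<beta>: "\<beta> = \<gamma> + smul n s2" using le by (simp add: \<gamma>_def prod_eq_iff)
    then have \<alpha>: "\<alpha> = \<gamma> + smul m s1" using ab(3) by (simp add: prod_eq_iff)
    have "\<gamma> \<in> dcone" using pos unfolding mem_cone_det \<beta> using \<alpha> by simp
    have "\<gamma> \<in> bar"
    proof -
      consider "pdet s1 \<gamma> \<noteq> 0" "pdet \<gamma> s2 \<noteq> 0" | "pdet s1 \<gamma> = 0" | "pdet \<gamma> s2 = 0" by blast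
      then show ?thesis
      proof cases
        case 1
        then show ?thesis using int \<open>\<gamma> \<in> dcone\<close> by blast
      next
        case 2
        \<comment> \<open>\<gamma> is the difference of two elements of the cyclic monoid on this
          ray.\<close>
        have "\<alpha> \<in> {x \<in> bar. pdet s1 x = 0}" "smul m s1 \<in> {x \<in> bar. pdet s1 x = 0}"
          using ab(1) 2 \<alpha> S_subset_bar[OF smul_S[OF s1_S]] by simp_all
        then have "\<gamma> \<in> {x \<in> bar. pdet s1 x = 0}"
          unfolding g1 using smul_range_diff[OF \<alpha>[symmetric]] by blast
        then show ?thesis by simp
      next
        case 3
        have "\<beta> \<in> {x \<in> bar. pdet x s2 = 0}" "smul n s2 \<in> {x \<in> bar. pdet x s2 = 0}"
          using ab(2) 3 \<beta> S_subset_bar[OF smul_S[OF s2_S]] by simp_all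
        then have "\<gamma> \<in> {x \<in> bar. pdet x s2 = 0}"
          unfolding g2 using smul_range_diff[OF \<beta>[symmetric]] by blast
        then show ?thesis by simp
      qed
    qed
    then show "\<exists>\<gamma>\<in>bar. \<beta> = \<gamma> + smul n s2" using \<beta> by blast
  qed
  show "buchsbaum_ring (rng (supported S :: 'k::field poly poly set))" by (rule buchsbaum)
qed

lemma buchsbaum_iff_rays:
  assumes "minimal_generators gens S"
    and "extremal_ray \<tau>\<^sub>1 (convex_cone hull (pt ` dcone))"
    and "extremal_ray \<tau>\<^sub>2 (convex_cone hull (pt ` dcone))"
    and "\<tau>\<^sub>1 \<noteq> \<tau>\<^sub>2"
  shows "buchsbaum_ring (semigroup_ring S :: 'k::field poly poly ring) \<longleftrightarrow>
    int_part \<tau>\<^sub>1 \<tau>\<^sub>2 dcone = int_part \<tau>\<^sub>1 \<tau>\<^sub>2 (semigroup_bar gens S) \<and>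
    (\<forall>\<tau>\<in>{\<tau>\<^sub>1, \<tau>\<^sub>2}. \<exists>g. on_ray (semigroup_bar gens S) \<tau> = submonoid_gen {g})"
proof -
  have bar: "semigroup_bar gens S = bar"
    unfolding bar_def by (rule semigroup_bar_eq[OF assms(1) add_S])
  have "\<tau>\<^sub>1 = ray (pt s1) \<and> \<tau>\<^sub>2 = ray (pt s2) \<or> \<tau>\<^sub>1 = ray (pt s2) \<and> \<tau>\<^sub>2 = ray (pt s1)"
    using extremal_ray_cases[OF assms(2)] extremal_ray_cases[OF assms(3)] assms(4) by blast
  then have \<tau>: "{\<tau>\<^sub>1, \<tau>\<^sub>2} = {ray (pt s1), ray (pt s2)}" "\<tau>\<^sub>1 \<union> \<tau>\<^sub>2 = ray (pt s1) \<union> ray (pt s2)" by blast+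
  have int: "int_part \<tau>\<^sub>1 \<tau>\<^sub>2 E = {x \<in> E. pdet s1 x \<noteq> 0 \<and> pdet x s2 \<noteq> 0}" if "E \<subseteq> dcone" for E
    unfolding int_part_def \<tau>(2) using that pt_mem_ray by blast
  have ray: "on_ray bar (ray (pt s1)) = {x \<in> bar. pdet s1 x = 0}"
    "on_ray bar (ray (pt s2)) = {x \<in> bar. pdet x s2 = 0}"
    unfolding on_ray_def using bar_subset_cone pt_mem_ray by blast+
  \<comment> \<open>Since \<open>bar\<close> lies in the cone, equality of the interiors amounts to
    one inclusion.\<close>
  have "bar \<subseteq> dcone" using bar_subset_cone by blast
  then have "int_part \<tau>\<^sub>1 \<tau>\<^sub>2 dcone = int_part \<tau>\<^sub>1 \<tau>\<^sub>2 bar \<longleftrightarrow>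
      {x \<in> dcone. pdet s1 x \<noteq> 0 \<and> pdet x s2 \<noteq> 0} \<subseteq> bar"
    unfolding int[OF subset_refl] int[OF \<open>bar \<subseteq> dcone\<close>] by blast
  moreover have "(semigroup_ring S :: 'k poly poly ring) = rng (supported S)"
    by (rule semigroup_ring_eq[OF zero_S add_S])
  ultimately show ?thesis
    unfolding bar \<tau>(1) by (simp add: ray buchsbaum_criterion)
qed

end

theorem proposition4:
  fixes a b r :: real
    and S gens :: "(nat \<times> nat) set"
    and \<tau>\<^sub>1 \<tau>\<^sub>2 :: "(real \<times> real) set"
  assumes "r > 0"
    and "S = disk_semigroup a b r"
    and "affine_semigroup S"
    and "minimal_generators gens S"
    and "simplicial gens S"
    and "extremal_ray \<tau>\<^sub>1 (convex_cone hull (pt ` disk_cone a b r))"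
    and "extremal_ray \<tau>\<^sub>2 (convex_cone hull (pt ` disk_cone a b r))"
    and "steeper \<tau>\<^sub>1 \<tau>\<^sub>2"
  shows "buchsbaum_ring (semigroup_ring S :: 'k::field poly poly ring) \<longleftrightarrow>
           int_part \<tau>\<^sub>1 \<tau>\<^sub>2 (disk_cone a b r) = int_part \<tau>\<^sub>1 \<tau>\<^sub>2 (semigroup_bar gens S) \<and>
           (\<forall>\<tau>\<in>{\<tau>\<^sub>1, \<tau>\<^sub>2}. \<exists>g. on_ray (semigroup_bar gens S) \<tau> = submonoid_gen {g})"
proof -
  obtain s t where st: "s \<in> gens" "t \<in> gens" "s \<noteq> t" "independent {pt s, pt t}"
    "rat_cone (pt ` S) = rat_cone {pt s, pt t}"
    using assms(5) unfolding simplicial_def by blast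
  have "rdet (pt s) (pt t) \<noteq> 0" using st(3,4) by (intro independent_rdet) (simp_all add: pt_eq_iff)
  then have "pdet s t \<noteq> 0" by (simp add: rdet_pt)
  then have "0 < pdet s t \<or> 0 < pdet t s" using pdet_swap[of s t] by linarith
  moreover have "{pt s, pt t} = {pt t, pt s}" by blast
  moreover have "s \<in> S" "t \<in> S"
    using assms(4) st(1,2) generators_mem unfolding minimal_generators_def by blast+
  ultimately obtain s1 s2 where "s1 \<in> S" "s2 \<in> S" "0 < pdet s1 s2"
    "rat_cone (pt ` S) = rat_cone {pt s1, pt s2}"
    using st(5) by metis
  then interpret simplicial_disk a b r s1 s2
    using assms(1,2) by unfold_locales simp_all
  \<comment> \<open>\<open>steeper\<close> is a strict comparison, so no ray is steeper than
    itself.\<close>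
  have "\<tau>\<^sub>1 \<noteq> \<tau>\<^sub>2"
  proof
    assume eq: "\<tau>\<^sub>1 = \<tau>\<^sub>2"
    obtain v where "v \<noteq> 0" "\<tau>\<^sub>1 = {t *\<^sub>R v | t. 0 \<le> t}"
      using assms(6) unfolding extremal_ray_def by blast
    then have "v \<in> \<tau>\<^sub>1 - {0}" by (auto intro!: exI[of _ 1])
    then show False using assms(8) unfolding steeper_def eq by (meson less_irrefl)
  qed
  then show ?thesis
    unfolding assms(2) by (intro buchsbaum_iff_rays assms(6,7)) (use assms(2,4) in simp)
qed

end
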